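(* Let $r\ge2$ and let $\mathcal{P}=\{P,Q\}$ be a set of two distinct $r$-patterns. (i) If $P$ and $Q$ are harmonious, then there are constants $0<c<C$ such that a.a.s. $c\,n^{1/(r-1)}\le z_{\mathcal P}(\mathbb{RM}^{(r)}_{n})\le C\,n^{1/(r-1)}$. (ii) If $P$ and $Q$ form a mismatch, then there are constants $0<c<C$ such that a.a.s. $c\,n^{1/r}\le z_{\mathcal P}(\mathbb{RM}^{(r)}_{n})\le C\,n^{1/r}$. (iii) If neither $P$ nor $Q$ is collectable, then a.a.s. $z_{\mathcal P}(\mathbb{RM}^{(r)}_{n})=z_{\mathcal P}$, where $z_{\mathcal P}$ is the largest size of any $\mathcal P$-clique whatsoever; this is an integer with $2\le z_{\mathcal P}\le 5$.
   Context: An ordered $r$-matching of size $n$ is a set of $n$ pairwise disjoint $r$-element subsets (edges) of a linearly ordered vertex set of size $rn$; $\mathbb{RM}^{(r)}_n$ is a uniformly random ordered $r$-matching on $[rn]$. Matchings are written as words (each edge gets a letter; each vertex is replaced by its edge's letter). An $r$-pattern is an ordered $r$-matching of size 2, written as a word over $\{A,B\}$ with each letter appearing $r$ times and beginning with $A$. Two edges form pattern $P$ if they induce a matching order-isomorphic to $P$. For a set $\mathcal P$ of $r$-patterns, a $\mathcal P$-clique is an ordered matching all of whose pairs of edges form patterns in $\mathcal P$, and $z_{\mathcal P}(M)$ is the largest size of a $\mathcal P$-clique contained in $M$. An $r$-pattern $P$ is collectable if it can be split into consecutive blocks $P=S_1\cdots S_s$ each of the form $A^tB^t$ or $B^tA^t$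 ($t\ge1$; $W^t$ denotes $t$ repetitions); this splitting is unique, and the composition of $P$ is $\lambda_P=(|S_1|/2,\dots,|S_s|/2)$. Two distinct collectable $r$-patterns $P,Q$ are harmonious if $\lambda_P=\lambda_Q$. A pair $\{P,Q\}$ is a mismatch if exactly one of $P,Q$ is collectable, or both are collectable but $\lambda_P\ne\lambda_Q$. "A.a.s." means with probability tending to 1 as $n\to\infty$. *)

theory Defs
  imports "HOL-Probability.Probability"
begin

text \<open>Patterns are words over {A,B}; we encode A as True and B as False.\<close>

definition is_pattern :: "nat \<Rightarrow> bool list \<Rightarrow> bool" where
  "is_pattern r P \<longleftrightarrow> length P = 2 * r \<and> count_list P True = r \<and> P \<noteq> [] \<and> hd P"

definition is_ord_matching :: "nat \<Rightarrow> nat set set \<Rightarrow> bool" where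
  "is_ord_matching r M \<longleftrightarrow> finite M \<and> (\<forall>e\<in>M. finite e \<and> card e = r) \<and>
     (\<forall>e\<in>M. \<forall>f\<in>M. e \<noteq> f \<longrightarrow> e \<inter> f = {})"

definition matchings :: "nat \<Rightarrow> nat \<Rightarrow> nat set set set" where
  "matchings r n = {M. is_ord_matching r M \<and> \<Union>M = {0..<r * n}}"

definition RM :: "nat \<Rightarrow> nat \<Rightarrow> nat set set pmf" where
  "RM r n = pmf_of_set (matchings r n)"

definition pattern_of :: "nat set \<Rightarrow> nat set \<Rightarrow> bool list" where
  "pattern_of e f =
     (let a = (if Min (e \<union> f) \<in> e then e else f)
      in map (\<lambda>x. x \<in> a) (sorted_list_of_set (e \<union> f)))"

definition forms :: "nat set \<Rightarrow> nat set \<Rightarrow> bool list \<Rightarrow> bool" where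
  "forms e f P \<longleftrightarrow> pattern_of e f = P"

definition is_clique :: "nat \<Rightarrow> bool list set \<Rightarrow> nat set set \<Rightarrow> bool" where
  "is_clique r Ps M \<longleftrightarrow> is_ord_matching r M \<and>
     (\<forall>e\<in>M. \<forall>f\<in>M. e \<noteq> f \<longrightarrow> (\<exists>P\<in>Ps. forms e f P))"

definition z_of :: "nat \<Rightarrow> bool list set \<Rightarrow> nat set set \<Rightarrow> nat" where
  "z_of r Ps M = Max {card M' | M'. M' \<subseteq> M \<and> is_clique r Ps M'}"

definition clique_sizes :: "nat \<Rightarrow> bool list set \<Rightarrow> nat set" where
  "clique_sizes r Ps = {card M | M. is_clique r Ps M}"

definition z_global :: "nat \<Rightarrow> bool list set \<Rightarrow> nat" where
  "z_global r Ps = Sup (clique_sizes r Ps)"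

definition block :: "nat \<Rightarrow> bool \<Rightarrow> bool list" where
  "block t b = replicate t b @ replicate t (\<not> b)"

definition has_composition :: "bool list \<Rightarrow> nat list \<Rightarrow> bool" where
  "has_composition P ts \<longleftrightarrow> (\<exists>bs. length bs = length ts \<and> (\<forall>t\<in>set ts. t \<ge> 1) \<and>
      P = concat (map2 block ts bs))"

definition collectable :: "bool list \<Rightarrow> bool" where
  "collectable P \<longleftrightarrow> (\<exists>ts. has_composition P ts)"

definition composition :: "bool list \<Rightarrow> nat list" where
  "composition P = (THE ts. has_composition P ts)"

definition harmonious :: "bool list \<Rightarrow> bool list \<Rightarrow> bool" where
  "harmonious P Q \<longleftrightarrow> P \<noteq> Q \<and> collectable P \<and> collectable Q \<and> composition P = composition Q"

definition mismatch :: "bool list \<Rightarrow> bool list \<Rightarrow> bool" where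
  "mismatch P Q \<longleftrightarrow> (collectable P \<noteq> collectable Q) \<or>
     (collectable P \<and> collectable Q \<and> composition P \<noteq> composition Q)"

definition aas :: "(nat \<Rightarrow> nat set set \<Rightarrow> bool) \<Rightarrow> nat \<Rightarrow> bool" where
  "aas E r \<longleftrightarrow> ((\<lambda>n. measure_pmf.prob (RM r n) {M. E n M}) \<longlonglongrightarrow> 1)"

end

(* Upper bounds come from the first moment: k given disjoint edges all occur with probability at
   most (e/n)^((r-1)k), so it suffices to count the cliques of size k in [rn].  If P and Q are a
   mismatch, there are i < j such that the intervals spanned by the i-th and j-th vertices of two
   edges are disjoint for one pattern and meet for the other; the sets of l-th vertices then
   determine these intervals, hence all patterns, hence the clique, which leaves at most
   binom(rn, k)^r cliques.  If P and Q are harmonious, one also has to know how the first vertices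
   are matched to the vertices at one position where P and Q differ, which costs a factor k!.

   For lower bounds, put the rn vertices into boxes so that every edge meeting the boxes correctly
   has a label (i, j) with i, j < k, and edges with different i and different j form P or Q (for a
   single collectable pattern only the labels (i, i) are used).  Chebyshev's inequality gives
   order k labelled edges, and by the first moment these cannot be covered by a small
   proportion of the rows and columns, so a maximal rook placement among them has order k.

   A non-collectable pattern admits no clique of size 3, so R(3,3) = 6 bounds the cliques in case
   (iii), and any fixed matching appears a.a.s. by finding its blown-up edges one by one. *)

theory Submission
  imports Defs "HOL-Real_Asymp.Real_Asymp"
begin

section \<open>Words, patterns and vertices\<close>

text \<open>The rates come from one comparison. If at most N^(rk) / k!^s cliques of size k fit into
  [N], then for N = rn their expected number in the random matching is at most (const * n / k^s)^k,
  so sizes beyond a constant times n^(1/s) die out; a mismatch gives s = r, a harmonious pair s = r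
  - 1. What singles out collectable words is the relation \<open>separated\<close>: in such a word
  two positions are separated exactly when they lie in one block, so the relation returns the
  composition, and a word with the same relation is collectable too. Hence a mismatch must show in
  this relation, while harmonious patterns differ only in the orientation of blocks. The obstacle in
  the lower bound is that the number of labelled edges does not tell whether they crowd into few
  rows and columns. There are at most 4^k choices of a set of rows and a set of columns, and the
  density allowed to these sets is taken so small that the first moment beats this factor. Words are
  handled through the comparisons \<open>before\<close>, which turn statements about patterns into
  inequalities between vertices.\<close>

text \<open>The i-th A of the word precedes its m-th B, counting from 0.\<close>

fun before :: "bool list \<Rightarrow> nat \<Rightarrow> nat \<Rightarrow> bool" where
  "before [] i m = False"
| "before (x # xs) i m = (if x then i = 0 \<or> before xs (i - 1) m else m \<noteq> 0 \<and> before xs i (m - 1))"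

text \<open>Holds for all indices because the recursion places missing letters at infinity: a
  missing A precedes nothing, and every existing A precedes a missing B.\<close>

lemma before_mono: "before P i m \<Longrightarrow> i' \<le> i \<Longrightarrow> m \<le> m' \<Longrightarrow> before P i' m'"
proof (induction P arbitrary: i m i' m')
  case (Cons x P)
  show ?case
  proof (cases x)
    case True
    then show ?thesis using Cons.prems Cons.IH[of "i - 1" m "i' - 1" m'] by (cases i') auto
  next
    case False
    then show ?thesis using Cons.prems Cons.IH[of i "m - 1" i' "m' - 1"] by (cases m; cases m') auto
  qed
qed simp

text \<open>The bridge from words to vertices. As \<open>s\<close> is increasing, its head precedes
  everything else, and dropping it shifts exactly one of the two filtered lists.\<close>

lemma before_map_iff:
  fixes s :: "nat list"
  assumes "sorted_wrt (<) s" "i < length (filter p s)" "m < length (filter (\<lambda>x. \<not> p x) s)"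
  shows "before (map p s) i m \<longleftrightarrow> filter p s ! i < filter (\<lambda>x. \<not> p x) s ! m"
  using assms
proof (induction s arbitrary: i m)
  case (Cons x s)
  have gt: "x < y" if "y \<in> set s" for y using Cons.prems that by auto
  show ?case
  proof (cases "p x")
    case True
    then have m: "m < length (filter (\<lambda>x. \<not> p x) s)" using Cons.prems by auto
    then have "filter (\<lambda>x. \<not> p x) s ! m \<in> set s" using nth_mem by fastforce
    then have "x < filter (\<lambda>x. \<not> p x) s ! m" by (rule gt)
    then show ?thesis using True Cons m by (cases i) auto
  next
    case False
    then have i: "i < length (filter p s)" using Cons.prems by auto
    then have "filter p s ! i \<in> set s" using nth_mem by fastforce
    then have "x < filter p s ! i" by (rule gt)
    then show ?thesis using False Cons i by (cases m) auto
  qed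
qed simp

text \<open>As long as both letters occur, the comparison at (0, 0) shows the first letter; removing
  it shifts one index, so the comparisons rebuild the word.\<close>

lemma before_eqI:
  assumes "count_list xs True = count_list ys True" "count_list xs False = count_list ys False"
    and "\<And>i m. i < count_list xs True \<Longrightarrow> m < count_list xs False \<Longrightarrow> before xs i m = before ys i m"
  shows "xs = ys"
  using assms
proof (induction xs arbitrary: ys)
  case Nil
  then show ?case by (cases ys; cases "hd ys") auto
next
  case (Cons x xs)
  then obtain y ys' where ys: "ys = y # ys'" by (cases ys; cases x) auto
  have xy: "x = y"
  proof (rule ccontr)
    assume "x \<noteq> y"
    then show False using Cons.prems(1,2) Cons.prems(3)[of 0 0] ys by (cases x; cases y) auto
  qed
  have "before xs i m = before ys' i m" if "i < count_list xs True" "m < count_list xs False" for i m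
    using Cons.prems(3)[of "if x then Suc i else i" "if x then m else Suc m"] that ys xy
    by (cases x) auto
  then show ?case using Cons.IH[of ys'] Cons.prems(1,2) ys xy by (cases x) auto
qed

lemma count_list_False: "count_list xs False = length xs - count_list xs True"
  by (induction xs) (auto simp: Suc_diff_le count_le_length)

section \<open>Vertices of an edge in increasing order, and patterns read off from them\<close>

definition vx :: "nat set \<Rightarrow> nat \<Rightarrow> nat" where
  "vx e l = sorted_list_of_set e ! l"

lemma vx_mem: "finite e \<Longrightarrow> l < card e \<Longrightarrow> vx e l \<in> e"
  unfolding vx_def by (metis length_sorted_list_of_set nth_mem set_sorted_list_of_set)

lemma vx_less: "finite e \<Longrightarrow> l < l' \<Longrightarrow> l' < card e \<Longrightarrow> vx e l < vx e l'"
  unfolding vx_def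
  by (metis length_sorted_list_of_set sorted_wrt_nth_less strict_sorted_list_of_set)

lemma vx_image: "finite e \<Longrightarrow> vx e ` {..<card e} = e"
proof -
  assume "finite e"
  then have "set (sorted_list_of_set e) = e" "length (sorted_list_of_set e) = card e" by auto
  then show ?thesis unfolding vx_def by (metis nth_image order_refl take_all lessThan_atLeast0)
qed

lemma vx_unique:
  fixes g :: "nat \<Rightarrow> nat"
  assumes "strict_mono_on {..<r} g" "l < r"
  shows "vx (g ` {..<r}) l = g l"
proof -
  have s: "sorted_wrt (<) (map g [0..<r])"
    using assms(1) by (auto simp: sorted_wrt_iff_nth_less strict_mono_on_def)
  have "sorted_list_of_set (set (map g [0..<r])) = map g [0..<r]"
    using s sorted_list_of_set.idem_if_sorted_distinct strict_sorted_iff by blast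
  moreover have "set (map g [0..<r]) = g ` {..<r}" by (auto simp: atLeast0LessThan)
  ultimately show ?thesis using assms(2) unfolding vx_def by (metis add_0 diff_zero nth_map_upt)
qed

definition redge :: "nat \<Rightarrow> nat set \<Rightarrow> bool" where
  "redge r e \<longleftrightarrow> finite e \<and> card e = r"

lemma filter_sorted_list_of_set:
  fixes V :: "nat set"
  shows "finite V \<Longrightarrow> filter p (sorted_list_of_set V) = sorted_list_of_set {x \<in> V. p x}"
proof -
  assume "finite V"
  then have "set (filter p (sorted_list_of_set V)) = {x \<in> V. p x}" by auto
  moreover have "sorted (filter p (sorted_list_of_set V))" "distinct (filter p (sorted_list_of_set V))"
    by (auto intro: sorted_filter[of "\<lambda>x. x", simplified])
  ultimately show ?thesis
    by (metis sorted_list_of_set.idem_if_sorted_distinct)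
qed

text \<open>Keeps \<open>e\<close> in the role of A whichever edge comes first; it agrees with
  \<open>pattern_of\<close> when \<open>e\<close> has the smaller first vertex.\<close>

definition oriented :: "nat set \<Rightarrow> nat set \<Rightarrow> bool list" where
  "oriented e f = map (\<lambda>x. x \<in> e) (sorted_list_of_set (e \<union> f))"

lemma before_oriented:
  assumes "redge r e" "redge r f" "e \<inter> f = {}" "i < r" "m < r"
  shows "before (oriented e f) i m \<longleftrightarrow> vx e i < vx f m"
proof -
  let ?s = "sorted_list_of_set (e \<union> f)"
  have fin: "finite (e \<union> f)" using assms by (auto simp: redge_def)
  have 1: "filter (\<lambda>x. x \<in> e) ?s = sorted_list_of_set e"
    unfolding filter_sorted_list_of_set[OF fin] by (rule arg_cong[where f = sorted_list_of_set]) auto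
  have 2: "filter (\<lambda>x. \<not> x \<in> e) ?s = sorted_list_of_set f"
    unfolding filter_sorted_list_of_set[OF fin]
    by (rule arg_cong[where f = sorted_list_of_set]) (use assms in auto)
  show ?thesis
    unfolding oriented_def vx_def
    using before_map_iff[of ?s i "\<lambda>x. x \<in> e" m] assms unfolding 1 2 redge_def by auto
qed

lemma count_oriented:
  assumes "redge r e" "redge r f" "e \<inter> f = {}"
  shows "count_list (oriented e f) True = r" "length (oriented e f) = 2 * r"
    "count_list (oriented e f) False = r"
proof -
  have fin: "finite (e \<union> f)" using assms by (auto simp: redge_def)
  have 1: "filter (\<lambda>x. x \<in> e) (sorted_list_of_set (e \<union> f)) = sorted_list_of_set e"
    unfolding filter_sorted_list_of_set[OF fin] by (rule arg_cong[where f = sorted_list_of_set]) auto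
  have c: "count_list (map p xs) True = length (filter p xs)" for p and xs :: "nat list"
    by (induction xs) auto
  show *: "count_list (oriented e f) True = r" unfolding oriented_def c 1 using assms by (auto simp: redge_def)
  show **: "length (oriented e f) = 2 * r"
    unfolding oriented_def using assms by (auto simp: redge_def card_Un_disjoint)
  show "count_list (oriented e f) False = r" using * ** by (simp add: count_list_False)
qed

lemma Min_eq_vx:
  assumes "redge r e" "r \<ge> 1" shows "Min e = vx e 0"
proof (rule Min_eqI)
  show "finite e" using assms by (auto simp: redge_def)
  then show "vx e 0 \<in> e" using assms by (auto simp: redge_def intro: vx_mem)
  fix y assume "y \<in> e"
  then obtain l where "l < r" "y = vx e l" using vx_image[of e] assms by (auto simp: redge_def)
  then show "vx e 0 \<le> y" using vx_less[of e 0 l] assms by (cases l) (auto simp: redge_def)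
qed

lemma pattern_of_oriented:
  assumes "redge r e" "redge r f" "e \<inter> f = {}" "r \<ge> 1" "vx e 0 < vx f 0"
  shows "pattern_of e f = oriented e f" "pattern_of f e = oriented e f"
proof -
  have ne: "finite e" "finite f" "e \<noteq> {}" "f \<noteq> {}" using assms by (auto simp: redge_def)
  have "Min (e \<union> f) = vx e 0"
    using assms ne by (simp add: Min_Un Min_eq_vx[of r])
  then have "Min (e \<union> f) \<in> e" using assms by (auto simp: redge_def intro: vx_mem)
  then show "pattern_of e f = oriented e f" "pattern_of f e = oriented e f"
    using assms(3) by (auto simp: pattern_of_def oriented_def Un_commute)
qed

lemma vx_less_or_greater:
  assumes "redge r e" "redge r f" "e \<inter> f = {}" "i < r" "m < r"
  shows "vx e i < vx f m \<or> vx f m < vx e i"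
  using assms vx_mem[of e i] vx_mem[of f m] by (metis disjoint_iff linorder_neqE_nat redge_def)

lemma pattern_of_sym:
  assumes "redge r e" "redge r f" "e \<inter> f = {}" "r \<ge> 1"
  shows "pattern_of e f = pattern_of f e"
  using vx_less_or_greater[OF assms(1-3), of 0 0] pattern_of_oriented assms
  by (metis Int_commute less_le_trans zero_less_one)

lemma forms_before:
  assumes "redge r e" "redge r f" "e \<inter> f = {}" "vx e 0 < vx f 0" "forms e f X" "i < r" "m < r"
  shows "vx e i < vx f m \<longleftrightarrow> before X i m"
  using before_oriented[OF assms(1-3)] pattern_of_oriented[OF assms(1-3)] assms
  by (auto simp: forms_def)

text \<open>If e has the smaller i-th vertex then e plays the role of A exactly when A's i-th letter comes first.\<close>

definition rel :: "bool list \<Rightarrow> nat \<Rightarrow> nat \<Rightarrow> nat \<Rightarrow> bool" where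
  "rel X i l m = (if before X i i then before X l m else \<not> before X m l)"

text \<open>Orders two edges by their i-th instead of their first vertices, as is needed when an
  edge is represented by the interval from its i-th to its j-th vertex. If \<open>f\<close> plays A,
  the comparison is the negation of the exchanged one.\<close>

lemma forms_rel:
  assumes "redge r e" "redge r f" "e \<inter> f = {}" "forms e f X" "i < r" "l < r" "m < r"
    and "vx e i < vx f i"
  shows "vx e l < vx f m \<longleftrightarrow> rel X i l m"
proof (cases "vx e 0 < vx f 0")
  case True
  then show ?thesis using forms_before[OF assms(1-3) True assms(4)] assms(5-) by (auto simp: rel_def)
next
  case False
  have fe: "vx f 0 < vx e 0" using False vx_less_or_greater[OF assms(1-3), of 0 0] assms(5) by auto
  have fo: "forms f e X" using assms pattern_of_sym[of r e f] by (auto simp: forms_def)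
  have fi: "f \<inter> e = {}" using assms by auto
  show ?thesis
    using forms_before[OF assms(2,1) fi fe fo, of i i] forms_before[OF assms(2,1) fi fe fo, of m l]
      vx_less_or_greater[OF assms(1-3), of l m] assms(5-) by (auto simp: rel_def)
qed

lemma is_pattern_count:
  "is_pattern r X \<Longrightarrow> count_list X True = r" "is_pattern r X \<Longrightarrow> count_list X False = r"
  by (auto simp: is_pattern_def count_list_False)

lemma formsI:
  assumes "redge r e" "redge r f" "e \<inter> f = {}" "is_pattern r X"
    and "\<And>i m. i < r \<Longrightarrow> m < r \<Longrightarrow> vx e i < vx f m \<longleftrightarrow> before X i m"
  shows "forms e f X"
proof -
  have r: "r \<ge> 1" using assms(4) by (cases r) (auto simp: is_pattern_def)
  have "before X 0 0" using assms(4) by (cases X) (auto simp: is_pattern_def)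
  then have "vx e 0 < vx f 0" using assms(5)[of 0 0] r by auto
  then have "pattern_of e f = oriented e f" using pattern_of_oriented[OF assms(1-3) r] by auto
  moreover have "oriented e f = X"
    by (rule before_eqI)
      (use count_oriented[OF assms(1-3)] is_pattern_count[OF assms(4)] before_oriented[OF assms(1-3)] assms(5) in auto)
  ultimately show ?thesis by (auto simp: forms_def)
qed

text \<open>By \<open>before_eqI\<close> a pattern is nothing but its table of comparisons; this is
  what lets blown-up edges inherit patterns.\<close>

lemma forms_transfer:
  assumes "redge r e" "redge r f" "e \<inter> f = {}" "redge r e'" "redge r f'" "e' \<inter> f' = {}" "r \<ge> 1"
    and eq: "\<And>i m. i < r \<Longrightarrow> m < r \<Longrightarrow> vx e i < vx f m \<longleftrightarrow> vx e' i < vx f' m"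
    and X: "forms e f X"
  shows "forms e' f' X"
proof (cases "vx e 0 < vx f 0")
  case True
  have "oriented e f = oriented e' f'"
    by (rule before_eqI) (use count_oriented[OF assms(1-3)] count_oriented[OF assms(4-6)]
        before_oriented[OF assms(1-3)] before_oriented[OF assms(4-6)] eq in auto)
  then show ?thesis using pattern_of_oriented(1)[OF assms(1-3,7) True]
      pattern_of_oriented(1)[OF assms(4-7)] True eq[of 0 0] assms(7) X by (auto simp: forms_def)
next
  case False
  have i: "f \<inter> e = {}" "f' \<inter> e' = {}" using assms by auto
  have lt: "vx f 0 < vx e 0" using False vx_less_or_greater[OF assms(1-3), of 0 0] assms(7) by auto
  have lt': "vx f' 0 < vx e' 0"
    using False eq[of 0 0] vx_less_or_greater[OF assms(4-6), of 0 0] assms(7) by auto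
  have "vx f i < vx e m \<longleftrightarrow> vx f' i < vx e' m" if "i < r" "m < r" for i m
    using eq[of m i] that vx_less_or_greater[OF assms(1-3), of m i] vx_less_or_greater[OF assms(4-6), of m i] by auto
  then have "oriented f e = oriented f' e'"
    by (intro before_eqI) (use count_oriented[OF assms(2,1) i(1)] count_oriented[OF assms(5,4) i(2)]
        before_oriented[OF assms(2,1) i(1)] before_oriented[OF assms(5,4) i(2)] in auto)
  then show ?thesis using pattern_of_oriented(2)[OF assms(2,1) i(1) assms(7) lt]
      pattern_of_oriented(2)[OF assms(5,4) i(2) assms(7) lt'] X by (auto simp: forms_def)
qed

section \<open>Cliques determined by coordinate data\<close>

lemma matching_redge:
  assumes "is_ord_matching r M"
  shows "finite M" "e \<in> M \<Longrightarrow> redge r e" "e \<in> M \<Longrightarrow> f \<in> M \<Longrightarrow> e \<noteq> f \<Longrightarrow> e \<inter> f = {}"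
  using assms by (auto simp: is_ord_matching_def redge_def)

lemma clique_subset: "is_clique r Ps M \<Longrightarrow> M' \<subseteq> M \<Longrightarrow> is_clique r Ps M'"
  unfolding is_clique_def is_ord_matching_def using finite_subset by (auto simp: subset_iff)

lemma clique_matching: "is_clique r Ps M \<Longrightarrow> is_ord_matching r M"
  by (auto simp: is_clique_def)

lemma inj_on_vx:
  assumes "is_ord_matching r M" "l < r" shows "inj_on (\<lambda>e. vx e l) M"
proof (rule inj_onI)
  fix e f assume "e \<in> M" "f \<in> M" "vx e l = vx f l"
  then show "e = f" using matching_redge[OF assms(1)] vx_less_or_greater[of r e f l l] assms(2) by auto
qed

lemma redge_eqI:
  assumes "redge r e" "redge r f" "\<And>l. l < r \<Longrightarrow> vx e l = vx f l" shows "e = f"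
proof -
  have "vx e ` {..<r} = e" "vx f ` {..<r} = f" using assms(1,2) vx_image by (metis redge_def)+
  then show ?thesis using assms(3) by (metis (no_types, lifting) image_cong lessThan_iff)
qed

text \<open>An order-preserving bijection of a set of natural numbers onto itself is the identity;
  the induction runs over the values of \<open>u\<close>.\<close>

lemma same_order_same_range:
  fixes u v :: "'a \<Rightarrow> nat"
  assumes im: "u ` A = v ` A" and ord: "\<And>x y. x \<in> A \<Longrightarrow> y \<in> A \<Longrightarrow> u x < u y \<longleftrightarrow> v x < v y"
    and "x \<in> A"
  shows "u x = v x"
proof -
  have "\<forall>x\<in>A. u x = n \<longrightarrow> v x = n" for n
  proof (induction n rule: less_induct)
    case (less n)
    show ?case
    proof (intro ballI impI, rule ccontr)
      fix x assume x: "x \<in> A" "u x = n" "v x \<noteq> n"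
      obtain y where y: "y \<in> A" "u y = v x" using im x(1) by (metis image_iff)
      obtain z where z: "z \<in> A" "v z = n" using im x(1,2) by (metis image_iff)
      show False
      \<comment> \<open>In either case one of the two witnesses has a \<open>u\<close>-value below
        \<open>n\<close>, where the induction hypothesis applies.\<close>
      proof (cases "v x < n")
        case True
        then have "v y = v x" using less y by blast
        then show False using ord[OF y(1) x(1)] y(2) x(2) True by linarith
      next
        case False
        then have "u z < n" using ord[OF z(1) x(1)] x z by linarith
        then have "v z = u z" using less z by blast
        then show False using \<open>u z < n\<close> z by linarith
      qed
    qed
  qed
  then show ?thesis using assms(3) by auto
qed

text \<open>Endpoint sets determine both monotone and non-crossing families of intervals:
  at the smallest right endpoint with two different owners, one of the two left endpoints
  would have to be matched again to a smaller right endpoint.\<close>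

lemma pairs_determined_by_endpoints:
  fixes N N' :: "(nat \<times> nat) set"
  assumes "fst ` N = fst ` N'" "snd ` N = snd ` N'"
    and inj: "inj_on fst N" "inj_on fst N'" "inj_on snd N" "inj_on snd N'"
    and c: "(\<forall>K\<in>{N, N'}. \<forall>p\<in>K. \<forall>q\<in>K. fst p < fst q \<longrightarrow> snd p < snd q) \<or>
      (\<forall>K\<in>{N, N'}. \<forall>p\<in>K. \<forall>q\<in>K. fst p < fst q \<and> fst q < snd p \<longrightarrow> snd q < snd p)"
    and lt: "\<forall>K\<in>{N, N'}. \<forall>p\<in>K. fst p < snd p"
  shows "N = N'"
proof -
  \<comment> \<open>The situation is symmetric in \<open>N\<close> and \<open>N'\<close>, so one
    implication, for either order of the two families, gives both inclusions at the right endpoint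
    \<open>y\<close>.\<close>
  have step: "(x, y) \<in> K'"
    if IH: "\<And>x z. z < y \<Longrightarrow> (x, z) \<in> K \<longleftrightarrow> (x, z) \<in> K'" and K: "{K, K'} = {N, N'}"
      and xy: "(x, y) \<in> K" for x y K K'
  proof (rule ccontr)
    assume n: "(x, y) \<notin> K'"
    have KK: "K = N \<and> K' = N' \<or> K = N' \<and> K' = N" using K by (simp add: doubleton_eq_iff)
    then have im: "fst ` K = fst ` K'" "snd ` K = snd ` K'"
      and ij: "inj_on fst K" "inj_on fst K'" "inj_on snd K" "inj_on snd K'"
      using assms(1-2) inj by (elim disjE conjE; simp)+
    have mem: "K \<in> {N, N'}" "K' \<in> {N, N'}" using KK by auto
    have "snd (x, y) \<in> snd ` K'" unfolding im(2)[symmetric] using xy by (rule imageI)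
    then obtain x' where x': "(x', y) \<in> K'" by auto
    then have "x \<noteq> x'" using n by auto
    have "fst (x, y) \<in> fst ` K'" unfolding im(1)[symmetric] using xy by (rule imageI)
    moreover have "fst (x', y) \<in> fst ` K" unfolding im(1) using x' by (rule imageI)
    ultimately obtain w w' where w: "(x, w) \<in> K'" "(x', w') \<in> K" by auto
    have wy: "w \<noteq> y" using n w by auto
    have wy': "w' \<noteq> y" using w(2) xy \<open>x \<noteq> x'\<close> inj_onD[OF ij(3), of "(x', w')" "(x, y)"] by auto
    \<comment> \<open>A partner below \<open>y\<close> would belong to both families by the
      induction hypothesis, giving one left endpoint two right endpoints.\<close>
    have nw: "\<not> w < y" "\<not> w' < y"
      using IH[of w x] IH[of w' x'] w xy x' wy wy' inj_onD[OF ij(1), of "(x, w)" "(x, y)"]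
        inj_onD[OF ij(2), of "(x', w')" "(x', y)"] by auto
    have lt': "x < y" "x' < y" using bspec[OF bspec[OF lt mem(1)] xy] bspec[OF bspec[OF lt mem(2)] x'] by simp_all
    \<comment> \<open>So both partners would lie above \<open>y\<close>; but then, whichever of
      \<open>x\<close>, \<open>x'\<close> is smaller, one of the two families violates its
      condition.\<close>
    have cc: "(x < x' \<longrightarrow> w' > y \<longrightarrow> w > y \<longrightarrow> False) \<and> (x' < x \<longrightarrow> w' > y \<longrightarrow> w > y \<longrightarrow> False)"
    proof (rule disjE[OF c])
      assume "\<forall>K\<in>{N, N'}. \<forall>p\<in>K. \<forall>q\<in>K. fst p < fst q \<longrightarrow> snd p < snd q"
      then have a: "\<forall>p\<in>K. \<forall>q\<in>K. fst p < fst q \<longrightarrow> snd p < snd q"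
        "\<forall>p\<in>K'. \<forall>q\<in>K'. fst p < fst q \<longrightarrow> snd p < snd q" using mem by blast+
      show ?thesis using a(1)[rule_format, OF w(2) xy] a(2)[rule_format, OF w(1) x'] by auto
    next
      assume "\<forall>K\<in>{N, N'}. \<forall>p\<in>K. \<forall>q\<in>K. fst p < fst q \<and> fst q < snd p \<longrightarrow> snd q < snd p"
      then have a: "\<forall>p\<in>K. \<forall>q\<in>K. fst p < fst q \<and> fst q < snd p \<longrightarrow> snd q < snd p"
        "\<forall>p\<in>K'. \<forall>q\<in>K'. fst p < fst q \<and> fst q < snd p \<longrightarrow> snd q < snd p"
        using mem by blast+
      show ?thesis using a(1)[rule_format, OF xy w(2)] a(2)[rule_format, OF x' w(1)] lt' by auto
    qed
    then show False using nw wy wy' \<open>x \<noteq> x'\<close> by auto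
  qed
  have "\<forall>x. (x, y) \<in> N \<longleftrightarrow> (x, y) \<in> N'" for y
  proof (induction y rule: less_induct)
    case (less y)
    show ?case
    proof (intro allI iffI)
      fix x
      show "(x, y) \<in> N'" if "(x, y) \<in> N" by (rule step[OF _ _ that]) (use less in auto)
      show "(x, y) \<in> N" if "(x, y) \<in> N'" by (rule step[OF _ _ that]) (use less in auto)
    qed
  qed
  then show ?thesis by auto
qed

definition coord :: "nat set set \<Rightarrow> nat \<Rightarrow> nat set" where
  "coord M l = (\<lambda>e. vx e l) ` M"

definition coord_pairs :: "nat \<Rightarrow> nat \<Rightarrow> nat set set \<Rightarrow> (nat \<times> nat) set" where
  "coord_pairs i j M = (\<lambda>e. (vx e i, vx e j)) ` M"

text \<open>The common pairs match each edge of \<open>M\<close> with the edge of \<open>M'\<close>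
  that has the same i-th and j-th vertices. Matched pairs of edges form the same pattern, so for
  every \<open>l\<close> the l-th vertices are ordered alike, and equal coordinate sets then force
  equal l-th vertices.\<close>

lemma clique_eqI_aux:
  assumes M: "is_ord_matching r M" "is_ord_matching r M'"
    and ij: "i < r" "j < r" and N: "coord_pairs i j M = coord_pairs i j M'"
    and V: "\<And>l. l < r \<Longrightarrow> coord M l = coord M' l"
    and det: "\<And>K e f. K \<in> {M, M'} \<Longrightarrow> e \<in> K \<Longrightarrow> f \<in> K \<Longrightarrow> vx e i < vx f i \<Longrightarrow>
       forms e f (pat (vx e i) (vx e j) (vx f i) (vx f j))"
  shows "M \<subseteq> M'"
proof
  define g where "g e = (THE e'. e' \<in> M' \<and> vx e' i = vx e i)" for e
  have g: "g e \<in> M'" "vx (g e) i = vx e i" "vx (g e) j = vx e j" if "e \<in> M" for e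
  proof -
    have "(vx e i, vx e j) \<in> coord_pairs i j M'" using that N unfolding coord_pairs_def by auto
    then obtain e' where e': "e' \<in> M'" "vx e' i = vx e i" "vx e' j = vx e j"
      by (auto simp: coord_pairs_def)
    have "g e = e'" unfolding g_def
      by (rule the_equality) (use e' inj_on_vx[OF M(2) ij(1)] in \<open>auto simp: inj_on_def\<close>)
    then show "g e \<in> M'" "vx (g e) i = vx e i" "vx (g e) j = vx e j" using e' by auto
  qed
  have gim: "g ` M = M'"
  proof
    show "g ` M \<subseteq> M'" using g by auto
    show "M' \<subseteq> g ` M"
    proof
      fix e' assume e': "e' \<in> M'"
      then have "vx e' i \<in> coord M i" using V[OF ij(1)] by (auto simp: coord_def)
      then obtain e where "e \<in> M" "vx e i = vx e' i" by (auto simp: coord_def)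
      then have "g e = e'" using g[of e] e' inj_on_vx[OF M(2) ij(1)] by (auto simp: inj_on_def)
      then show "e' \<in> g ` M" using \<open>e \<in> M\<close> by auto
    qed
  qed
  have ord: "vx e l < vx f l \<longleftrightarrow> vx (g e) l < vx (g f) l"
    if ef: "e \<in> M" "f \<in> M" and l: "l < r" for e f l
  proof -
    have *: "(vx e l < vx f l \<longleftrightarrow> vx (g e) l < vx (g f) l) \<and> (vx f l < vx e l \<longleftrightarrow> vx (g f) l < vx (g e) l)"
      if ef: "e \<in> M" "f \<in> M" and lt: "vx e i < vx f i" for e f
    proof -
      let ?X = "pat (vx e i) (vx e j) (vx f i) (vx f j)"
      have ne: "e \<noteq> f" "g e \<noteq> g f" using lt g(2)[OF ef(1)] g(2)[OF ef(2)] by auto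
      have lt': "vx (g e) i < vx (g f) i" using lt g ef by auto
      have F: "forms e f ?X" using det[of M e f] ef lt by auto
      have F': "forms (g e) (g f) ?X"
        using det[of M' "g e" "g f"] g(1)[OF ef(1)] g(1)[OF ef(2)] lt' g ef by auto
      note R = matching_redge[OF M(1)] and R' = matching_redge[OF M(2)]
      have 1: "vx e l < vx f l \<longleftrightarrow> rel ?X i l l"
        using forms_rel[OF R(2)[OF ef(1)] R(2)[OF ef(2)] R(3)[OF ef ne(1)] F ij(1) l l lt] .
      have 2: "vx (g e) l < vx (g f) l \<longleftrightarrow> rel ?X i l l"
        using forms_rel[OF R'(2)[OF g(1)[OF ef(1)]] R'(2)[OF g(1)[OF ef(2)]]
            R'(3)[OF g(1)[OF ef(1)] g(1)[OF ef(2)] ne(2)] F' ij(1) l l lt'] .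
      have 3: "vx e l < vx f l \<or> vx f l < vx e l"
        using vx_less_or_greater[OF R(2)[OF ef(1)] R(2)[OF ef(2)] R(3)[OF ef ne(1)] l l] .
      have 4: "vx (g e) l < vx (g f) l \<or> vx (g f) l < vx (g e) l"
        using vx_less_or_greater[OF R'(2)[OF g(1)[OF ef(1)]] R'(2)[OF g(1)[OF ef(2)]]
            R'(3)[OF g(1)[OF ef(1)] g(1)[OF ef(2)] ne(2)] l l] .
      show ?thesis using 1 2 3 4 by auto
    qed
    have "vx e i < vx f i \<or> vx f i < vx e i \<or> e = f"
      using inj_on_vx[OF M(1) ij(1)] ef by (metis inj_onD linorder_neqE_nat)
    then show ?thesis using *[of e f] *[of f e] ef by auto
  qed
  fix e assume e: "e \<in> M"
  have "vx e l = vx (g e) l" if l: "l < r" for l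
  proof (rule same_order_same_range[of "\<lambda>e. vx e l" M "\<lambda>e. vx (g e) l"])
    show "(\<lambda>e. vx e l) ` M = (\<lambda>e. vx (g e) l) ` M"
      using V[OF l] unfolding coord_def gim[symmetric] by (simp add: image_image)
  qed (use ord[OF _ _ l] e in auto)
  then have "e = g e"
    by (rule redge_eqI[OF matching_redge(2)[OF M(1) e] matching_redge(2)[OF M(2) g(1)[OF e]]])
  then show "e \<in> M'" using g(1)[OF e] by simp
qed

lemma clique_eqI:
  assumes M: "is_ord_matching r M" "is_ord_matching r M'"
    and ij: "i < r" "j < r" and N: "coord_pairs i j M = coord_pairs i j M'"
    and V: "\<And>l. l < r \<Longrightarrow> coord M l = coord M' l"
    and det: "\<And>K e f. K \<in> {M, M'} \<Longrightarrow> e \<in> K \<Longrightarrow> f \<in> K \<Longrightarrow> vx e i < vx f i \<Longrightarrow>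
       forms e f (pat (vx e i) (vx e j) (vx f i) (vx f j))"
  shows "M = M'"
proof
  show "M \<subseteq> M'" by (rule clique_eqI_aux[OF assms])
  show "M' \<subseteq> M"
    by (rule clique_eqI_aux[OF M(2,1) ij N[symmetric] V[symmetric], where pat=pat]) (use det in auto)
qed

lemma coord_pairs_fst: "fst ` coord_pairs i j M = coord M i" "snd ` coord_pairs i j M = coord M j"
  by (auto simp: coord_pairs_def coord_def image_image)

text \<open>For i \<le> j: the intervals from the i-th to the j-th vertex of the two edges are
  disjoint, with A's interval first in one alternative and B's in the other.\<close>

definition separated :: "bool list \<Rightarrow> nat \<Rightarrow> nat \<Rightarrow> bool" where
  "separated X i j \<longleftrightarrow> before X j i \<or> \<not> before X i j"

lemma clique_forms:
  assumes "is_clique r {P, Q} K" "e \<in> K" "f \<in> K" "e \<noteq> f"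
  shows "forms e f P \<or> forms e f Q"
  using assms by (auto simp: is_clique_def)

text \<open>The pairs reveal all patterns: the first vertices tell which edge plays A, and the j-th
  ones then tell \<open>P\<close> from \<open>Q\<close>. The pairs also carry the coordinate sets at
  0 and \<open>j\<close>, so \<open>V\<close> speaks only of the other coordinates.\<close>

lemma sign_clique_eqI:
  assumes M: "is_clique r {P, Q} M" "is_clique r {P, Q} M'"
    and j: "j < r" and sg: "before P j j \<noteq> before Q j j" "before P 0 0" "before Q 0 0"
    and N: "coord_pairs 0 j M = coord_pairs 0 j M'"
    and V: "\<And>l. l < r \<Longrightarrow> l \<noteq> 0 \<Longrightarrow> l \<noteq> j \<Longrightarrow> coord M l = coord M' l"
  shows "M = M'"
proof -
  have r: "0 < r" using j by auto
  define pat where "pat (a::nat) (b::nat) (c::nat) (d::nat) = (if b < d \<longleftrightarrow> before P j j then P else Q)" for a b c d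
  have V': "coord M l = coord M' l" if "l < r" for l
    using V[of l] that coord_pairs_fst[of 0 j M] coord_pairs_fst[of 0 j M'] unfolding N by auto
  have det: "forms e f (pat (vx e 0) (vx e j) (vx f 0) (vx f j))"
    if K: "K \<in> {M, M'}" and ef: "e \<in> K" "f \<in> K" and lt: "vx e 0 < vx f 0" for K e f
  proof -
    have C: "is_clique r {P, Q} K" using K M by auto
    have ne: "e \<noteq> f" using lt by auto
    note R = matching_redge[OF clique_matching[OF C]]
    have rel: "vx e j < vx f j \<longleftrightarrow> before X j j" if "forms e f X" for X
      using forms_before[OF R(2)[OF ef(1)] R(2)[OF ef(2)] R(3)[OF ef ne] lt that j j] .
    show ?thesis using clique_forms[OF C ef ne] rel[of P] rel[of Q] sg by (auto simp: pat_def)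
  qed
  show ?thesis
    by (rule clique_eqI[OF clique_matching[OF M(1)] clique_matching[OF M(2)] r j N V' det]) auto
qed

text \<open>Of two intervals that meet, whether they are nested or shifted depends only on Y, so the
  lemma on endpoint sets recovers all intervals from their endpoints.\<close>

lemma separated_clique_eqI:
  assumes M: "is_clique r {X, Y} M" "is_clique r {X, Y} M'"
    and ij: "i < j" "j < r" and sep: "separated X i j" "\<not> separated Y i j"
    and V: "\<And>l. l < r \<Longrightarrow> coord M l = coord M' l"
  shows "M = M'"
proof -
  have i: "i < r" using ij by auto
  \<comment> \<open>When \<open>e\<close> has the smaller i-th vertex, its interval ends before that
    of \<open>f\<close> begins under \<open>X\<close> but not under \<open>Y\<close>; this one
    comparison tells the patterns apart.\<close>
  have relX: "rel X i j i"
    using sep(1) before_mono[of X i i i j] before_mono[of X j i i i] ij by (auto simp: separated_def rel_def)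
  have relY: "\<not> rel Y i j i"
    using sep(2) ij by (auto simp: separated_def rel_def)
  define pat where "pat (a::nat) (b::nat) (c::nat) (d::nat) = (if b < c then X else Y)" for a b c d
  have both: "forms e f (pat (vx e i) (vx e j) (vx f i) (vx f j)) \<and>
    (if vx e j < vx f i then True else vx e j < vx f j \<longleftrightarrow> rel Y i j j)"
    if K: "K \<in> {M, M'}" and ef: "e \<in> K" "f \<in> K" and lt: "vx e i < vx f i" for K e f
  proof -
    have C: "is_clique r {X, Y} K" using K M by auto
    have ne: "e \<noteq> f" using lt by auto
    note R = matching_redge[OF clique_matching[OF C]]
    have rel: "vx e l < vx f m \<longleftrightarrow> rel Z i l m" if "forms e f Z" "l < r" "m < r" for Z l m
      using forms_rel[OF R(2)[OF ef(1)] R(2)[OF ef(2)] R(3)[OF ef ne] that(1) i that(2,3) lt] .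
    show ?thesis using clique_forms[OF C ef ne] rel[of X j i] rel[of Y j i] rel[of Y j j] relX relY i ij
      by (auto simp: pat_def)
  qed
  have fstsnd: "fst p < fst q \<Longrightarrow> \<exists>e\<in>K. \<exists>f\<in>K. p = (vx e i, vx e j) \<and> q = (vx f i, vx f j) \<and> vx e i < vx f i"
    if "p \<in> coord_pairs i j K" "q \<in> coord_pairs i j K" for p q K
    using that unfolding coord_pairs_def by force
  have ltK: "vx e i < vx e j" if "e \<in> K" "K \<in> {M, M'}" for e K
    using matching_redge(2)[OF clique_matching[OF M(1)], of e] matching_redge(2)[OF clique_matching[OF M(2)], of e]
      that vx_less[of e i j] ij by (auto simp: redge_def)
  have injK: "inj_on fst (coord_pairs i j K)" "inj_on snd (coord_pairs i j K)" if "K \<in> {M, M'}" for K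
  proof -
    have K: "is_ord_matching r K" using M clique_matching that by auto
    show "inj_on fst (coord_pairs i j K)" "inj_on snd (coord_pairs i j K)"
      using inj_on_vx[OF K i] inj_on_vx[OF K ij(2)] by (auto simp: coord_pairs_def inj_on_def)
  qed
  have N: "coord_pairs i j M = coord_pairs i j M'"
  proof (rule pairs_determined_by_endpoints)
    show "(\<forall>K\<in>{coord_pairs i j M, coord_pairs i j M'}. \<forall>p\<in>K. \<forall>q\<in>K. fst p < fst q \<longrightarrow> snd p < snd q) \<or>
      (\<forall>K\<in>{coord_pairs i j M, coord_pairs i j M'}. \<forall>p\<in>K. \<forall>q\<in>K. fst p < fst q \<and> fst q < snd p \<longrightarrow> snd q < snd p)"
    \<comment> \<open>If intervals meeting under \<open>Y\<close> are shifted, right endpoints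
      increase with left ones for all pairs, disjoint ones included; otherwise meeting intervals are
      nested.\<close>
    proof (cases "rel Y i j j")
      case True
      have "snd p < snd q" if K: "K \<in> {M, M'}" and p: "p \<in> coord_pairs i j K" "q \<in> coord_pairs i j K" "fst p < fst q" for K p q
      proof -
        obtain e f where ef: "e \<in> K" "f \<in> K" "p = (vx e i, vx e j)" "q = (vx f i, vx f j)" "vx e i < vx f i"
          using fstsnd[OF p] by auto
        show ?thesis using both[OF K ef(1,2,5)] ltK[OF ef(2) K] ef True by (auto split: if_splits)
      qed
      then show ?thesis by blast
    next
      case False
      have "snd q < snd p" if K: "K \<in> {M, M'}" and p: "p \<in> coord_pairs i j K" "q \<in> coord_pairs i j K" "fst p < fst q"
        and lt: "fst q < snd p" for K p q
      proof -
        obtain e f where ef: "e \<in> K" "f \<in> K" "p = (vx e i, vx e j)" "q = (vx f i, vx f j)" "vx e i < vx f i"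
          using fstsnd[OF p] by auto
        have K': "is_ord_matching r K" using M clique_matching K by auto
        have "vx e j \<noteq> vx f j" using inj_on_vx[OF K' ij(2)] ef by (auto simp: inj_on_def)
        then show ?thesis using both[OF K ef(1,2,5)] ef False lt by (auto split: if_splits)
      qed
      then show ?thesis by blast
    qed
    show "\<forall>K\<in>{coord_pairs i j M, coord_pairs i j M'}. \<forall>p\<in>K. fst p < snd p"
      using ltK by (auto simp: coord_pairs_def)
  qed (use injK V i ij in \<open>auto simp: coord_pairs_fst\<close>)
  show ?thesis
    by (rule clique_eqI[OF clique_matching[OF M(1)] clique_matching[OF M(2)] i ij(2) N V, where pat=pat])
      (use both in auto)
qed

section \<open>Compositions\<close>

text \<open>Index of the block that holds position \<open>i\<close>. A block contains equally many
  letters of both kinds, so the same function locates the i-th A and the i-th B.\<close>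

fun blk :: "nat list \<Rightarrow> nat \<Rightarrow> nat" where
  "blk [] i = 0"
| "blk (t # ts) i = (if i < t then 0 else Suc (blk ts (i - t)))"

lemma blk_mono: "i \<le> j \<Longrightarrow> blk ts i \<le> blk ts j"
proof (induction ts arbitrary: i j)
  case (Cons t ts)
  then show ?case using Cons.IH[of "i - t" "j - t"] by auto
qed simp

lemma blk_less_length: "i < sum_list ts \<Longrightarrow> blk ts i < length ts"
proof (induction ts arbitrary: i)
  case (Cons t ts)
  then show ?case using Cons.IH[of "i - t"] by auto
qed simp

lemma before_replicate:
  "before (replicate t b @ X) i m = (if b then i < t \<or> before X (i - t) m else t \<le> m \<and> before X i (m - t))"
  by (induction t arbitrary: i m) auto

lemma before_block:
  "before (block t b @ X) i m =
    (if i < t \<and> m < t then b else if i < t then True else if m < t then False else before X (i - t) (m - t))"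
  by (auto simp: block_def before_replicate)

text \<open>Letters in different blocks compare as the blocks do, and inside a block one kind of
  letter entirely precedes the other.\<close>

lemma before_composition:
  assumes "length bs = length ts" "i < sum_list ts" "m < sum_list ts"
  shows "before (concat (map2 block ts bs)) i m \<longleftrightarrow>
    blk ts i < blk ts m \<or> blk ts i = blk ts m \<and> bs ! blk ts i"
  using assms
proof (induction ts bs arbitrary: i m rule: list_induct2')
  case (4 t ts b bs)
  then show ?case using "4.IH"[of "i - t" "m - t"] by (auto simp: before_block)
qed auto

lemma count_block: "count_list (block t b) c = t"
proof -
  have "count_list (replicate t x) c = (if x = c then t else 0)" for x by (induction t) auto
  then show ?thesis by (auto simp: block_def)
qed

lemma count_composition:
  "length bs = length ts \<Longrightarrow> count_list (concat (map2 block ts bs)) c = sum_list ts"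
  by (induction ts bs rule: list_induct2') (auto simp: count_block)

lemma is_pattern_before_0: "is_pattern r X \<Longrightarrow> before X 0 0"
  by (cases X) (auto simp: is_pattern_def)

lemma has_composition_before:
  assumes "is_pattern r X" "has_composition X ts"
  obtains bs where "length bs = length ts" "sum_list ts = r"
    "\<And>i m. i < r \<Longrightarrow> m < r \<Longrightarrow> before X i m \<longleftrightarrow> blk ts i < blk ts m \<or> blk ts i = blk ts m \<and> bs ! blk ts i"
proof -
  obtain bs where bs: "length bs = length ts" "X = concat (map2 block ts bs)"
    using assms(2) by (auto simp: has_composition_def)
  then have s: "sum_list ts = r" using is_pattern_count(1)[OF assms(1)] count_composition by metis
  show ?thesis by (rule that[OF bs(1) s]) (use before_composition[OF bs(1)] bs(2) s in auto)
qed

text \<open>In one block all letters of one kind come first, so the intervals are disjoint; for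
  different blocks both intervals begin in the earlier block and end in the later one, so they
  meet.\<close>

lemma separated_iff_blk:
  assumes "is_pattern r X" "has_composition X ts" "i \<le> j" "j < r"
  shows "separated X i j \<longleftrightarrow> blk ts i = blk ts j"
proof -
  obtain bs where "\<And>i m. i < r \<Longrightarrow> m < r \<Longrightarrow> before X i m \<longleftrightarrow> blk ts i < blk ts m \<or> blk ts i = blk ts m \<and> bs ! blk ts i"
    using has_composition_before[OF assms(1,2)] by metis
  then show ?thesis using assms(3,4) blk_mono[OF assms(3), of ts] by (auto simp: separated_def)
qed

lemma takeWhile_replicate_append:
  "b \<noteq> c \<Longrightarrow> takeWhile (\<lambda>x. x = b) (replicate t b @ c # X) = replicate t b"
  by (induction t) auto

text \<open>The initial run of equal letters has length exactly \<open>t\<close>, because the first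
  block continues with the other letter; so the first block is determined and can be
  removed.\<close>

lemma has_composition_unique:
  "has_composition X ts \<Longrightarrow> has_composition X ts' \<Longrightarrow> ts = ts'"
proof (induction ts arbitrary: ts' X)
  case Nil
  then have "X = []" by (auto simp: has_composition_def)
  then show ?case using Nil(2)
    by (cases ts') (auto simp: has_composition_def length_Suc_conv block_def)
next
  case (Cons t ts)
  obtain b bs where 1: "length bs = length ts" "\<forall>t\<in>set ts. t \<ge> 1" "t \<ge> 1"
    "X = block t b @ concat (map2 block ts bs)"
    using Cons.prems(1) by (auto simp: has_composition_def length_Suc_conv)
  then have "X \<noteq> []" by (auto simp: block_def)
  then obtain t' us where ts': "ts' = t' # us" using Cons.prems(2)
    by (cases ts') (auto simp: has_composition_def)
  obtain b' bs' where 2: "length bs' = length us" "\<forall>t\<in>set us. t \<ge> 1" "t' \<ge> 1"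
    "X = block t' b' @ concat (map2 block us bs')"
    using Cons.prems(2) by (auto simp: ts' has_composition_def length_Suc_conv)
  have hd: "hd (block s c @ Y) = c" if "s \<ge> 1" for s c Y using that by (cases s) (auto simp: block_def)
  define Y Y' where "Y = concat (map2 block ts bs)" and "Y' = concat (map2 block us bs')"
  have eq: "block t b @ Y = block t' b' @ Y'" using 1(4) 2(4) unfolding Y_def Y'_def by (rule trans[OF sym])
  have b: "b = b'" using arg_cong[OF eq, of hd] unfolding hd[OF 1(3)] hd[OF 2(3)] .
  have tw: "takeWhile (\<lambda>x. x = c) (block s c @ Y) = replicate s c" if "s \<ge> 1" for s c Y
    using that takeWhile_replicate_append[of c "\<not> c" s "replicate (s - 1) (\<not> c) @ Y"]
    by (cases s) (simp_all add: block_def)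
  have "replicate t b = replicate t' b"
    using arg_cong[OF eq, of "takeWhile (\<lambda>x. x = b)"] tw[OF 1(3)] tw[OF 2(3)] unfolding b by simp
  then have t: "t = t'" by (metis length_replicate)
  have "Y = Y'" using eq unfolding b t by simp
  moreover have "has_composition Y ts" using 1(1,2) unfolding has_composition_def Y_def by blast
  moreover have "has_composition Y' us" using 2(1,2) unfolding has_composition_def Y'_def by blast
  ultimately show ?case using Cons.IH[of Y us] t ts' by simp
qed

lemma composition_eq: "has_composition X ts \<Longrightarrow> composition X = ts"
  unfolding composition_def by (rule the_equality) (auto dest: has_composition_unique)

text \<open>Inside a block of \<open>ts\<close> separation forces all comparisons of
  \<open>Q\<close> to agree, and across blocks its failure forces the order of the blocks; so
  \<open>Q\<close> is the concatenation of blocks with suitable signs.\<close>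

lemma has_composition_transfer:
  assumes P: "is_pattern r P" "has_composition P ts" and Q: "is_pattern r Q"
    and sep: "\<And>i j. i < j \<Longrightarrow> j < r \<Longrightarrow> separated P i j \<longleftrightarrow> separated Q i j"
  shows "has_composition Q ts"
proof -
  have sum: "sum_list ts = r" by (rule has_composition_before[OF P])
  have sepQ: "separated Q i j \<longleftrightarrow> blk ts i = blk ts j" if "i \<le> j" "j < r" for i j
  proof (cases "i = j")
    case True
    then show ?thesis by (simp add: separated_def)
  next
    case False
    then show ?thesis using sep[of i j] separated_iff_blk[OF P that] that by linarith
  qed
  \<comment> \<open>The sign of a block is read off at any of its positions; \<open>const\<close>
    shows that all of them give the same sign.\<close>
  define bs where "bs = map (\<lambda>b. \<exists>i<r. blk ts i = b \<and> before Q i i) [0..<length ts]"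
  have len: "length bs = length ts" by (simp add: bs_def)
  have const: "before Q i m \<longleftrightarrow> before Q j j"
    if "blk ts i = blk ts j" "blk ts m = blk ts j" "i < r" "j < r" "m < r" for i j m
  proof -
    \<comment> \<open>By monotonicity \<open>before Q j i\<close> implies the other three
      comparisons and \<open>before Q i j\<close> is implied by them, so separation makes all four
      equal.\<close>
    have s1: "(before Q i j \<longleftrightarrow> before Q i i) \<and> (before Q j i \<longleftrightarrow> before Q i i) \<and> (before Q j j \<longleftrightarrow> before Q i i)"
      if "blk ts i = blk ts j" "i \<le> j" "i < r" "j < r" for i j
    proof -
      have "before Q j i \<or> \<not> before Q i j" using sepQ[OF that(2,4)] that(1) unfolding separated_def by simp
      then show ?thesis
        using before_mono[of Q j i i i] before_mono[of Q j i j j] before_mono[of Q i i i j]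
          before_mono[of Q j j i j] before_mono[of Q j i i j] that(2) by blast
    qed
    have s2: "(before Q i j \<longleftrightarrow> before Q i i) \<and> (before Q j j \<longleftrightarrow> before Q i i)"
      if "blk ts i = blk ts j" "i < r" "j < r" for i j
    proof (cases "i \<le> j")
      case True
      then show ?thesis using s1[OF that(1) True that(2,3)] by blast
    next
      case False
      then have "j \<le> i" by simp
      then show ?thesis using s1[OF that(1)[symmetric] _ that(3,2)] by blast
    qed
    have "blk ts i = blk ts m" using that by simp
    then show ?thesis using s2[OF _ that(3,5)] s2[OF that(1,3,4)] by blast
  qed
  have bs_nth: "bs ! blk ts i \<longleftrightarrow> before Q i i" if "i < r" for i
  proof -
    have "bs ! blk ts i \<longleftrightarrow> (\<exists>j<r. blk ts j = blk ts i \<and> before Q j j)"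
      using that sum blk_less_length[of i ts] by (simp add: bs_def)
    then show ?thesis using const[OF _ _ _ that] that by blast
  qed
  have "Q = concat (map2 block ts bs)"
  proof (rule before_eqI)
    show "before Q i m = before (concat (map2 block ts bs)) i m"
      if "i < count_list Q True" "m < count_list Q False" for i m
    proof -
      have im: "i < r" "m < r" using that is_pattern_count[OF Q] by auto
      have "before Q i m \<longleftrightarrow> blk ts i < blk ts m \<or> blk ts i = blk ts m \<and> before Q i i"
      proof (cases "blk ts i" "blk ts m" rule: linorder_cases)
        case less
        then have "i \<le> m" using blk_mono[of m i ts] by linarith
        then show ?thesis using less sepQ[of i m] im unfolding separated_def by simp
      next
        case equal
        then show ?thesis using const[OF refl equal[symmetric] im(1) im(1) im(2)] by simp
      next
        case greater
        then have "m \<le> i" using blk_mono[of i m ts] by linarith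
        then show ?thesis using greater sepQ[of m i] im unfolding separated_def by simp
      qed
      then show ?thesis using before_composition[OF len, of i m] sum im bs_nth[OF im(1)] by simp
    qed
  qed (use is_pattern_count[OF Q] count_composition[OF len] sum in auto)
  then show ?thesis using len P(2) by (auto simp: has_composition_def)
qed

lemma mismatch_separated:
  assumes "is_pattern r P" "is_pattern r Q" "mismatch P Q"
  shows "\<exists>i j. i < j \<and> j < r \<and> separated P i j \<noteq> separated Q i j"
proof (rule ccontr)
  assume "\<not> ?thesis"
  then have sep: "separated P i j \<longleftrightarrow> separated Q i j" if "i < j" "j < r" for i j using that by blast
  have "has_composition P ts \<longleftrightarrow> has_composition Q ts" for ts
    using has_composition_transfer[OF assms(1) _ assms(2)] has_composition_transfer[OF assms(2) _ assms(1)] sep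
    by blast
  then show False using assms(3) composition_eq by (auto simp: mismatch_def collectable_def)
qed

text \<open>Words with the same blocks can differ only in the orientation of a block, and every
  diagonal comparison within that block shows it.\<close>

lemma sign_differs:
  assumes P: "is_pattern r P" "has_composition P ts" and Q: "is_pattern r Q" "has_composition Q ts"
    and "P \<noteq> Q"
  shows "\<exists>j<r. before P j j \<noteq> before Q j j"
proof (rule ccontr)
  assume n: "\<not> ?thesis"
  have "P = Q"
  proof (rule before_eqI)
    obtain bs where bs: "\<And>i m. i < r \<Longrightarrow> m < r \<Longrightarrow> before P i m \<longleftrightarrow> blk ts i < blk ts m \<or> blk ts i = blk ts m \<and> bs ! blk ts i"
      using has_composition_before[OF P] by metis
    obtain cs where cs: "\<And>i m. i < r \<Longrightarrow> m < r \<Longrightarrow> before Q i m \<longleftrightarrow> blk ts i < blk ts m \<or> blk ts i = blk ts m \<and> cs ! blk ts i"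
      using has_composition_before[OF Q] by metis
    show "before P i m = before Q i m" if "i < count_list P True" "m < count_list P False" for i m
    proof -
      have im: "i < r" "m < r" using that is_pattern_count[OF P(1)] by auto
      have "before P i i = before Q i i" using n im(1) by blast
      then show ?thesis using bs[OF im] cs[OF im] bs[OF im(1) im(1)] cs[OF im(1) im(1)] by auto
    qed
  qed (use is_pattern_count[OF P(1)] is_pattern_count[OF Q(1)] in auto)
  then show False using assms(5) by simp
qed

text \<open>For p < v < w this is the chain A_v < B_p < A_w < B_v of letters, or the same with A and
  B exchanged. On three edges that pairwise form the pattern it closes to a cycle.\<close>

definition obstruction :: "bool list \<Rightarrow> nat \<Rightarrow> nat \<Rightarrow> nat \<Rightarrow> bool" where
  "obstruction X p v w \<longleftrightarrow> (before X v p \<and> \<not> before X w p \<and> before X w v) \<or>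
    (\<not> before X p v \<and> before X p w \<and> \<not> before X v w)"

lemma replicate_decomp:
  assumes "X \<noteq> []" obtains a R where "a \<ge> 1" "X = replicate a (hd X) @ R" "R = [] \<or> hd R \<noteq> hd X"
proof -
  let ?t = "takeWhile (\<lambda>x. x = hd X) X" and ?d = "dropWhile (\<lambda>x. x = hd X) X"
  have "?t = replicate (length ?t) (hd X)"
    by (metis (full_types) replicate_length_same set_takeWhileD)
  moreover have "length ?t \<ge> 1" using assms by (cases X) auto
  moreover have "?d = [] \<or> hd ?d \<noteq> hd X" using hd_dropWhile[of "\<lambda>x. x = hd X" X] by auto
  ultimately show ?thesis using that[of "length ?t" ?d] by (metis takeWhile_dropWhile_id)
qed

lemma count_list_replicate: "count_list (replicate n x) y = (if x = y then n else 0)"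
  by (induction n) auto

lemma obstruction_block:
  assumes "obstruction X p v w"
  shows "obstruction (block t b @ X) (p + t) (v + t) (w + t)"
  using assms by (auto simp: obstruction_def before_block)

text \<open>Stated for balanced words, since after removing a block the rest may begin with B. A
  first run no longer than the second starts a block that can be removed; a longer one yields an
  obstruction at once.\<close>

lemma collectable_or_obstruction:
  assumes "count_list X True = count_list X False"
  shows "collectable X \<or> (\<exists>p v w. p < v \<and> v < w \<and> w < count_list X True \<and> obstruction X p v w)"
  using assms
proof (induction "length X" arbitrary: X rule: less_induct)
  case less
  show ?case
  proof (cases "X = []")
    case True
    then have "has_composition X []" by (auto simp: has_composition_def)
    then show ?thesis by (auto simp: collectable_def)
  next
    case False
    obtain a R where a: "a \<ge> 1" "X = replicate a (hd X) @ R" "R = [] \<or> hd R \<noteq> hd X"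
      by (rule replicate_decomp[OF False])
    define b where "b = hd X"
    have R: "R \<noteq> []"
    proof
      assume "R = []"
      then have "X = replicate a b" using a b_def by simp
      then show False using less.prems a(1) by (auto simp: count_list_replicate split: if_splits)
    qed
    obtain c S where c: "c \<ge> 1" "R = replicate c (hd R) @ S" "S = [] \<or> hd S \<noteq> hd R"
      by (rule replicate_decomp[OF R])
    have X: "X = replicate a b @ replicate c (\<not> b) @ S"
    proof -
      have hR: "hd R = (\<not> b)" using a(3) R b_def by auto
      show ?thesis using a(2) c(2) unfolding hR b_def[symmetric] by simp
    qed
    have S: "S \<noteq> [] \<Longrightarrow> hd S = b" using a(3) c(3) R b_def by auto
    show ?thesis
    proof (cases "a \<le> c")
      case True
      define Y where "Y = replicate (c - a) (\<not> b) @ S"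
      have XY: "X = block a b @ Y"
      proof -
        have "replicate c (\<not> b) = replicate a (\<not> b) @ replicate (c - a) (\<not> b)"
          using True by (simp flip: replicate_add)
        then show ?thesis by (simp add: X Y_def block_def)
      qed
      have cnt: "count_list X d = a + count_list Y d" for d by (simp add: XY count_block)
      have "length Y < length X" using a(1) by (simp add: XY block_def)
      then consider "collectable Y" | p v w where "p < v" "v < w" "w < count_list Y True" "obstruction Y p v w"
        using less.hyps[of Y] less.prems cnt by auto
      then show ?thesis
      proof cases
        case 1
        then obtain ts bs where "length bs = length ts" "\<forall>t\<in>set ts. t \<ge> 1" "Y = concat (map2 block ts bs)"
          by (auto simp: collectable_def has_composition_def)
        then have "has_composition X (a # ts)"
          unfolding has_composition_def XY using a(1) by (intro exI[of _ "b # bs"]) auto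
        then show ?thesis by (auto simp: collectable_def)
      next
        case 2
        then have "obstruction X (p + a) (v + a) (w + a)" unfolding XY by (intro obstruction_block)
        moreover have "p + a < v + a" "v + a < w + a" "w + a < count_list X True" using 2 cnt by auto
        ultimately show ?thesis by blast
      qed
    next
      case False
      have cnt: "count_list X b = a + count_list S b" "count_list X (\<not> b) = c + count_list S (\<not> b)"
        by (auto simp: X count_list_replicate)
      have eq: "count_list X b = count_list X (\<not> b)" using less.prems by (cases b) auto
      then have "S \<noteq> []" using cnt False by auto
      then obtain S' where S': "S = b # S'" using S by (cases S) auto
      \<comment> \<open>Here c < a. Letter number c of the first kind lies in the first run, before
        all letters of the other kind; letter number a opens \<open>S\<close>; and number c of the
        other kind comes later in \<open>S\<close>.\<close>
      have "obstruction X 0 c a"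
        using False a(1) c(1) by (cases b) (auto simp: X S' obstruction_def before_replicate)
      moreover have "a < count_list X True" using cnt(1) S' eq less.prems by (cases b) auto
      ultimately show ?thesis using c(1) False by (intro disjI2 exI[of _ 0] exI[of _ c] exI[of _ a]) auto
    qed
  qed
qed

section \<open>Cliques of non-collectable patterns\<close>

text \<open>The three inequalities of the obstruction are applied to the three different pairs of
  edges and chain up to \<open>vx f v < vx f v\<close>.\<close>

lemma no_ordered_triangle:
  assumes ob: "obstruction X p v w" "p < v" "v < w" "w < r"
    and e: "redge r e" "redge r f" "redge r g" "e \<inter> f = {}" "e \<inter> g = {}" "f \<inter> g = {}"
    and F: "forms e f X" "forms e g X" "forms f g X"
    and ord: "vx e 0 < vx f 0" "vx f 0 < vx g 0"
  shows False
proof -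
  have l: "p < r" "v < r" "w < r" using ob by auto
  have eg0: "vx e 0 < vx g 0" using ord by auto
  note ef = forms_before[OF e(1,2,4) ord(1) F(1)] and fg = forms_before[OF e(2,3,6) ord(2) F(3)]
    and eg = forms_before[OF e(1,3,5) eg0 F(2)]
  note cef = vx_less_or_greater[OF e(1,2,4)] and cfg = vx_less_or_greater[OF e(2,3,6)] and ceg = vx_less_or_greater[OF e(1,3,5)]
  show False
    using ob(1) unfolding obstruction_def
  proof (elim disjE conjE)
    assume a: "before X v p" "\<not> before X w p" "before X w v"
    have "vx f v < vx g p" using fg l a by blast
    also have "vx g p < vx e w" using eg l a ceg[of w p] by blast
    also have "vx e w < vx f v" using ef l a by blast
    finally show False .
  next
    assume a: "\<not> before X p v" "before X p w" "\<not> before X v w"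
    have "vx f v < vx e p" using ef l a cef[of p v] by blast
    also have "vx e p < vx g w" using eg l a by blast
    also have "vx g w < vx f v" using fg l a cfg[of v w] by blast
    finally show False .
  qed
qed

lemma no_triangle:
  assumes X: "is_pattern r X" "\<not> collectable X" and M: "is_ord_matching r M"
    and in_M: "e \<in> M" "f \<in> M" "g \<in> M" and ne: "e \<noteq> f" "e \<noteq> g" "f \<noteq> g"
    and F: "forms e f X" "forms e g X" "forms f g X"
  shows False
proof -
  have cnt: "count_list X True = r" "count_list X False = r" using is_pattern_count[OF X(1)] .
  obtain p v w where ob: "obstruction X p v w" "p < v" "v < w" "w < r"
    using collectable_or_obstruction[of X] X(2) unfolding cnt by blast
  have r: "0 < r" using ob by auto
  note R = matching_redge[OF M]
  have tri: False if "e \<in> M" "f \<in> M" "g \<in> M" "e \<noteq> f" "e \<noteq> g" "f \<noteq> g"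
    "forms e f X" "forms e g X" "forms f g X" "vx e 0 < vx f 0" "vx f 0 < vx g 0" for e f g
    using no_ordered_triangle[OF ob R(2)[OF that(1)] R(2)[OF that(2)] R(2)[OF that(3)]
        R(3)[OF that(1,2,4)] R(3)[OF that(1,3,5)] R(3)[OF that(2,3,6)] that(7-)] .
  have sym: "forms f e X" if "forms e f X" "e \<in> M" "f \<in> M" "e \<noteq> f" for e f
    using that pattern_of_sym[OF R(2) R(2) R(3), of e f] r unfolding forms_def by simp
  have cases: "vx e 0 < vx f 0 \<or> vx f 0 < vx e 0" "vx e 0 < vx g 0 \<or> vx g 0 < vx e 0"
    "vx f 0 < vx g 0 \<or> vx g 0 < vx f 0"
    using vx_less_or_greater[OF R(2)[OF in_M(1)] R(2)[OF in_M(2)] R(3)[OF in_M(1,2) ne(1)] r r]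
      vx_less_or_greater[OF R(2)[OF in_M(1)] R(2)[OF in_M(3)] R(3)[OF in_M(1,3) ne(2)] r r]
      vx_less_or_greater[OF R(2)[OF in_M(2)] R(2)[OF in_M(3)] R(3)[OF in_M(2,3) ne(3)] r r] .
  have S: "forms f e X" "forms g e X" "forms g f X" using sym F in_M ne by blast+
  show False
    using cases tri[OF in_M(1,2,3) ne F] tri[OF in_M(1,3,2) ne(2,1) ne(3)[symmetric] F(2,1) S(3)]
      tri[OF in_M(2,1,3) ne(1)[symmetric] ne(3,2) S(1) F(3,2)]
      tri[OF in_M(2,3,1) ne(3) ne(1)[symmetric] ne(2)[symmetric] F(3) S(1,2)]
      tri[OF in_M(3,1,2) ne(2)[symmetric] ne(3)[symmetric] ne(1) S(2,3) F(1)]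
      tri[OF in_M(3,2,1) ne(3)[symmetric] ne(2)[symmetric] ne(1)[symmetric] S(3,2,1)]
    by blast
qed

text \<open>The bound R(3,3) \<le> 6: some colour occurs three times at \<open>x\<close>, and either
  it reappears among these three neighbours or they form a triangle of the other colour.\<close>

lemma monochromatic_triangle:
  assumes "finite A" "card A \<ge> 6" and sym: "\<And>x y. x \<in> A \<Longrightarrow> y \<in> A \<Longrightarrow> c x y \<longleftrightarrow> c y x"
  shows "\<exists>x\<in>A. \<exists>y\<in>A. \<exists>z\<in>A. x \<noteq> y \<and> x \<noteq> z \<and> y \<noteq> z \<and> c x y = c x z \<and> c x y = c y z"
proof -
  obtain x where x: "x \<in> A" using assms(2) by fastforce
  have fin: "finite (A - {x})" and five: "card (A - {x}) \<ge> 5" using assms x by auto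
  have "card ({y \<in> A - {x}. c x y} \<union> {y \<in> A - {x}. \<not> c x y})
      = card {y \<in> A - {x}. c x y} + card {y \<in> A - {x}. \<not> c x y}"
    by (rule card_Un_disjoint) (use fin in auto)
  moreover have "{y \<in> A - {x}. c x y} \<union> {y \<in> A - {x}. \<not> c x y} = A - {x}" by blast
  ultimately have "card {y \<in> A - {x}. c x y} + card {y \<in> A - {x}. \<not> c x y} \<ge> 5" using five by argo
  then have "3 \<le> card {y \<in> A - {x}. c x y} \<or> 3 \<le> card {y \<in> A - {x}. \<not> c x y}"
    by linarith
  then have "\<exists>b. 3 \<le> card {y \<in> A - {x}. c x y = b}"
  proof
    assume "3 \<le> card {y \<in> A - {x}. c x y}"
    then show ?thesis by (intro exI[of _ True]) simp
  next
    assume "3 \<le> card {y \<in> A - {x}. \<not> c x y}"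
    then show ?thesis by (intro exI[of _ False]) simp
  qed
  then obtain b where "3 \<le> card {y \<in> A - {x}. c x y = b}" by blast
  then obtain B where B: "B \<subseteq> {y \<in> A - {x}. c x y = b}" "card B = 3"
    by (rule obtain_subset_with_card_n)
  then obtain y1 y2 y3 where y: "B = {y1, y2, y3}" "y1 \<noteq> y2" "y1 \<noteq> y3" "y2 \<noteq> y3"
    by (auto simp: card_3_iff)
  have m: "y1 \<in> A" "y2 \<in> A" "y3 \<in> A" "x \<noteq> y1" "x \<noteq> y2" "x \<noteq> y3"
    "c x y1 = b" "c x y2 = b" "c x y3 = b" using B(1) unfolding y(1) by blast+
  have tri: ?thesis if "u \<in> A" "v \<in> A" "w \<in> A" "u \<noteq> v" "u \<noteq> w" "v \<noteq> w" "c u v = d" "c u w = d" "c v w = d"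
    for u v w d
    by (intro bexI[OF _ that(1)] bexI[OF _ that(2)] bexI[OF _ that(3)]) (simp add: that)
  consider "c y1 y2 = b" | "c y1 y3 = b" | "c y2 y3 = b"
    | "c y1 y2 = (\<not> b)" "c y1 y3 = (\<not> b)" "c y2 y3 = (\<not> b)" by argo
  then show ?thesis
  proof cases
    case 1 show ?thesis by (rule tri[OF x m(1,2,4,5) y(2) m(7,8) 1])
  next
    case 2 show ?thesis by (rule tri[OF x m(1,3,4,6) y(3) m(7,9) 2])
  next
    case 3 show ?thesis by (rule tri[OF x m(2,3,5,6) y(4) m(8,9) 3])
  next
    case 4 show ?thesis by (rule tri[OF m(1,2,3) y(2,3,4) 4])
  qed
qed

text \<open>Pairs are coloured by whether they form \<open>P\<close>; those that do not form
  \<open>Q\<close>. A monochromatic triangle is excluded by \<open>no_triangle\<close>.\<close>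

lemma noncollectable_clique_le_5:
  assumes "is_pattern r P" "\<not> collectable P" "is_pattern r Q" "\<not> collectable Q"
    and C: "is_clique r {P, Q} M"
  shows "card M \<le> 5"
proof (rule ccontr)
  assume "\<not> ?thesis"
  then have six: "card M \<ge> 6" by simp
  have r: "r \<ge> 1" using assms(1) by (cases r) (auto simp: is_pattern_def)
  note M = clique_matching[OF C] and R = matching_redge[OF clique_matching[OF C]]
  have "forms e f P \<longleftrightarrow> forms f e P" if "e \<in> M" "f \<in> M" for e f
    using pattern_of_sym[OF R(2) R(2) R(3) r, of e f] that unfolding forms_def by (cases "e = f") auto
  from monochromatic_triangle[of M "\<lambda>e f. forms e f P", OF R(1) six this]
  obtain e f g where efg: "e \<in> M" "f \<in> M" "g \<in> M" "e \<noteq> f" "e \<noteq> g" "f \<noteq> g"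
    "forms e f P = forms e g P" "forms e f P = forms f g P" by blast
  show False
  proof (cases "forms e f P")
    case True
    then show False using no_triangle[OF assms(1,2) M efg(1-6)] efg(7,8) by blast
  next
    case False
    then have "forms e f Q" "forms e g Q" "forms f g Q"
      using clique_forms[OF C] efg by blast+
    then show False using no_triangle[OF assms(3,4) M efg(1-6)] by blast
  qed
qed

section \<open>Extremal clique sizes\<close>

lemma finite_clique_sizes: "finite M \<Longrightarrow> finite {card M' | M'. M' \<subseteq> M \<and> is_clique r Ps M'}"
  by (rule finite_subset[of _ "card ` Pow M"]) auto

lemma z_of_ge: "finite M \<Longrightarrow> S \<subseteq> M \<Longrightarrow> is_clique r Ps S \<Longrightarrow> card S \<le> z_of r Ps M"
  unfolding z_of_def by (intro Max_ge finite_clique_sizes) auto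

lemma empty_clique: "is_clique r Ps {}"
  by (simp add: is_clique_def is_ord_matching_def)

lemma z_of_attained:
  assumes "finite M" obtains S where "S \<subseteq> M" "is_clique r Ps S" "card S = z_of r Ps M"
proof -
  have "z_of r Ps M \<in> {card M' | M'. M' \<subseteq> M \<and> is_clique r Ps M'}"
    unfolding z_of_def by (rule Max_in[OF finite_clique_sizes[OF assms]]) (use empty_clique in auto)
  then show ?thesis using that by auto
qed

text \<open>Subsets of cliques are cliques. The union bound needs cliques of one prescribed
  size.\<close>

lemma z_of_subclique:
  assumes "finite M" "k \<le> z_of r Ps M"
  shows "\<exists>S\<subseteq>M. is_clique r Ps S \<and> card S = k"
proof -
  obtain S where S: "S \<subseteq> M" "is_clique r Ps S" "card S = z_of r Ps M" using z_of_attained[OF assms(1)] .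
  have "k \<le> card S" using assms(2) S(3) by simp
  then obtain T where "T \<subseteq> S" "card T = k" by (rule obtain_subset_with_card_n)
  then show ?thesis using S clique_subset by blast
qed

text \<open>The positions of the two letters in the word \<open>X\<close> serve as the two
  edges.\<close>

lemma pair_clique:
  assumes X: "is_pattern r X" "X \<in> Ps" "r \<ge> 1"
  shows "2 \<in> clique_sizes r Ps"
proof -
  define e f where "e = {i. i < 2 * r \<and> X ! i}" and "f = {i. i < 2 * r \<and> \<not> X ! i}"
  have len: "length X = 2 * r" using X(1) by (simp add: is_pattern_def)
  have un: "e \<union> f = {0..<2 * r}" "e \<inter> f = {}" by (auto simp: e_def f_def)
  have "card e = r"
  proof -
    have "e = {i. i < length X \<and> X ! i = True}" by (auto simp: e_def len)
    then show ?thesis using is_pattern_count(1)[OF X(1)]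
      unfolding count_list_eq_length_filter length_filter_conv_card by (simp add: eq_commute)
  qed
  moreover have fin: "finite e" "finite f" by (auto simp: e_def f_def)
  ultimately have "card f = r" using card_Un_disjoint[OF fin un(2)] un(1) by simp
  then have R: "redge r e" "redge r f" using \<open>card e = r\<close> fin by (auto simp: redge_def)
  have "X ! 0" using X(1) by (cases X) (auto simp: is_pattern_def)
  then have "0 \<in> e" using X(3) by (auto simp: e_def)
  have min: "Min (e \<union> f) \<in> e"
  proof -
    have "Min (e \<union> f) = 0" unfolding un by (rule Min_eqI) (use X(3) in auto)
    then show ?thesis using \<open>0 \<in> e\<close> by simp
  qed
  have "map (\<lambda>x. x \<in> e) [0..<2 * r] = X"
    by (rule nth_equalityI) (auto simp: len e_def)
  then have "pattern_of e f = X" using min un(1) by (simp add: pattern_of_def)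
  then have F: "forms e f X" "forms f e X" using pattern_of_sym[OF R un(2) X(3)] by (auto simp: forms_def)
  have "e \<noteq> f" using un(2) \<open>0 \<in> e\<close> by auto
  then have "card {e, f} = 2" by simp
  moreover have "is_clique r Ps {e, f}"
    using R un(2) F X(2) by (auto simp: is_clique_def is_ord_matching_def redge_def)
  ultimately show ?thesis unfolding clique_sizes_def by (metis (mono_tags, lifting) mem_Collect_eq)
qed

lemma clique_card_le_z_global:
  assumes "bdd_above (clique_sizes r Ps)" "is_clique r Ps M"
  shows "card M \<le> z_global r Ps"
  unfolding z_global_def by (rule cSup_upper) (use assms in \<open>auto simp: clique_sizes_def\<close>)

lemma z_of_le_z_global:
  assumes "bdd_above (clique_sizes r Ps)" "finite M"
  shows "z_of r Ps M \<le> z_global r Ps"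
  using z_of_attained[OF assms(2)] clique_card_le_z_global[OF assms(1)] by metis

lemma z_global_attained:
  assumes "bdd_above (clique_sizes r Ps)"
  obtains K where "is_clique r Ps K" "card K = z_global r Ps"
proof -
  have "card ({} :: nat set set) \<in> clique_sizes r Ps"
    unfolding clique_sizes_def using empty_clique[of r Ps] by (intro CollectI exI conjI) auto
  then have "clique_sizes r Ps \<noteq> {}" by blast
  moreover have "finite (clique_sizes r Ps)" using assms by (simp add: bdd_above_nat)
  ultimately have "z_global r Ps \<in> clique_sizes r Ps"
    unfolding z_global_def by (simp add: cSup_eq_Max)
  then show ?thesis using that unfolding clique_sizes_def by auto
qed

lemma noncollectable_z_global:
  assumes "is_pattern r P" "\<not> collectable P" "is_pattern r Q" "\<not> collectable Q"
  shows "bdd_above (clique_sizes r {P, Q})" "2 \<le> z_global r {P, Q}" "z_global r {P, Q} \<le> 5"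
proof -
  have le: "x \<le> 5" if "x \<in> clique_sizes r {P, Q}" for x
    using that noncollectable_clique_le_5[OF assms] by (auto simp: clique_sizes_def)
  then show bdd: "bdd_above (clique_sizes r {P, Q})" by (rule bdd_aboveI)
  have two: "2 \<in> clique_sizes r {P, Q}"
    using pair_clique[OF assms(1), of "{P, Q}"] assms(1) by (cases r) (auto simp: is_pattern_def)
  then show "2 \<le> z_global r {P, Q}" unfolding z_global_def by (rule cSup_upper[OF _ bdd])
  show "z_global r {P, Q} \<le> 5" unfolding z_global_def by (rule cSup_least) (use two le in auto)
qed

section \<open>Counting matchings\<close>

definition matchings_on :: "nat \<Rightarrow> nat set \<Rightarrow> nat set set set" where
  "matchings_on r V = {M. is_ord_matching r M \<and> \<Union>M = V}"

text \<open>The count (rm)! / (r!^m m!) in recursive form: a fixed vertex chooses its r - 1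
  companions, and the remaining vertices are matched.\<close>

primrec num_matchings :: "nat \<Rightarrow> nat \<Rightarrow> nat" where
  "num_matchings r 0 = 1"
| "num_matchings r (Suc m) = ((r * Suc m - 1) choose (r - 1)) * num_matchings r m"

lemma matchings_eq: "matchings r n = matchings_on r {0..<r * n}"
  by (simp add: matchings_def matchings_on_def)

lemma finite_matchings_on: "finite V \<Longrightarrow> finite (matchings_on r V)"
  by (rule finite_subset[of _ "Pow (Pow V)"]) (auto simp: matchings_on_def)

lemma card_subsets_containing:
  assumes "finite V" "v \<in> V" "r \<ge> 1"
  shows "card {e. e \<subseteq> V \<and> v \<in> e \<and> card e = r} = (card V - 1) choose (r - 1)"
proof -
  have "bij_betw (insert v) {s. s \<subseteq> V - {v} \<and> card s = r - 1} {e. e \<subseteq> V \<and> v \<in> e \<and> card e = r}"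
  proof (rule bij_betw_byWitness[where f' = "\<lambda>e. e - {v}"])
    show "insert v ` {s. s \<subseteq> V - {v} \<and> card s = r - 1} \<subseteq> {e. e \<subseteq> V \<and> v \<in> e \<and> card e = r}"
    proof safe
      fix s assume s: "s \<subseteq> V - {v}" "card s = r - 1"
      then have "finite s" using assms(1) finite_subset by blast
      moreover have "v \<notin> s" using s by auto
      ultimately show "card (insert v s) = r" using s assms by simp
    qed (use assms in auto)
    show "(\<lambda>e. e - {v}) ` {e. e \<subseteq> V \<and> v \<in> e \<and> card e = r} \<subseteq> {s. s \<subseteq> V - {v} \<and> card s = r - 1}"
      using assms by auto
  qed auto
  then have "card {e. e \<subseteq> V \<and> v \<in> e \<and> card e = r} = card {s. s \<subseteq> V - {v} \<and> card s = r - 1}"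
    by (simp add: bij_betw_same_card)
  also have "\<dots> = (card V - 1) choose (r - 1)"
    using n_subsets[of "V - {v}" "r - 1"] assms by simp
  finally show ?thesis .
qed

lemma card_Union_matching:
  "is_ord_matching r S \<Longrightarrow> card (\<Union>S) = r * card S"
proof -
  assume S: "is_ord_matching r S"
  have "card (\<Union>S) = sum card S"
    by (rule card_Union_disjoint) (use S in \<open>auto simp: is_ord_matching_def pairwise_def disjnt_def\<close>)
  also have "\<dots> = (\<Sum>e\<in>S. r)" by (rule sum.cong) (use S in \<open>auto simp: is_ord_matching_def\<close>)
  finally show ?thesis by simp
qed

text \<open>Removing \<open>S\<close> and adding it back are inverse to each other; r \<ge> 1
  excludes the empty edge, which could lie both in \<open>S\<close> and in a matching of the
  rest.\<close>

lemma bij_betw_matchings_containing: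
  assumes S: "is_ord_matching r S" "\<Union>S \<subseteq> V" and r: "r \<ge> 1" and fin: "finite V"
  shows "bij_betw (\<lambda>M. M - S) {M \<in> matchings_on r V. S \<subseteq> M} (matchings_on r (V - \<Union>S))"
proof (rule bij_betw_byWitness[where f' = "\<lambda>M. M \<union> S"])
  have disj: "S \<inter> M = {}" if "M \<in> matchings_on r (V - \<Union>S)" for M
  proof (rule ccontr)
    assume "S \<inter> M \<noteq> {}"
    then obtain e where e: "e \<in> S" "e \<in> M" by auto
    then have "card e = r" using S by (auto simp: is_ord_matching_def)
    then have "e \<noteq> {}" using r by auto
    moreover have "e \<subseteq> V - \<Union>S" using that e by (auto simp: matchings_on_def)
    ultimately show False using e by auto
  qed
  show "\<forall>M\<in>matchings_on r (V - \<Union>S). M \<union> S - S = M" using disj by blast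
  show "(\<lambda>M. M - S) ` {M \<in> matchings_on r V. S \<subseteq> M} \<subseteq> matchings_on r (V - \<Union>S)"
  proof (clarify)
    fix M assume M: "M \<in> matchings_on r V" "S \<subseteq> M"
    then have m: "is_ord_matching r M" "\<Union>M = V" by (auto simp: matchings_on_def)
    have "is_ord_matching r (M - S)" using m(1) by (auto simp: is_ord_matching_def)
    moreover have "\<Union>(M - S) = V - \<Union>S"
    proof
      show "V - \<Union>S \<subseteq> \<Union>(M - S)" using m(2) by blast
      show "\<Union>(M - S) \<subseteq> V - \<Union>S"
      proof
        fix x assume "x \<in> \<Union>(M - S)"
        then obtain e where e: "e \<in> M" "e \<notin> S" "x \<in> e" by blast
        have "x \<notin> f" if "f \<in> S" for f
        proof
          assume "x \<in> f"
          moreover have "f \<in> M" "e \<noteq> f" using that M(2) e(2) by auto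
          ultimately show False using m(1) e(1,3) unfolding is_ord_matching_def by blast
        qed
        then show "x \<in> V - \<Union>S" using e m(2) by blast
      qed
    qed
    ultimately show "M - S \<in> matchings_on r (V - \<Union>S)" by (simp add: matchings_on_def)
  qed
  show "(\<lambda>M. M \<union> S) ` matchings_on r (V - \<Union>S) \<subseteq> {M \<in> matchings_on r V. S \<subseteq> M}"
  proof (clarify, intro conjI)
    fix M assume "M \<in> matchings_on r (V - \<Union>S)"
    then have m: "is_ord_matching r M" "\<Union>M = V - \<Union>S" by (auto simp: matchings_on_def)
    have "e \<inter> f = {}" "f \<inter> e = {}" if "e \<in> M" "f \<in> S" for e f using m(2) that by blast+
    then have "is_ord_matching r (M \<union> S)"
      using m(1) S(1) unfolding is_ord_matching_def by (simp add: ball_Un)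
    moreover have "\<Union>(M \<union> S) = V" using m(2) S(2) by auto
    ultimately show "M \<union> S \<in> matchings_on r V" by (simp add: matchings_on_def)
  qed auto
qed auto

text \<open>Matchings are classified by the edge that covers a fixed vertex
  \<open>v\<close>.\<close>

lemma card_matchings_on:
  assumes "finite V" "card V = r * m" "r \<ge> 1"
  shows "card (matchings_on r V) = num_matchings r m"
  using assms
proof (induction m arbitrary: V)
  case 0
  have "matchings_on r {} = {{}}"
  proof -
    have "M = {}" if M: "is_ord_matching r M" "\<Union>M = {}" for M
    proof (rule ccontr)
      assume "M \<noteq> {}"
      then obtain e where e: "e \<in> M" by auto
      then have "e = {}" "card e = r" using M by (auto simp: is_ord_matching_def)
      then show False using assms(3) by simp
    qed
    moreover have "is_ord_matching r {}" by (simp add: is_ord_matching_def)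
    ultimately show ?thesis unfolding matchings_on_def by blast
  qed
  then show ?case using 0 by simp
next
  case (Suc m)
  have "card V > 0" using Suc.prems(2,3) by simp
  then have "V \<noteq> {}" by auto
  then obtain v where v: "v \<in> V" by auto
  define E where "E = {e. e \<subseteq> V \<and> v \<in> e \<and> card e = r}"
  have finE: "finite E" by (rule finite_subset[of _ "Pow V"]) (use Suc.prems in \<open>auto simp: E_def\<close>)
  have un: "matchings_on r V = (\<Union>e\<in>E. {M \<in> matchings_on r V. {e} \<subseteq> M})"
  proof
    show "matchings_on r V \<subseteq> (\<Union>e\<in>E. {M \<in> matchings_on r V. {e} \<subseteq> M})"
    proof
      fix M assume M: "M \<in> matchings_on r V"
      then obtain e where "e \<in> M" "v \<in> e" using v by (auto simp: matchings_on_def)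
      moreover from this have "e \<in> E"
        using M by (auto simp: E_def matchings_on_def is_ord_matching_def)
      ultimately show "M \<in> (\<Union>e\<in>E. {M \<in> matchings_on r V. {e} \<subseteq> M})"
        using M by blast
    qed
  qed auto
  have each: "card {M \<in> matchings_on r V. {e} \<subseteq> M} = num_matchings r m" if "e \<in> E" for e
  proof -
    have fe: "finite e" using that Suc.prems(1) finite_subset by (auto simp: E_def)
    have "card {M \<in> matchings_on r V. {e} \<subseteq> M} = card (matchings_on r (V - \<Union>{e}))"
      by (rule bij_betw_same_card[OF bij_betw_matchings_containing])
        (use that fe Suc.prems in \<open>auto simp: E_def is_ord_matching_def\<close>)
    also have "\<dots> = num_matchings r m"
      by (rule Suc.IH) (use that fe Suc.prems in \<open>auto simp: E_def card_Diff_subset\<close>)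
    finally show ?thesis .
  qed
  have "card (matchings_on r V) = card (\<Union>e\<in>E. {M \<in> matchings_on r V. {e} \<subseteq> M})"
    using un by (rule arg_cong)
  also have "\<dots> = (\<Sum>e\<in>E. card {M \<in> matchings_on r V. {e} \<subseteq> M})"
  proof (rule card_UN_disjoint)
    show "\<forall>i\<in>E. \<forall>j\<in>E. i \<noteq> j \<longrightarrow> {M \<in> matchings_on r V. {i} \<subseteq> M} \<inter> {M \<in> matchings_on r V. {j} \<subseteq> M} = {}"
    proof (intro ballI impI, rule ccontr)
      fix i j assume ij: "i \<in> E" "j \<in> E" "i \<noteq> j"
        and "{M \<in> matchings_on r V. {i} \<subseteq> M} \<inter> {M \<in> matchings_on r V. {j} \<subseteq> M} \<noteq> {}"
      then obtain M where "is_ord_matching r M" "i \<in> M" "j \<in> M" by (auto simp: matchings_on_def)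
      then have "i \<inter> j = {}" using ij(3) unfolding is_ord_matching_def by blast
      then show False using ij unfolding E_def by blast
    qed
    show "\<forall>e\<in>E. finite {M \<in> matchings_on r V. {e} \<subseteq> M}"
      using finite_matchings_on[OF Suc.prems(1), of r] by simp
  qed (rule finE)
  also have "\<dots> = card E * num_matchings r m" using each by simp
  also have "card E = (r * Suc m - 1) choose (r - 1)"
    using card_subsets_containing[OF Suc.prems(1) v Suc.prems(3)] Suc.prems(2) by (simp add: E_def)
  finally show ?case by simp
qed

section \<open>The probability that prescribed edges all occur\<close>

lemma num_matchings_pos: "r \<ge> 1 \<Longrightarrow> num_matchings r m > 0"
  by (induction m) (auto simp: zero_less_binomial_iff)

text \<open>For k \<le> n this is the probability that k prescribed disjoint edges in [rn] all
  occur; it depends on them only through k.\<close>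

definition edge_prob :: "nat \<Rightarrow> nat \<Rightarrow> nat \<Rightarrow> real" where
  "edge_prob r n k = real (num_matchings r (n - k)) / real (num_matchings r n)"

lemma matchings_finite_nonempty:
  assumes "r \<ge> 1" shows "finite (matchings r n)" "matchings r n \<noteq> {}" "card (matchings r n) = num_matchings r n"
proof -
  show "finite (matchings r n)" by (simp add: matchings_eq finite_matchings_on)
  show c: "card (matchings r n) = num_matchings r n"
    unfolding matchings_eq by (rule card_matchings_on) (use assms in auto)
  show "matchings r n \<noteq> {}" using c num_matchings_pos[OF assms, of n] by auto
qed

lemma set_pmf_RM: "r \<ge> 1 \<Longrightarrow> set_pmf (RM r n) = matchings r n"
  unfolding RM_def by (rule set_pmf_of_set) (auto simp: matchings_finite_nonempty)

lemma prob_contains: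
  assumes "r \<ge> 1" "is_ord_matching r S" "\<Union>S \<subseteq> {0..<r * n}"
  shows "measure_pmf.prob (RM r n) {M. S \<subseteq> M} = edge_prob r n (card S)" "card S \<le> n"
proof -
  note R = matchings_finite_nonempty[OF assms(1), of n]
  have c: "card (\<Union>S) = r * card S" by (rule card_Union_matching[OF assms(2)])
  have "card (\<Union>S) \<le> card {0..<r * n}" by (rule card_mono) (use assms in auto)
  then show "card S \<le> n" using c assms(1) by simp
  have "measure_pmf.prob (RM r n) {M. S \<subseteq> M} = card (matchings r n \<inter> {M. S \<subseteq> M}) / card (matchings r n)"
    unfolding RM_def by (rule measure_pmf_of_set) (use R in auto)
  also have "matchings r n \<inter> {M. S \<subseteq> M} = {M \<in> matchings_on r {0..<r * n}. S \<subseteq> M}"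
    by (auto simp: matchings_eq)
  also have "card \<dots> = card (matchings_on r ({0..<r * n} - \<Union>S))"
    by (rule bij_betw_same_card[OF bij_betw_matchings_containing]) (use assms in auto)
  also have "\<dots> = num_matchings r (n - card S)"
  proof (rule card_matchings_on)
    have "finite (\<Union>S)" using assms(3) finite_subset by blast
    then show "card ({0..<r * n} - \<Union>S) = r * (n - card S)"
      using c assms(3) by (simp add: card_Diff_subset diff_mult_distrib2)
  qed (use assms in auto)
  finally show "measure_pmf.prob (RM r n) {M. S \<subseteq> M} = edge_prob r n (card S)"
    using R by (simp add: edge_prob_def)
qed

lemma prob_contains_invalid:
  assumes "r \<ge> 1" "\<not> (is_ord_matching r S \<and> \<Union>S \<subseteq> {0..<r * n})"
  shows "measure_pmf.prob (RM r n) {M. S \<subseteq> M} = 0"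
proof -
  have "set_pmf (RM r n) \<inter> {M. S \<subseteq> M} = {}"
  proof (rule ccontr)
    assume "set_pmf (RM r n) \<inter> {M. S \<subseteq> M} \<noteq> {}"
    then obtain M where "M \<in> matchings r n" "S \<subseteq> M" using set_pmf_RM[OF assms(1)] by auto
    then show False using assms(2) finite_subset[of S M]
      by (auto simp: matchings_def is_ord_matching_def subset_iff)
  qed
  then show ?thesis by (simp add: measure_pmf_zero_iff)
qed

text \<open>For r > 1 each new factor, (rt - 1) choose (r - 1), is at least t^(r-1), because (rt -
  1) / (r - 1) \<ge> t; for r = 1 both are 1.\<close>

lemma num_matchings_growth:
  assumes "r \<ge> 1"
  shows "real (num_matchings r m) * fact (m + k) ^ (r - 1) \<le> real (num_matchings r (m + k)) * fact m ^ (r - 1)"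
proof (induction k)
  case (Suc k)
  let ?N = "r * Suc (m + k) - 1"
  have "real (Suc (m + k)) ^ (r - 1) \<le> real (?N choose (r - 1))"
  proof (cases "r = 1")
    case False
    have "real (Suc (m + k)) * real (r - 1) \<le> real ?N"
      using assms by (simp add: of_nat_diff algebra_simps)
    then have "real (Suc (m + k)) \<le> real ?N / real (r - 1)"
      using False assms by (simp add: le_divide_eq)
    then have "real (Suc (m + k)) ^ (r - 1) \<le> (real ?N / real (r - 1)) ^ (r - 1)"
      by (intro power_mono) auto
    also have "\<dots> \<le> real (?N choose (r - 1))"
      by (rule binomial_ge_n_over_k_pow_k) (simp add: algebra_simps)
    finally show ?thesis .
  qed simp
  then have "real (Suc (m + k)) ^ (r - 1) * (real (num_matchings r m) * fact (m + k) ^ (r - 1))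
      \<le> real (?N choose (r - 1)) * (real (num_matchings r (m + k)) * fact m ^ (r - 1))"
    by (intro mult_mono Suc.IH) auto
  moreover have "fact (m + Suc k) = real (Suc (m + k)) * fact (m + k)" by simp
  ultimately show ?case by (simp only: add_Suc_right num_matchings.simps power_mult_distrib of_nat_mult mult_ac)
qed simp

text \<open>At each step of the induction one factor e pays for raising the base, since (1 +
  1/(m+k))^k \<le> e. For m = 0 this is k! \<ge> (k/e)^k.\<close>

lemma fact_ratio_ge: "(real (m + k) / exp 1) ^ k * fact m \<le> (fact (m + k) :: real)"
proof (induction k)
  case (Suc k)
  let ?N = "real (m + k)"
  have "(?N + 1) ^ k \<le> exp 1 * ?N ^ k"
  proof (cases "k = 0")
    case False
    then have N: "?N > 0" by simp
    have "(1 + 1 / ?N) ^ k \<le> exp (1 / ?N) ^ k" by (intro power_mono exp_ge_add_one_self) (use N in auto)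
    also have "\<dots> = exp (real k / ?N)" by (simp flip: exp_of_nat_mult)
    also have "\<dots> \<le> exp 1" using N by simp
    finally have "(1 + 1 / ?N) ^ k * ?N ^ k \<le> exp 1 * ?N ^ k" by (intro mult_right_mono) auto
    moreover have "(1 + 1 / ?N) * ?N = ?N + 1" using N by (simp add: field_simps)
    ultimately show ?thesis by (simp flip: power_mult_distrib)
  qed auto
  then have "(?N + 1) ^ k / exp 1 ^ k \<le> exp 1 * ?N ^ k / exp 1 ^ k" by (intro divide_right_mono) auto
  then have *: "((?N + 1) / exp 1) ^ k \<le> exp 1 * (?N / exp 1) ^ k" by (simp add: power_divide)
  have "(real (m + Suc k) / exp 1) ^ Suc k * fact m = (?N + 1) / exp 1 * ((?N + 1) / exp 1) ^ k * fact m"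
    by (simp add: algebra_simps)
  also have "\<dots> \<le> (?N + 1) / exp 1 * (exp 1 * (?N / exp 1) ^ k) * fact m"
    by (intro mult_right_mono mult_left_mono *) auto
  also have "\<dots> = (?N + 1) * ((?N / exp 1) ^ k * fact m)" by simp
  also have "\<dots> \<le> (?N + 1) * fact (m + k)" by (intro mult_left_mono Suc.IH) auto
  also have "\<dots> = fact (m + Suc k)" by (simp add: algebra_simps)
  finally show ?case .
qed simp

lemma edge_prob_le:
  assumes "r \<ge> 1" "k \<le> n" "n \<ge> 1"
  shows "edge_prob r n k \<le> (exp 1 / real n) ^ ((r - 1) * k)"
proof -
  define m where "m = n - k"
  have n: "n = m + k" using assms by (simp add: m_def)
  have "(real n / exp 1) ^ k * fact m \<le> (fact n :: real)" using fact_ratio_ge[of m k] n by simp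
  then have "((real n / exp 1) ^ k * fact m) ^ (r - 1) \<le> (fact n :: real) ^ (r - 1)"
    by (intro power_mono) auto
  then have "real (num_matchings r m) * (((real n / exp 1) ^ k) ^ (r - 1) * fact m ^ (r - 1))
     \<le> real (num_matchings r m) * fact n ^ (r - 1)"
    by (intro mult_left_mono) (auto simp: power_mult_distrib)
  also have "\<dots> \<le> real (num_matchings r n) * fact m ^ (r - 1)"
    using num_matchings_growth[OF assms(1), of m k] n by simp
  finally have "real (num_matchings r m) * ((real n / exp 1) ^ k) ^ (r - 1) * fact m ^ (r - 1)
     \<le> real (num_matchings r n) * fact m ^ (r - 1)" by (simp add: mult.assoc)
  then have "real (num_matchings r m) * ((real n / exp 1) ^ k) ^ (r - 1) \<le> real (num_matchings r n)"
    by (simp add: mult_le_cancel_right)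
  then have "real (num_matchings r m) * (real n / exp 1) ^ ((r - 1) * k) \<le> real (num_matchings r n)"
    by (simp add: power_mult[symmetric] mult.commute)
  moreover have "(exp 1 / real n) ^ ((r - 1) * k) = 1 / (real n / exp 1) ^ ((r - 1) * k)"
    by (simp add: power_divide)
  moreover have "(real n / exp 1) ^ ((r - 1) * k) > 0" using assms by simp
  ultimately show ?thesis
    using num_matchings_pos[OF assms(1), of n] by (simp add: edge_prob_def m_def field_simps)
qed

text \<open>Union bound. Members of \<open>G\<close> that are not matchings inside [rn] occur with
  probability 0, so \<open>G\<close> may be any finite family of k-element sets.\<close>

lemma first_moment:
  assumes "r \<ge> 1" "n \<ge> 1" "finite G" "\<And>S. S \<in> G \<Longrightarrow> card S = k"
  shows "measure_pmf.prob (RM r n) {M. \<exists>S\<in>G. S \<subseteq> M} \<le> real (card G) * (exp 1 / real n) ^ ((r - 1) * k)"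
proof -
  have "measure_pmf.prob (RM r n) {M. \<exists>S\<in>G. S \<subseteq> M} = measure_pmf.prob (RM r n) (\<Union>S\<in>G. {M. S \<subseteq> M})"
    by (rule arg_cong[where f = "measure_pmf.prob (RM r n)"]) auto
  also have "\<dots> \<le> (\<Sum>S\<in>G. measure_pmf.prob (RM r n) {M. S \<subseteq> M})"
    by (rule measure_pmf.finite_measure_subadditive_finite) (use assms in auto)
  also have "\<dots> \<le> (\<Sum>S\<in>G. (exp 1 / real n) ^ ((r - 1) * k))"
  proof (rule sum_mono)
    fix S assume "S \<in> G"
    then have c: "card S = k" using assms by auto
    show "measure_pmf.prob (RM r n) {M. S \<subseteq> M} \<le> (exp 1 / real n) ^ ((r - 1) * k)"
    proof (cases "is_ord_matching r S \<and> \<Union>S \<subseteq> {0..<r * n}")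
      case True
      then show ?thesis using prob_contains[OF assms(1), of S n] edge_prob_le[OF assms(1), of k n] assms(2) c by auto
    next
      case False
      then show ?thesis using prob_contains_invalid[OF assms(1) False] by simp
    qed
  qed
  finally show ?thesis by simp
qed

section \<open>Moments and asymptotic events\<close>

lemma integrable_RM:
  "r \<ge> 1 \<Longrightarrow> integrable (measure_pmf (RM r n)) (f :: _ \<Rightarrow> real)"
  by (rule integrable_measure_pmf_finite) (simp add: set_pmf_RM matchings_finite_nonempty)

lemma card_inter_eq_sum:
  "finite F \<Longrightarrow> real (card (M \<inter> F)) = (\<Sum>e\<in>F. indicator {M. {e} \<subseteq> M} M)"
proof -
  assume "finite F"
  then have "(\<Sum>e\<in>F. indicator {M. {e} \<subseteq> M} M) = (\<Sum>e\<in>F. if e \<in> M then 1 else (0::real))"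
    by (intro sum.cong) (auto simp: indicator_def)
  also have "\<dots> = real (card (F \<inter> M))" using \<open>finite F\<close> by (simp add: sum.If_cases)
  finally show ?thesis by (simp add: Int_commute)
qed

text \<open>Chebyshev's inequality for the number of edges of \<open>F\<close> in the matching.
  Distinct edges that intersect never occur together, so every pair of distinct edges contributes at
  most \<open>edge_prob r n 2\<close>.\<close>

lemma second_moment:
  assumes r: "r \<ge> 1" and F: "finite F" "\<And>e. e \<in> F \<Longrightarrow> card e = r \<and> e \<subseteq> {0..<r * n}"
    and pos: "real (card F) * edge_prob r n 1 > 0"
  shows "measure_pmf.prob (RM r n) {M. real (card (M \<inter> F)) \<le> real (card F) * edge_prob r n 1 / 2} \<le>
    4 * (1 / (real (card F) * edge_prob r n 1) + (edge_prob r n 2 / (edge_prob r n 1)\<^sup>2 - 1))"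
proof -
  let ?p = "RM r n" and ?E = "measure_pmf.expectation (RM r n)"
  define Y where "Y M = real (card (M \<inter> F))" for M
  define mu where "mu = real (card F) * edge_prob r n 1"
  note int = integrable_RM[OF r]
  have single: "measure_pmf.prob ?p {M. {e} \<subseteq> M} = edge_prob r n 1" if "e \<in> F" for e
    using prob_contains(1)[OF r, of "{e}" n] F(2)[OF that] finite_subset[of e "{0..<r * n}"]
    by (simp add: is_ord_matching_def)
  have Ye: "Y = (\<lambda>M. \<Sum>e\<in>F. indicator {M. {e} \<subseteq> M} M)"
    using card_inter_eq_sum[OF F(1)] by (auto simp: Y_def)
  have EY: "?E Y = mu"
    unfolding Ye mu_def by (subst Bochner_Integration.integral_sum) (auto simp: int single)
  have pair: "measure_pmf.prob ?p {M. {e, f} \<subseteq> M} \<le> (if e = f then edge_prob r n 1 else edge_prob r n 2)"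
    if "e \<in> F" "f \<in> F" for e f
  proof (cases "e = f")
    case True
    then show ?thesis using single[OF that(1)] by simp
  next
    case False
    show ?thesis
    proof (cases "is_ord_matching r {e, f} \<and> \<Union>{e, f} \<subseteq> {0..<r * n}")
      case True
      then show ?thesis using prob_contains(1)[OF r, of "{e, f}" n] False by (simp add: numeral_2_eq_2)
    next
      case False
      then show ?thesis using prob_contains_invalid[OF r False] by (auto simp: edge_prob_def)
    qed
  qed
  have Y2: "(\<lambda>M. (Y M)\<^sup>2) = (\<lambda>M. \<Sum>e\<in>F. \<Sum>f\<in>F. indicator {M. {e, f} \<subseteq> M} M)"
    unfolding Ye power2_eq_square sum_product
    by (intro ext sum.cong refl) (auto simp: indicator_def)
  have EY2: "?E (\<lambda>M. (Y M)\<^sup>2) = (\<Sum>e\<in>F. \<Sum>f\<in>F. measure_pmf.prob ?p {M. {e, f} \<subseteq> M})"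
    unfolding Y2 by (subst Bochner_Integration.integral_sum, simp add: int, intro sum.cong refl,
        subst Bochner_Integration.integral_sum) (auto simp: int)
  also have "\<dots> \<le> (\<Sum>e\<in>F. \<Sum>f\<in>F. if e = f then edge_prob r n 1 else edge_prob r n 2)"
    by (intro sum_mono pair)
  also have "\<dots> \<le> (\<Sum>e\<in>F. \<Sum>f\<in>F. (if e = f then edge_prob r n 1 else 0) + edge_prob r n 2)"
    by (intro sum_mono) (auto simp: edge_prob_def)
  also have "\<dots> = mu + (real (card F))\<^sup>2 * edge_prob r n 2"
    using F(1) by (simp add: sum.distrib mu_def power2_eq_square algebra_simps)
  finally have b: "?E (\<lambda>M. (Y M)\<^sup>2) \<le> mu + (real (card F))\<^sup>2 * edge_prob r n 2" .
  have var: "measure_pmf.variance ?p Y \<le> mu + (real (card F))\<^sup>2 * edge_prob r n 2 - mu\<^sup>2"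
    using measure_pmf.variance_eq[OF int int, of n Y] EY b by simp
  have mu: "mu > 0" using pos by (simp add: mu_def)
  \<comment> \<open>On this event the distance from the mean is at least half the mean, hence the
    factor 4.\<close>
  have "measure_pmf.prob ?p {M. Y M \<le> mu / 2} \<le> measure_pmf.prob ?p {M \<in> space (measure_pmf ?p). mu / 2 \<le> \<bar>Y M - ?E Y\<bar>}"
    by (rule measure_pmf.finite_measure_mono) (use EY mu in \<open>auto simp: abs_if\<close>)
  also have "\<dots> \<le> measure_pmf.variance ?p Y / (mu / 2)\<^sup>2"
    by (rule measure_pmf.Chebyshev_inequality) (use int mu in auto)
  also have "\<dots> \<le> (mu + (real (card F))\<^sup>2 * edge_prob r n 2 - mu\<^sup>2) / (mu / 2)\<^sup>2"
    by (rule divide_right_mono[OF var]) simp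
  also have "\<dots> = 4 * (1 / mu + ((real (card F))\<^sup>2 * edge_prob r n 2 / mu\<^sup>2 - 1))"
    using mu by (simp add: field_simps power2_eq_square)
  also have "(real (card F))\<^sup>2 * edge_prob r n 2 / mu\<^sup>2 = edge_prob r n 2 / (edge_prob r n 1)\<^sup>2"
  proof -
    have "card F \<noteq> 0"
    proof
      assume "card F = 0"
      then have "mu = 0" by (simp add: mu_def)
      then show False using mu by simp
    qed
    then show ?thesis by (simp add: mu_def power_mult_distrib)
  qed
  finally show ?thesis by (simp add: Y_def mu_def)
qed

lemma edge_prob_1:
  assumes "r \<ge> 1" "n \<ge> 1"
  shows "edge_prob r n 1 = 1 / real ((r * n - 1) choose (r - 1))"
proof -
  obtain m where n: "n = Suc m" using assms by (cases n) auto
  show ?thesis using num_matchings_pos[OF assms(1), of m] by (simp add: edge_prob_def n)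
qed

text \<open>After cancellation the ratio is ((rn-1) choose (r-1)) / ((rn-r-1) choose (r-1)), a
  product of r - 1 quotients tending to 1: disjoint edges are asymptotically uncorrelated.\<close>

lemma edge_prob_ratio_tendsto:
  assumes r: "r \<ge> 1"
  shows "(\<lambda>n. edge_prob r n 2 / (edge_prob r n 1)\<^sup>2) \<longlonglongrightarrow> 1"
proof -
  define g where "g n = (\<Prod>i=0..<r - 1. (real r * real n - 1 - real i) / (real r * real n - real r - 1 - real i))" for n
  have "g \<longlonglongrightarrow> (\<Prod>i=0..<r - 1. 1)"
    unfolding g_def
  proof (rule tendsto_prod)
    fix i
    show "(\<lambda>n. (real r * real n - 1 - real i) / (real r * real n - real r - 1 - real i)) \<longlonglongrightarrow> 1"
      using r by real_asymp
  qed
  moreover have "eventually (\<lambda>n. g n = edge_prob r n 2 / (edge_prob r n 1)\<^sup>2) sequentially"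
    using eventually_ge_at_top[of 2]
  proof eventually_elim
    case (elim n)
    obtain m where n: "n = Suc (Suc m)"
      using elim by (metis One_nat_def Suc_1 Suc_le_D add_2_eq_Suc' le_add_diff_inverse2)
    let ?A = "(r * n - 1) choose (r - 1)" and ?B = "(r * Suc m - 1) choose (r - 1)"
    have pos: "real ?A > 0" "real ?B > 0" "real (num_matchings r m) > 0"
      using r num_matchings_pos[OF r, of m] by (auto simp: zero_less_binomial_iff n)
    have "edge_prob r n 2 / (edge_prob r n 1)\<^sup>2 = real ?A / real ?B"
      using pos by (simp add: edge_prob_def n field_simps power2_eq_square)
    also have "real ?A = (\<Prod>i=0..<r - 1. real r * real n - 1 - real i) / fact (r - 1)"
    proof -
      have "1 \<le> r * n" using r elim by simp
      then have "real (r * n - 1) = real r * real n - 1" by (simp add: of_nat_diff)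
      then show ?thesis by (simp add: binomial_gbinomial gbinomial_prod_rev)
    qed
    also have "real ?B = (\<Prod>i=0..<r - 1. real r * real n - real r - 1 - real i) / fact (r - 1)"
    proof -
      have "real (r * Suc m - 1) = real (r * Suc m) - 1" using r by (simp add: of_nat_diff)
      also have "real (r * Suc m) = real r * real n - real r"
        by (simp only: n of_nat_mult of_nat_Suc) algebra
      finally have "real (r * Suc m - 1) = real r * real n - real r - 1" .
      then show ?thesis by (simp add: binomial_gbinomial gbinomial_prod_rev)
    qed
    finally show ?case by (simp add: g_def prod_dividef)
  qed
  ultimately show ?thesis by (simp add: tendsto_cong)
qed

section \<open>Working with asymptotically almost sure events\<close>

lemma prob_compl: "measure_pmf.prob p {M. \<not> E M} = 1 - measure_pmf.prob p {M. E M}"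
  using measure_pmf.prob_compl[of "{M. E M}" p] by (simp add: Compl_eq_Diff_UNIV[symmetric] Collect_neg_eq)

lemma aas_iff: "aas E r \<longleftrightarrow> (\<lambda>n. measure_pmf.prob (RM r n) {M. \<not> E n M}) \<longlonglongrightarrow> 0"
proof -
  have "(\<lambda>n. measure_pmf.prob (RM r n) {M. E n M}) = (\<lambda>n. 1 - measure_pmf.prob (RM r n) {M. \<not> E n M})"
    by (simp add: prob_compl)
  moreover have "(\<lambda>n. measure_pmf.prob (RM r n) {M. \<not> E n M}) = (\<lambda>n. 1 - measure_pmf.prob (RM r n) {M. E n M})"
    by (simp add: prob_compl)
  ultimately show ?thesis unfolding aas_def
    using tendsto_diff[OF tendsto_const[of 1], of "\<lambda>n. measure_pmf.prob (RM r n) {M. \<not> E n M}" 0 sequentially]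
      tendsto_diff[OF tendsto_const[of 1], of "\<lambda>n. measure_pmf.prob (RM r n) {M. E n M}" 1 sequentially]
    by auto
qed

lemma aasI:
  assumes "eventually (\<lambda>n. measure_pmf.prob (RM r n) {M. \<not> E n M} \<le> b n) sequentially" "b \<longlonglongrightarrow> 0"
  shows "aas E r"
  unfolding aas_iff by (rule tendsto_sandwich[OF _ assms(1) tendsto_const assms(2)]) simp

lemma prob_RM_mono:
  assumes "r \<ge> 1" "\<And>M. M \<in> matchings r n \<Longrightarrow> A M \<Longrightarrow> B M"
  shows "measure_pmf.prob (RM r n) {M. A M} \<le> measure_pmf.prob (RM r n) {M. B M}"
  by (rule measure_pmf.finite_measure_mono_AE)
    (use assms(2) set_pmf_RM[OF assms(1)] in \<open>auto simp: AE_measure_pmf_iff\<close>)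

lemma aas_mono:
  assumes "r \<ge> 1" "aas E r" "eventually (\<lambda>n. \<forall>M\<in>matchings r n. E n M \<longrightarrow> E' n M) sequentially"
  shows "aas E' r"
proof (rule aasI)
  show "(\<lambda>n. measure_pmf.prob (RM r n) {M. \<not> E n M}) \<longlonglongrightarrow> 0" using assms(2) by (simp add: aas_iff)
  show "eventually (\<lambda>n. measure_pmf.prob (RM r n) {M. \<not> E' n M} \<le> measure_pmf.prob (RM r n) {M. \<not> E n M}) sequentially"
    using assms(3)
  proof eventually_elim
    case (elim n)
    show ?case by (rule prob_RM_mono[OF assms(1)]) (use elim in auto)
  qed
qed

lemma aas_conj:
  assumes "aas E r" "aas E' r" shows "aas (\<lambda>n M. E n M \<and> E' n M) r"
proof (rule aasI)
  show "(\<lambda>n. measure_pmf.prob (RM r n) {M. \<not> E n M} + measure_pmf.prob (RM r n) {M. \<not> E' n M}) \<longlonglongrightarrow> 0"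
    using tendsto_add[OF assms[unfolded aas_iff]] by simp
  show "eventually (\<lambda>n. measure_pmf.prob (RM r n) {M. \<not> (E n M \<and> E' n M)} \<le>
     measure_pmf.prob (RM r n) {M. \<not> E n M} + measure_pmf.prob (RM r n) {M. \<not> E' n M}) sequentially"
  proof (intro always_eventually allI)
    fix n
    have "{M. \<not> (E n M \<and> E' n M)} = {M. \<not> E n M} \<union> {M. \<not> E' n M}" by auto
    then show "measure_pmf.prob (RM r n) {M. \<not> (E n M \<and> E' n M)} \<le>
     measure_pmf.prob (RM r n) {M. \<not> E n M} + measure_pmf.prob (RM r n) {M. \<not> E' n M}"
      using measure_Un_le[of "{M. \<not> E n M}" "measure_pmf (RM r n)" "{M. \<not> E' n M}"] by simp
  qed
qed

lemma aas_ball: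
  assumes "finite I" "\<And>i. i \<in> I \<Longrightarrow> aas (E i) r"
  shows "aas (\<lambda>n M. \<forall>i\<in>I. E i n M) r"
  using assms
proof (induction I rule: finite_induct)
  case empty
  then show ?case by (simp add: aas_def)
next
  case (insert i I)
  then show ?case using aas_conj[of "E i" r "\<lambda>n M. \<forall>i\<in>I. E i n M"] by simp
qed

text \<open>The correlation error vanishes by \<open>edge_prob_ratio_tendsto\<close>, so a mean
  tending to infinity is enough for concentration.\<close>

lemma many_edges:
  assumes r: "r \<ge> 1" and F: "\<And>n. finite (F n)" "\<And>n e. e \<in> F n \<Longrightarrow> card e = r \<and> e \<subseteq> {0..<r * n}"
    and lim: "filterlim (\<lambda>n. real (card (F n)) * edge_prob r n 1) at_top sequentially"
  shows "aas (\<lambda>n M. real (card (F n)) * edge_prob r n 1 / 2 < real (card (M \<inter> F n))) r"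
proof (rule aasI)
  show "(\<lambda>n. 4 * (1 / (real (card (F n)) * edge_prob r n 1) + (edge_prob r n 2 / (edge_prob r n 1)\<^sup>2 - 1))) \<longlonglongrightarrow> 0"
  proof -
    have "(\<lambda>n. 1 / (real (card (F n)) * edge_prob r n 1)) \<longlonglongrightarrow> 0"
      using tendsto_inverse_0_at_top[OF lim] by (simp add: inverse_eq_divide)
    from tendsto_mult[OF tendsto_const[of 4] tendsto_add[OF this tendsto_diff[OF edge_prob_ratio_tendsto[OF r] tendsto_const[of 1]]]]
    show ?thesis by simp
  qed
  have "eventually (\<lambda>n. real (card (F n)) * edge_prob r n 1 > 0) sequentially"
    using lim by (simp add: filterlim_at_top_dense)
  then show "eventually (\<lambda>n. measure_pmf.prob (RM r n) {M. \<not> real (card (F n)) * edge_prob r n 1 / 2 < real (card (M \<inter> F n))}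
    \<le> 4 * (1 / (real (card (F n)) * edge_prob r n 1) + (edge_prob r n 2 / (edge_prob r n 1)\<^sup>2 - 1))) sequentially"
  proof eventually_elim
    case (elim n)
    show ?case using second_moment[OF r F(1) F(2) elim] by (simp add: not_less)
  qed
qed

section \<open>Upper bounds\<close>

lemma card_coord: "is_ord_matching r S \<Longrightarrow> l < r \<Longrightarrow> card (coord S l) = card S"
  unfolding coord_def by (rule card_image) (rule inj_on_vx)

lemma coord_subset:
  assumes "is_ord_matching r S" "l < r" "\<Union>S \<subseteq> V" shows "coord S l \<subseteq> V"
proof
  fix x assume "x \<in> coord S l"
  then obtain e where e: "e \<in> S" "x = vx e l" by (auto simp: coord_def)
  have "vx e l \<in> e" by (rule vx_mem) (use matching_redge(2)[OF assms(1) e(1)] assms(2) in \<open>auto simp: redge_def\<close>)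
  then show "x \<in> V" using assms(3) e by blast
qed

lemma card_coord_pairs:
  assumes "is_ord_matching r S" "i < r" shows "card (coord_pairs i j S) = card S"
  unfolding coord_pairs_def
  by (rule card_image) (use inj_on_vx[OF assms] in \<open>auto simp: inj_on_def\<close>)

lemma coord_pairs_subset:
  assumes "is_ord_matching r S" "i < r" "j < r" "\<Union>S \<subseteq> V" shows "coord_pairs i j S \<subseteq> V \<times> V"
  using coord_subset[OF assms(1,2,4)] coord_subset[OF assms(1,3,4)]
  by (auto simp: coord_pairs_def coord_def)

definition cliques :: "nat \<Rightarrow> bool list set \<Rightarrow> nat \<Rightarrow> nat \<Rightarrow> nat set set set" where
  "cliques r Ps N k = {S. is_clique r Ps S \<and> card S = k \<and> \<Union>S \<subseteq> {0..<N}}"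

lemma finite_cliques: "finite (cliques r Ps N k)"
  by (rule finite_subset[of _ "Pow (Pow {0..<N})"]) (auto simp: cliques_def)

text \<open>The r coordinate sets determine the clique, and each of them is one of at most N^k / k!
  subsets.\<close>

lemma card_separated_cliques:
  assumes "i < j" "j < r" "separated X i j" "\<not> separated Y i j"
  shows "card (cliques r {X, Y} N k) * fact k ^ r \<le> N ^ (r * k)"
proof -
  let ?T = "{..<r} \<rightarrow>\<^sub>E {A. A \<subseteq> {0..<N} \<and> card A = k}"
  have "card (cliques r {X, Y} N k) \<le> card ?T"
  proof (rule card_inj_on_le)
    show "inj_on (\<lambda>S. restrict (coord S) {..<r}) (cliques r {X, Y} N k)"
    proof (rule inj_onI)
      fix S S' assume S: "S \<in> cliques r {X, Y} N k" "S' \<in> cliques r {X, Y} N k"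
        and eq: "restrict (coord S) {..<r} = restrict (coord S') {..<r}"
      have "coord S l = coord S' l" if "l < r" for l
        using fun_cong[OF eq, of l] that by simp
      then show "S = S'"
        using separated_clique_eqI[OF _ _ assms, of S S'] S by (auto simp: cliques_def)
    qed
    show "(\<lambda>S. restrict (coord S) {..<r}) ` cliques r {X, Y} N k \<subseteq> ?T"
    proof (rule image_subsetI)
      fix S assume "S \<in> cliques r {X, Y} N k"
      then have S: "is_ord_matching r S" "card S = k" "\<Union>S \<subseteq> {0..<N}"
        by (auto simp: cliques_def clique_matching)
      have "coord S l \<subseteq> {0..<N}" "card (coord S l) = k" if "l < r" for l
        using coord_subset[OF S(1) that S(3)] card_coord[OF S(1) that] S(2) by auto
      then show "restrict (coord S) {..<r} \<in> ?T" by (simp add: PiE_iff)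
    qed
    show "finite ?T" by (intro finite_PiE) auto
  qed
  also have "card ?T = (N choose k) ^ r" using n_subsets[of "{0..<N}" k] by (simp add: card_PiE)
  finally have "card (cliques r {X, Y} N k) * fact k ^ r \<le> (N choose k) ^ r * fact k ^ r" by simp
  also have "\<dots> = ((N choose k) * fact k) ^ r" by (simp add: power_mult_distrib)
  also have "\<dots> \<le> (N ^ k) ^ r" by (intro power_mono binomial_fact_pow) simp
  also have "\<dots> = N ^ (r * k)" by (simp add: power_mult[symmetric] mult.commute)
  finally show ?thesis .
qed

text \<open>The pairs at coordinates 0 and \<open>j\<close> form one k-subset of [N]^2, so these two
  coordinates share a single factor 1/k!.\<close>

lemma card_sign_cliques:
  assumes j: "j < r" and sg: "before P j j \<noteq> before Q j j" "before P 0 0" "before Q 0 0"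
  shows "card (cliques r {P, Q} N k) * fact k ^ (r - 1) \<le> N ^ (r * k)"
proof -
  have j0: "j \<noteq> 0" using sg by (cases j) auto
  define J where "J = {..<r} - {0, j}"
  have cJ: "card J = r - 2" using j j0 by (simp add: J_def card_Diff_subset)
  let ?T = "(J \<rightarrow>\<^sub>E {A. A \<subseteq> {0..<N} \<and> card A = k}) \<times> {A. A \<subseteq> {0..<N} \<times> {0..<N} \<and> card A = k}"
  have "card (cliques r {P, Q} N k) \<le> card ?T"
  proof (rule card_inj_on_le)
    show "inj_on (\<lambda>S. (restrict (coord S) J, coord_pairs 0 j S)) (cliques r {P, Q} N k)"
    proof (rule inj_onI)
      fix S S' assume S: "S \<in> cliques r {P, Q} N k" "S' \<in> cliques r {P, Q} N k"
        and eq: "(restrict (coord S) J, coord_pairs 0 j S) = (restrict (coord S') J, coord_pairs 0 j S')"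
      have eq': "restrict (coord S) J = restrict (coord S') J" using eq by simp
      have "coord S l = coord S' l" if "l < r" "l \<noteq> 0" "l \<noteq> j" for l
        using fun_cong[OF eq', of l] that by (simp add: J_def)
      then show "S = S'"
        using sign_clique_eqI[OF _ _ j sg, of S S'] S eq by (auto simp: cliques_def)
    qed
    show "(\<lambda>S. (restrict (coord S) J, coord_pairs 0 j S)) ` cliques r {P, Q} N k \<subseteq> ?T"
    proof (rule image_subsetI)
      fix S assume "S \<in> cliques r {P, Q} N k"
      then have S: "is_ord_matching r S" "card S = k" "\<Union>S \<subseteq> {0..<N}"
        by (auto simp: cliques_def clique_matching)
      have 1: "coord S l \<subseteq> {0..<N}" "card (coord S l) = k" if "l \<in> J" for l
        using coord_subset[OF S(1) _ S(3), of l] card_coord[OF S(1), of l] S(2) that by (auto simp: J_def)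
      have 2: "coord_pairs 0 j S \<subseteq> {0..<N} \<times> {0..<N}" "card (coord_pairs 0 j S) = k"
        using coord_pairs_subset[OF S(1) _ j S(3), of 0] card_coord_pairs[OF S(1), of 0 j] S(2) j by auto
      show "(restrict (coord S) J, coord_pairs 0 j S) \<in> ?T"
        using 1 2 by (simp add: PiE_iff)
    qed
    show "finite ?T" by (intro finite_cartesian_product finite_PiE) (auto simp: J_def)
  qed
  also have "card ?T = (N choose k) ^ (r - 2) * ((N * N) choose k)"
  proof -
    have "card (J \<rightarrow>\<^sub>E {A. A \<subseteq> {0..<N} \<and> card A = k}) = (N choose k) ^ (r - 2)"
      using n_subsets[of "{0..<N}" k] cJ by (simp add: card_PiE J_def)
    moreover have "card {A. A \<subseteq> {0..<N} \<times> {0..<N} \<and> card A = k} = (N * N) choose k"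
      using n_subsets[of "{0..<N} \<times> {0..<N}" k] by simp
    ultimately show ?thesis by (simp add: card_cartesian_product)
  qed
  finally have "card (cliques r {P, Q} N k) * fact k ^ (r - 1)
     \<le> ((N choose k) ^ (r - 2) * ((N * N) choose k)) * fact k ^ (r - 1)" by simp
  also have "\<dots> = ((N choose k) * fact k) ^ (r - 2) * (((N * N) choose k) * fact k)"
  proof -
    have "r - 1 = Suc (r - 2)" using j j0 by simp
    then show ?thesis by (simp add: power_mult_distrib)
  qed
  also have "\<dots> \<le> (N ^ k) ^ (r - 2) * (N * N) ^ k"
    by (intro mult_mono power_mono binomial_fact_pow) simp_all
  also have "\<dots> = N ^ (k * (r - 2) + 2 * k)"
    by (simp add: power_mult[symmetric] power_add power_mult_distrib mult_2)
  also have "k * (r - 2) + 2 * k = r * k"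
  proof -
    define q where "q = r - 2"
    have "r = q + 2" using j j0 by (simp add: q_def)
    then show ?thesis by (simp add: algebra_simps)
  qed
  finally show ?thesis .
qed

lemma pow_div_exp_le_fact: "(real k / exp 1) ^ k \<le> fact k"
  using fact_ratio_ge[of 0 k] by simp

lemma finite_matching: "M \<in> matchings r n \<Longrightarrow> finite M"
  by (auto simp: matchings_def is_ord_matching_def)

text \<open>The parameter \<open>s\<close> is the number of factors 1/k! won in the clique count,
  and it alone decides the exponent.\<close>

lemma upper_bound:
  assumes r: "r \<ge> 1" and s: "s \<ge> 1"
    and cnt: "\<And>N k. card (cliques r Ps N k) * fact k ^ s \<le> N ^ (r * k)"
  shows "\<exists>C>0. aas (\<lambda>n M. real (z_of r Ps M) \<le> C * real n powr (1 / real s)) r"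
proof -
  \<comment> \<open>The k-th root of the expected number of cliques is at most r^r e^(r-1) e^s n /
    k^s; this constant makes it at most 1/2 once k^s \<ge> K n.\<close>
  define K where "K = 2 * real r ^ r * exp 1 ^ (r - 1) * exp 1 ^ s"
  have K1: "K \<ge> 1"
  proof -
    have "1 * 1 * 1 * 1 \<le> 2 * real r ^ r * exp 1 ^ (r - 1) * exp 1 ^ s"
      by (intro mult_mono one_le_power) (use r in auto)
    then show ?thesis by (simp add: K_def)
  qed
  define k where "k n = nat \<lceil>K * real n powr (1 / real s)\<rceil>" for n
  have "aas (\<lambda>n M. real (z_of r Ps M) \<le> K * real n powr (1 / real s)) r"
  proof (rule aasI)
    show "(\<lambda>n. (1 / 2) ^ k n) \<longlonglongrightarrow> (0::real)"
    proof -
      have "filterlim k at_top sequentially"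
        unfolding k_def using K1 s by real_asymp
      then show ?thesis by (rule filterlim_compose[OF LIMSEQ_power_zero, rotated]) simp
    qed
    show "eventually (\<lambda>n. measure_pmf.prob (RM r n) {M. \<not> real (z_of r Ps M) \<le> K * real n powr (1 / real s)} \<le> (1 / 2) ^ k n) sequentially"
      using eventually_ge_at_top[of 1]
    proof eventually_elim
      case (elim n)
      let ?k = "k n"
      let ?x = "K * real n powr (1 / real s)"
      have x0: "?x > 0" using K1 elim by simp
      have kx: "?x \<le> real ?k" unfolding k_def by linarith
      have kpos: "?k \<ge> 1" using x0 kx by linarith
      have "measure_pmf.prob (RM r n) {M. \<not> real (z_of r Ps M) \<le> ?x}
        \<le> measure_pmf.prob (RM r n) {M. \<exists>S\<in>cliques r Ps (r * n) ?k. S \<subseteq> M}"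
      proof (rule prob_RM_mono[OF r])
        fix M assume M: "M \<in> matchings r n" "\<not> real (z_of r Ps M) \<le> ?x"
        have "?k \<le> z_of r Ps M" using M(2) unfolding k_def by linarith
        then obtain S where "S \<subseteq> M" "is_clique r Ps S" "card S = ?k"
          using z_of_subclique[OF finite_matching[OF M(1)]] by blast
        moreover have "\<Union>S \<subseteq> {0..<r * n}" using M(1) \<open>S \<subseteq> M\<close> by (auto simp: matchings_def)
        ultimately show "\<exists>S\<in>cliques r Ps (r * n) ?k. S \<subseteq> M" by (auto simp: cliques_def)
      qed
      also have "\<dots> \<le> real (card (cliques r Ps (r * n) ?k)) * (exp 1 / real n) ^ ((r - 1) * ?k)"
        by (rule first_moment[OF r elim finite_cliques]) (simp add: cliques_def)
      also have "\<dots> \<le> (real (r * n) ^ r * (exp 1 / real n) ^ (r - 1) * (exp 1 / real ?k) ^ s) ^ ?k"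
      proof -
        let ?A = "real (card (cliques r Ps (r * n) ?k))"
        let ?B = "((real ?k / exp 1) ^ ?k) ^ s" and ?D = "((exp 1 / real ?k) ^ s) ^ ?k"
        have A: "?A * fact ?k ^ s \<le> real (r * n) ^ (r * ?k)"
          using of_nat_mono[OF cnt[of "r * n" ?k], where 'a = real] by simp
        have "?B \<le> fact ?k ^ s"
          by (intro power_mono pow_div_exp_le_fact) simp
        then have "?A * ?B \<le> ?A * fact ?k ^ s" by (rule mult_left_mono) simp
        then have AB: "?A * ?B \<le> real (r * n) ^ (r * ?k)" using A by (rule order_trans)
        have "?B = ((real ?k / exp 1) ^ s) ^ ?k"
          by (simp only: power_mult[symmetric] mult.commute)
        then have "?B * ?D = ((real ?k / exp 1) ^ s * (exp 1 / real ?k) ^ s) ^ ?k"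
          by (simp only: power_mult_distrib)
        also have "(real ?k / exp 1) ^ s * (exp 1 / real ?k) ^ s = 1"
          using kpos by (simp add: power_divide)
        finally have "?B * ?D = 1" by simp
        then have "?A = ?A * ?B * ?D" by (simp only: mult.assoc mult_1_right)
        also have "\<dots> \<le> real (r * n) ^ (r * ?k) * ?D" by (rule mult_right_mono[OF AB]) simp
        finally have "?A * (exp 1 / real n) ^ ((r - 1) * ?k)
          \<le> (real (r * n) ^ (r * ?k) * ?D) * (exp 1 / real n) ^ ((r - 1) * ?k)"
          by (rule mult_right_mono) simp
        then show ?thesis unfolding power_mult power_mult_distrib by (simp only: mult_ac)
      qed
      also have "\<dots> \<le> (1 / 2) ^ ?k"
      proof (rule power_mono)
        have "K * real n \<le> K ^ s * real n"
          using K1 s elim by (intro mult_right_mono) (auto intro: self_le_power)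
        also have "\<dots> = ?x ^ s"
          using elim s by (simp add: power_mult_distrib powr_realpow[symmetric] powr_powr del: powr_realpow)
        also have "\<dots> \<le> real ?k ^ s" by (intro power_mono kx) (use x0 in simp)
        finally have kk: "K * real n \<le> real ?k ^ s" .
        have "real (r * n) ^ r * (exp 1 / real n) ^ (r - 1) = real r ^ r * exp 1 ^ (r - 1) * real n"
        proof -
          have "real n ^ r = real n ^ (r - 1) * real n" using r by (cases r) auto
          then show ?thesis using elim by (simp add: power_mult_distrib power_divide)
        qed
        then have "real (r * n) ^ r * (exp 1 / real n) ^ (r - 1) * (exp 1 / real ?k) ^ s
          = (K * real n) / (2 * real ?k ^ s)"
          by (simp add: K_def power_divide)
        also have "\<dots> \<le> 1 / 2" using kk kpos by (simp add: field_simps)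
        finally show "real (r * n) ^ r * (exp 1 / real n) ^ (r - 1) * (exp 1 / real ?k) ^ s \<le> 1 / 2" .
      qed simp
      finally show ?case .
    qed
  qed
  then show ?thesis using K1 by (intro exI[of _ K]) auto
qed

section \<open>Blow-ups\<close>

text \<open>Every vertex v becomes the interval of \<open>L\<close> vertices starting at v * L, and
  an edge becomes the family of its transversals; division by \<open>L\<close> recovers the original
  edge.\<close>

definition blowup :: "nat \<Rightarrow> nat set \<Rightarrow> nat set set" where
  "blowup L e = (\<lambda>x. (\<lambda>v. v * L + x v) ` e) ` (e \<rightarrow>\<^sub>E {..<L})"

lemma blowupE:
  assumes "e' \<in> blowup L e"
  obtains x where "e' = (\<lambda>v. v * L + x v) ` e" "\<And>v. v \<in> e \<Longrightarrow> x v < L" "\<And>v. v \<in> e \<Longrightarrow> (v * L + x v) div L = v"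
proof -
  obtain x where x: "x \<in> e \<rightarrow>\<^sub>E {..<L}" "e' = (\<lambda>v. v * L + x v) ` e" using assms by (auto simp: blowup_def)
  have lt: "x v < L" if "v \<in> e" for v using x(1) that by auto
  then have "(v * L + x v) div L = v" if "v \<in> e" for v using lt[OF that] by simp
  then show ?thesis using that x(2) lt by blast
qed

lemma blowup_div: "e' \<in> blowup L e \<Longrightarrow> (\<lambda>u. u div L) ` e' = e"
  by (erule blowupE) (simp add: image_image)

lemma card_blowup:
  assumes "finite e" shows "card (blowup L e) = L ^ card e" "finite (blowup L e)"
proof -
  have "inj_on (\<lambda>x. (\<lambda>v. v * L + x v) ` e) (e \<rightarrow>\<^sub>E {..<L})"
  proof (rule inj_onI)
    fix x y assume x: "x \<in> e \<rightarrow>\<^sub>E {..<L}" and y: "y \<in> e \<rightarrow>\<^sub>E {..<L}"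
      and eq: "(\<lambda>v. v * L + x v) ` e = (\<lambda>v. v * L + y v) ` e"
    show "x = y"
    proof (rule PiE_ext[OF x y])
      fix v assume v: "v \<in> e"
      then have "v * L + x v \<in> (\<lambda>v. v * L + y v) ` e" using eq by blast
      then obtain w where w: "w \<in> e" "v * L + x v = w * L + y w" by auto
      have "x v < L" "y w < L" using x y v w by (auto simp: PiE_iff)
      then have "(v * L + x v) div L = v" "(w * L + y w) div L = w" by simp_all
      then have "v = w" using w(2) by simp
      then show "x v = y v" using w(2) by simp
    qed
  qed
  then show "card (blowup L e) = L ^ card e"
    unfolding blowup_def using assms by (simp add: card_image card_PiE)
  show "finite (blowup L e)" unfolding blowup_def using assms by (intro finite_imageI finite_PiE) auto
qed

lemma blowup_vx:
  assumes "redge r e" "e' \<in> blowup L e"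
  shows "redge r e'" "l < r \<Longrightarrow> vx e' l div L = vx e l"
proof -
  obtain x where x: "e' = (\<lambda>v. v * L + x v) ` e" "\<And>v. v \<in> e \<Longrightarrow> x v < L"
    "\<And>v. v \<in> e \<Longrightarrow> (v * L + x v) div L = v"
    using blowupE[OF assms(2)] by blast
  have e: "finite e" "card e = r" using assms(1) by (auto simp: redge_def)
  have "inj_on (\<lambda>v. v * L + x v) e"
    by (rule inj_on_inverseI[of _ "\<lambda>u. u div L"]) (use x(3) in simp)
  then show "redge r e'" using e by (simp add: x(1) redge_def card_image)
  define g where "g l = vx e l * L + x (vx e l)" for l
  have vm: "vx e l \<in> e" if "l < r" for l using vx_mem[of e l] e that by simp
  have "g i < g j" if "i < j" "j < r" for i j
  proof -
    have "vx e i + 1 \<le> vx e j" using vx_less[of e i j] e that by simp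
    then have "(vx e i + 1) * L \<le> vx e j * L" by (rule mult_right_mono) simp
    moreover have "x (vx e i) < L" using x(2)[OF vm] that by simp
    ultimately show ?thesis by (simp add: g_def)
  qed
  then have "strict_mono_on {..<r} g" by (auto simp: strict_mono_on_def)
  moreover have "e' = g ` {..<r}"
  proof -
    have "e' = (\<lambda>v. v * L + x v) ` (vx e ` {..<r})" using vx_image[OF e(1)] e(2) x(1) by simp
    then show ?thesis by (simp add: image_image g_def)
  qed
  ultimately have "vx e' l = g l" if "l < r" for l using vx_unique that by blast
  then show "l < r \<Longrightarrow> vx e' l div L = vx e l" using x(3)[OF vm] by (simp add: g_def)
qed

lemma blowup_subset:
  assumes "e' \<in> blowup L e" "e \<subseteq> {0..<N}" shows "e' \<subseteq> {0..<N * L}"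
proof
  fix u assume "u \<in> e'"
  obtain x where x: "e' = (\<lambda>v. v * L + x v) ` e" "\<And>v. v \<in> e \<Longrightarrow> x v < L"
    using blowupE[OF assms(1)] by blast
  then obtain v where v: "v \<in> e" "u = v * L + x v" using \<open>u \<in> e'\<close> by auto
  have "Suc v * L \<le> N * L" using assms(2) v by (intro mult_right_mono) auto
  then show "u \<in> {0..<N * L}" using x(2)[OF v(1)] v(2) by simp
qed

lemma blowup_disjoint:
  assumes "e \<inter> f = {}" "e' \<in> blowup L e" "f' \<in> blowup L f" shows "e' \<inter> f' = {}"
  using blowup_div[OF assms(2)] blowup_div[OF assms(3)] assms(1) by blast

text \<open>Distinct vertices move into disjoint intervals in the same order, so no comparison
  changes.\<close>

lemma blowup_forms:
  assumes e: "redge r e" "redge r f" "e \<inter> f = {}" "r \<ge> 1"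
    and b: "e' \<in> blowup L e" "f' \<in> blowup L f" and X: "forms e f X"
  shows "forms e' f' X"
proof (rule forms_transfer[OF e(1-3) blowup_vx(1)[OF e(1) b(1)] blowup_vx(1)[OF e(2) b(2)] blowup_disjoint[OF e(3) b] e(4) _ X])
  fix i m assume im: "i < r" "m < r"
  have d: "vx e' i div L = vx e i" "vx f' m div L = vx f m"
    using blowup_vx(2)[OF e(1) b(1) im(1)] blowup_vx(2)[OF e(2) b(2) im(2)] .
  show "vx e i < vx f m \<longleftrightarrow> vx e' i < vx f' m"
  proof
    assume "vx e i < vx f m"
    then show "vx e' i < vx f' m" using d div_le_mono[of "vx f' m" "vx e' i" L] by linarith
  next
    assume "vx e' i < vx f' m"
    then have "vx e i \<le> vx f m" using d div_le_mono[of "vx e' i" "vx f' m" L] by linarith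
    moreover have "vx e i \<noteq> vx f m" using vx_less_or_greater[OF e(1-3) im] by linarith
    ultimately show "vx e i < vx f m" by simp
  qed
qed

lemma edge_prob_1_ge:
  assumes "r \<ge> 1" "n \<ge> 1" shows "edge_prob r n 1 \<ge> 1 / real (r * n) ^ (r - 1)"
proof -
  let ?b = "(r * n - 1) choose (r - 1)"
  have "r \<le> r * n" using assms by simp
  then have "r - 1 \<le> r * n - 1" by linarith
  then have b: "?b > 0" by (simp add: zero_less_binomial_iff)
  have "?b * 1 \<le> ?b * fact (r - 1)" by (intro mult_le_mono) (auto simp: fact_ge_1)
  also have "\<dots> \<le> (r * n - 1) ^ (r - 1)" by (rule binomial_fact_pow)
  also have "\<dots> \<le> (r * n) ^ (r - 1)" by (intro power_mono) auto
  finally have le: "real ?b \<le> real ((r * n) ^ (r - 1))" by (simp only: of_nat_le_iff mult_1_right)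
  have "real ?b > 0" using b by (simp only: of_nat_0_less_iff)
  then have "1 / real ((r * n) ^ (r - 1)) \<le> 1 / real ?b"
    by (intro frac_le[OF zero_le_one order_refl _ le])
  then show ?thesis by (simp only: edge_prob_1[OF assms] of_nat_power)
qed

text \<open>Serves both the copies of a fixed clique and the rook placements; \<open>d\<close>
  decodes a blown-up edge.\<close>

lemma cliqueI_blowup:
  assumes r: "r \<ge> 1" and T: "finite T" "\<And>f. f \<in> T \<Longrightarrow> redge r (d f) \<and> f \<in> blowup L (d f)"
    and pw: "\<And>f g. f \<in> T \<Longrightarrow> g \<in> T \<Longrightarrow> f \<noteq> g \<Longrightarrow> d f \<inter> d g = {} \<and> (\<exists>X\<in>Ps. forms (d f) (d g) X)"
  shows "is_clique r Ps T"
proof -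
  have re: "redge r f" if "f \<in> T" for f using T(2)[OF that] blowup_vx(1) by blast
  have "f \<inter> g = {}" if "f \<in> T" "g \<in> T" "f \<noteq> g" for f g
    using blowup_disjoint[of "d f" "d g" f L g] T(2)[OF that(1)] T(2)[OF that(2)] pw[OF that] by blast
  moreover have "\<exists>X\<in>Ps. forms f g X" if "f \<in> T" "g \<in> T" "f \<noteq> g" for f g
    using blowup_forms[of r "d f" "d g" f L g] r T(2)[OF that(1)] T(2)[OF that(2)] pw[OF that] by blast
  ultimately show ?thesis
    using re T(1) unfolding is_clique_def is_ord_matching_def redge_def by blast
qed

text \<open>[rn] is cut into \<open>N\<close> intervals of length \<open>L n\<close>. An edge of
  \<open>K\<close> has L^r copies, each of probability at least (rn)^(1-r), so the expected number
  of copies present grows linearly; one copy of each edge makes a clique.\<close>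

lemma contains_fixed_clique:
  assumes r: "r \<ge> 1" and K: "is_clique r Ps K"
  shows "aas (\<lambda>n M. card K \<le> z_of r Ps M) r"
proof -
  note RK = matching_redge[OF clique_matching[OF K]]
  have finU: "finite (\<Union>K)" using RK by (auto simp: redge_def)
  define N where "N = Suc (Max (insert 0 (\<Union>K)))"
  have sub: "e \<subseteq> {0..<N}" if "e \<in> K" for e
  proof
    fix v assume "v \<in> e"
    then have "v \<le> Max (insert 0 (\<Union>K))" using finU that by (intro Max_ge) auto
    then show "v \<in> {0..<N}" by (simp add: N_def)
  qed
  have N: "N \<ge> 1" by (simp add: N_def)
  define L where "L n = r * n div N" for n
  have each: "aas (\<lambda>n M. M \<inter> blowup (L n) e \<noteq> {}) r" if e: "e \<in> K" for e
  proof -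
    have re: "finite e" "card e = r" using RK(2)[OF e] by (auto simp: redge_def)
    have lim: "filterlim (\<lambda>n. real (card (blowup (L n) e)) * edge_prob r n 1) at_top sequentially"
    proof (rule filterlim_at_top_mono)
      show "filterlim (\<lambda>n. real (r * n) / (2 * real N) ^ r) at_top sequentially"
      proof -
        have "real r / (2 * real N) ^ r > 0" using N r by simp
        from filterlim_tendsto_pos_mult_at_top[OF tendsto_const this filterlim_real_sequentially]
        show ?thesis by (simp only: of_nat_mult times_divide_eq_left)
      qed
      \<comment> \<open>The factor 2 absorbs the rounding: rn < (L + 1) N \<le> 2 L N once L \<ge>
        1.\<close>
      show "eventually (\<lambda>n. real (r * n) / (2 * real N) ^ r \<le> real (card (blowup (L n) e)) * edge_prob r n 1) sequentially"
        using eventually_ge_at_top[of N]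
      proof eventually_elim
        case (elim n)
        have n1: "n \<ge> 1" using elim N by simp
        have "1 * n \<le> r * n" using r by (rule mult_right_mono) simp
        then have "N \<le> r * n" using elim by linarith
        then have "L n \<ge> 1" using N by (simp add: L_def div_greater_zero_iff Suc_le_eq)
        then have "1 * N \<le> L n * N" by (rule mult_right_mono) simp
        moreover have "r * n < L n * N + N"
          using N dividend_less_div_times[of N "r * n"] by (simp add: L_def algebra_simps)
        ultimately have "r * n \<le> 2 * (L n * N)" by linarith
        then have "real (r * n) \<le> real (2 * (L n * N))" by (simp only: of_nat_le_iff)
        then have "real (r * n) \<le> 2 * real (L n) * real N" by simp
        then have "real (r * n) / (2 * real N) \<le> real (L n)"
          using N by (simp add: divide_le_eq mult.commute mult.left_commute)
        then have "(real (r * n) / (2 * real N)) ^ r \<le> real (L n) ^ r" by (intro power_mono) auto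
        then have "(real (r * n) / (2 * real N)) ^ r * (1 / real (r * n) ^ (r - 1))
          \<le> real (L n) ^ r * edge_prob r n 1"
          by (intro mult_mono edge_prob_1_ge r n1) auto
        moreover have "(real (r * n) / (2 * real N)) ^ r * (1 / real (r * n) ^ (r - 1)) = real (r * n) / (2 * real N) ^ r"
        proof -
          have "real (r * n) ^ r = real (r * n) * real (r * n) ^ (r - 1)" using r by (cases r) auto
          moreover have "real (r * n) \<noteq> 0" using r n1 by simp
          ultimately show ?thesis by (simp add: power_divide)
        qed
        ultimately show ?case using card_blowup[OF re(1), of "L n"] re(2) by simp
      qed
    qed
    have sub': "f \<subseteq> {0..<r * n}" if "f \<in> blowup (L n) e" for f n
    proof -
      have "N * L n \<le> r * n" by (simp add: L_def)
      then show ?thesis using blowup_subset[OF that sub[OF e]] by auto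
    qed
    have "aas (\<lambda>n M. real (card (blowup (L n) e)) * edge_prob r n 1 / 2 < real (card (M \<inter> blowup (L n) e))) r"
      by (rule many_edges[OF r _ _ lim])
        (use card_blowup(2)[OF re(1)] sub' blowup_vx(1)[OF RK(2)[OF e]] in \<open>auto simp: redge_def\<close>)
    then show ?thesis
    proof (rule aas_mono[OF r])
      have "M \<inter> blowup (L n) e \<noteq> {}"
        if "real (card (blowup (L n) e)) * edge_prob r n 1 / 2 < real (card (M \<inter> blowup (L n) e))" for n M
      proof
        assume "M \<inter> blowup (L n) e = {}"
        then have "real (card (blowup (L n) e)) * edge_prob r n 1 < 0" using that by simp
        moreover have "real (card (blowup (L n) e)) * edge_prob r n 1 \<ge> 0" by (simp add: edge_prob_def)
        ultimately show False by simp
      qed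
      then show "eventually (\<lambda>n. \<forall>M\<in>matchings r n. real (card (blowup (L n) e)) * edge_prob r n 1 / 2 < real (card (M \<inter> blowup (L n) e)) \<longrightarrow> M \<inter> blowup (L n) e \<noteq> {}) sequentially"
        by (intro always_eventually) blast
    qed
  qed
  have "aas (\<lambda>n M. \<forall>e\<in>K. M \<inter> blowup (L n) e \<noteq> {}) r"
    by (rule aas_ball[OF RK(1) each])
  then show ?thesis
  proof (rule aas_mono[OF r], intro always_eventually allI ballI impI)
    fix n M assume M: "M \<in> matchings r n" and ex: "\<forall>e\<in>K. M \<inter> blowup (L n) e \<noteq> {}"
    have "\<forall>e\<in>K. \<exists>f. f \<in> M \<and> f \<in> blowup (L n) e" using ex by blast
    from bchoice[OF this] obtain h where "\<forall>e\<in>K. h e \<in> M \<and> h e \<in> blowup (L n) e" by blast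
    then have h: "\<And>e. e \<in> K \<Longrightarrow> h e \<in> M \<and> h e \<in> blowup (L n) e" by blast
    have dh: "(\<lambda>u. u div L n) ` h e = e" if "e \<in> K" for e using blowup_div h[OF that] by blast
    have inj: "inj_on h K" by (rule inj_on_inverseI[of _ "\<lambda>f. (\<lambda>u. u div L n) ` f"]) (rule dh)
    have "is_clique r Ps (h ` K)"
    proof (rule cliqueI_blowup[OF r, where d = "\<lambda>f. (\<lambda>u. u div L n) ` f"])
      show "finite (h ` K)" using RK(1) by simp
      show "redge r ((\<lambda>u. u div L n) ` f) \<and> f \<in> blowup (L n) ((\<lambda>u. u div L n) ` f)" if f: "f \<in> h ` K" for f
      proof -
        obtain e where "e \<in> K" "f = h e" using f by auto
        then show ?thesis using dh[of e] h[of e] RK(2)[of e] by simp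
      qed
      show "(\<lambda>u. u div L n) ` f \<inter> (\<lambda>u. u div L n) ` g = {} \<and> (\<exists>X\<in>Ps. forms ((\<lambda>u. u div L n) ` f) ((\<lambda>u. u div L n) ` g) X)"
        if fg: "f \<in> h ` K" "g \<in> h ` K" "f \<noteq> g" for f g
      proof -
        obtain e1 e2 where e: "e1 \<in> K" "e2 \<in> K" "f = h e1" "g = h e2" using fg by auto
        then have ne: "e1 \<noteq> e2" using fg(3) by auto
        have "\<exists>X\<in>Ps. forms e1 e2 X"
          using conjunct2[OF K[unfolded is_clique_def]] e(1,2) ne by blast
        then show ?thesis unfolding e(3,4) dh[OF e(1)] dh[OF e(2)]
          using RK(3)[OF e(1,2) ne] by (rule conjI[rotated])
      qed
    qed
    then have "card (h ` K) \<le> z_of r Ps M"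
      using z_of_ge[OF finite_matching[OF M]] h by blast
    then show "card K \<le> z_of r Ps M" using card_image[OF inj] by simp
  qed
qed

section \<open>Rook placements\<close>

text \<open>\<open>T\<close> is maximal under inclusion: an element of \<open>X\<close> avoiding all
  rows and columns of \<open>T\<close> could be added.\<close>

lemma covering_rook:
  assumes "finite X"
  obtains T where "T \<subseteq> X" "\<forall>x\<in>T. \<forall>y\<in>T. x \<noteq> y \<longrightarrow> a x \<noteq> a y \<and> b x \<noteq> b y"
    "\<forall>x\<in>X. a x \<in> a ` T \<or> b x \<in> b ` T"
proof -
  define R where "R = {T. T \<subseteq> X \<and> (\<forall>x\<in>T. \<forall>y\<in>T. x \<noteq> y \<longrightarrow> a x \<noteq> a y \<and> b x \<noteq> b y)}"
  have "finite R" by (rule finite_subset[of _ "Pow X"]) (use assms in \<open>auto simp: R_def\<close>)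
  moreover have "{} \<in> R" by (simp add: R_def)
  ultimately obtain T where T: "T \<in> R" "\<And>U. U \<in> R \<Longrightarrow> T \<subseteq> U \<Longrightarrow> T = U"
    using finite_has_maximal[of R] by blast
  have "a x \<in> a ` T \<or> b x \<in> b ` T" if x: "x \<in> X" for x
  proof (rule ccontr)
    assume n: "\<not> ?thesis"
    have nx: "a x \<noteq> a y" "b x \<noteq> b y" if "y \<in> T" for y using n that by auto
    have ins: "insert x T \<in> R" using T(1) x nx nx[symmetric] unfolding R_def by simp
    have "x \<in> T" by (subst T(2)[OF ins]) auto
    then show False using n by blast
  qed
  then show ?thesis using T(1) unfolding R_def by (intro that[of T]) auto
qed

text \<open>Labels (i, i) correspond to u = 1 and all labels (i, j) to u = 2; the cliques then have order
  n powr (1 / s) with s = r + 1 - u.\<close>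

locale rook_family =
  fixes r u s :: nat and Ps :: "bool list set"
    and E :: "nat \<Rightarrow> nat set set" and a b :: "nat \<Rightarrow> nat set \<Rightarrow> nat"
  assumes r: "r \<ge> 1" and us: "u + s = r + 1" and s: "s \<ge> 1"
    and E: "\<And>k e. e \<in> E k \<Longrightarrow> redge r e \<and> e \<subseteq> {0..<r * r * k} \<and> a k e < k \<and> b k e < k"
    and cardE: "\<And>k. finite (E k)" "\<And>k. card (E k) = k ^ u"
    and rows: "\<And>k i. card {e \<in> E k. a k e = i} * k \<le> k ^ u"
    and cols: "\<And>k i. card {e \<in> E k. b k e = i} * k \<le> k ^ u"
    and compat: "\<And>k e f. e \<in> E k \<Longrightarrow> f \<in> E k \<Longrightarrow> a k e \<noteq> a k f \<Longrightarrow> b k e \<noteq> b k f \<Longrightarrow>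
      e \<inter> f = {} \<and> (\<exists>X\<in>Ps. forms e f X)"
begin

text \<open>The expected scale of the cliques. Division by \<open>r\<close> ensures (r * side)^s
  \<le> n, hence r * side \<le> n, so that boxes are nonempty once \<open>side\<close> is
  positive.\<close>

definition side :: "nat \<Rightarrow> nat" where
  "side n = nat \<lfloor>real n powr (1 / real s) / real r\<rfloor>"

text \<open>The labelled edges live on r * r * \<open>side\<close> points, so intervals of this
  length fit into [rn].\<close>

definition len :: "nat \<Rightarrow> nat" where
  "len n = n div (r * side n)"

definition boxed :: "nat \<Rightarrow> nat set set" where
  "boxed n = (\<Union>e\<in>E (side n). blowup (len n) e)"

definition down :: "nat \<Rightarrow> nat set \<Rightarrow> nat set" where
  "down n f = (\<lambda>v. v div len n) ` f"

lemma down: "f \<in> blowup (len n) e \<Longrightarrow> down n f = e"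
  unfolding down_def by (rule blowup_div)

lemma boxed_down: "f \<in> boxed n \<Longrightarrow> down n f \<in> E (side n) \<and> f \<in> blowup (len n) (down n f)"
proof -
  assume "f \<in> boxed n"
  then obtain e where "e \<in> E (side n)" "f \<in> blowup (len n) e" unfolding boxed_def by blast
  then show ?thesis using down[of f n e] by simp
qed

lemma card_boxes:
  assumes "A \<subseteq> E (side n)"
  shows "card (\<Union>e\<in>A. blowup (len n) e) = card A * len n ^ r" "finite (\<Union>e\<in>A. blowup (len n) e)"
proof -
  have A: "finite A" using assms cardE(1) finite_subset by blast
  have re: "finite e" "card e = r" if "e \<in> A" for e
    using E[of e "side n"] subsetD[OF assms that] by (simp_all add: redge_def)
  have "card (\<Union>e\<in>A. blowup (len n) e) = (\<Sum>e\<in>A. card (blowup (len n) e))"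
  proof (rule card_UN_disjoint[OF A])
    show "\<forall>e\<in>A. finite (blowup (len n) e)" using card_blowup(2)[OF re(1)] by simp
    show "\<forall>e\<in>A. \<forall>f\<in>A. e \<noteq> f \<longrightarrow> blowup (len n) e \<inter> blowup (len n) f = {}"
    proof (intro ballI impI, rule ccontr)
      fix e f assume "e \<noteq> f" "blowup (len n) e \<inter> blowup (len n) f \<noteq> {}"
      then obtain x where "x \<in> blowup (len n) e" "x \<in> blowup (len n) f" by blast
      then have "e = f" using down[of x n e] down[of x n f] by simp
      then show False using \<open>e \<noteq> f\<close> by simp
    qed
  qed
  also have "\<dots> = (\<Sum>e\<in>A. len n ^ r)" by (rule sum.cong) (simp_all add: card_blowup(1)[OF re(1)] re(2))
  finally show "card (\<Union>e\<in>A. blowup (len n) e) = card A * len n ^ r" by simp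
  show "finite (\<Union>e\<in>A. blowup (len n) e)" using A card_blowup(2)[OF re(1)] by simp
qed

lemma boxed_props:
  "finite (boxed n)" "card (boxed n) = side n ^ u * len n ^ r"
  "f \<in> boxed n \<Longrightarrow> card f = r \<and> f \<subseteq> {0..<r * n}"
proof -
  show "finite (boxed n)" "card (boxed n) = side n ^ u * len n ^ r"
    using card_boxes[of "E (side n)" n] cardE(2) by (simp_all add: boxed_def)
  assume f: "f \<in> boxed n"
  then have Ed: "down n f \<in> E (side n)" and bl: "f \<in> blowup (len n) (down n f)"
    using boxed_down by blast+
  have e: "redge r (down n f)" "down n f \<subseteq> {0..<r * r * side n}" using E[OF Ed] by simp_all
  have "r * side n * len n \<le> n" by (simp add: len_def)
  then have "r * (r * side n * len n) \<le> r * n" by (rule mult_left_mono) simp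
  then have "{0..<r * r * side n * len n} \<subseteq> {0..<r * n}" by (simp only: mult.assoc ivl_subset) simp
  then have "f \<subseteq> {0..<r * n}" using blowup_subset[OF bl e(2)] by (rule subset_trans[rotated])
  moreover have "card f = r" using blowup_vx(1)[OF e(1) bl] by (simp add: redge_def)
  ultimately show "card f = r \<and> f \<subseteq> {0..<r * n}" by simp
qed

text \<open>Rounding down costs at most a factor 2 in \<open>side\<close> and in \<open>len\<close>,
  both being at least 1.\<close>

lemma side_bounds:
  assumes n: "n \<ge> 1" and k: "side n \<ge> 1"
  shows "real n \<le> (2 * real r * real (side n)) ^ s" "(real r * real (side n)) ^ s \<le> real n"
    "real n powr (1 / real s) \<le> 2 * real r * real (side n)"
    "real n / (2 * real r * real (side n)) \<le> real (len n)" "real (len n) \<le> real n / (real r * real (side n))"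
proof -
  let ?x = "real n powr (1 / real s)"
  have x0: "?x > 0" using n by simp
  have xs: "?x ^ s = real n" using n s by (simp add: powr_realpow[symmetric] powr_powr)
  have le: "real (side n) \<le> ?x / real r" unfolding side_def using x0 by simp
  have gt: "?x / real r < real (side n) + 1" unfolding side_def by linarith
  have rk: "real r * real (side n) \<le> ?x" using le r by (simp add: field_simps)
  show x2: "?x \<le> 2 * real r * real (side n)"
  proof -
    have "?x < (real (side n) + 1) * real r" using gt r by (simp add: divide_less_eq)
    also have "\<dots> \<le> (2 * real (side n)) * real r" using k by (intro mult_right_mono) auto
    finally show ?thesis by (simp add: mult_ac)
  qed
  show "real n \<le> (2 * real r * real (side n)) ^ s" "(real r * real (side n)) ^ s \<le> real n"
    using power_mono[OF x2, of s] power_mono[OF rk, of s] xs x0 by auto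
  have "real r * real (side n) \<le> real n"
  proof -
    have "?x \<le> ?x ^ s"
      using s n by (intro self_le_power) (auto simp: ge_one_powr_ge_zero)
    then show ?thesis using rk xs by linarith
  qed
  then have "real (r * side n) \<le> real n" by simp
  then have "r * side n \<le> n" by (simp only: of_nat_le_iff)
  moreover have pos: "r * side n > 0" using r k by simp
  ultimately have L1: "len n \<ge> 1" unfolding len_def by (simp add: div_greater_zero_iff Suc_le_eq)
  have "n < (len n + 1) * (r * side n)"
    using dividend_less_div_times[OF pos, of n] by (simp add: len_def algebra_simps)
  also have "\<dots> \<le> (2 * len n) * (r * side n)" using L1 by (intro mult_right_mono) auto
  finally have "real n \<le> real ((2 * len n) * (r * side n))" by (simp only: of_nat_le_iff)
  then show "real n / (2 * real r * real (side n)) \<le> real (len n)"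
    using r k by (simp add: divide_le_eq mult_ac)
  have "len n * (r * side n) \<le> n" by (simp add: len_def)
  then have "real (len n * (r * side n)) \<le> real n" by (simp only: of_nat_le_iff)
  then show "real (len n) \<le> real n / (real r * real (side n))"
    using r k by (simp add: le_divide_eq)
qed

lemma side_at_top: "filterlim side at_top sequentially"
  unfolding side_def using r s by real_asymp

text \<open>(2r)^r comes from the lower bound on \<open>len\<close>, and r^(r-1) from that on the
  edge probability.\<close>

definition mean_const :: real where "mean_const = 1 / ((2 * real r) ^ r * real r ^ (r - 1))"

lemma mean_const_pos: "mean_const > 0" using r by (simp add: mean_const_def)

text \<open>With k = \<open>side n\<close> the mean is at least of order k^u (n/k)^r n^(1-r) = k^u n
  / k^r. Since n \<ge> k^s and u + s = r + 1, this is at least of order k.\<close>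

lemma boxed_mean:
  assumes n: "n \<ge> 1" and k: "side n \<ge> 1"
  shows "mean_const * real (side n) \<le> real (card (boxed n)) * edge_prob r n 1"
proof -
  let ?k = "real (side n)" and ?n = "real n"
  note B = side_bounds[OF n k]
  have kp: "?k > 0" and np: "?n > 0" and rp: "real r > 0" using k n r by auto
  have "?k ^ u * (?n / (2 * real r * ?k)) ^ r * (1 / real (r * n) ^ (r - 1))
     \<le> ?k ^ u * real (len n) ^ r * edge_prob r n 1"
    by (intro mult_mono power_mono B(4) edge_prob_1_ge r n) (auto simp: edge_prob_def)
  also have "\<dots> = real (card (boxed n)) * edge_prob r n 1" by (simp add: boxed_props(2))
  finally have 1: "?k ^ u * (?n / (2 * real r * ?k)) ^ r * (1 / real (r * n) ^ (r - 1)) \<le> real (card (boxed n)) * edge_prob r n 1" .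
  have nr: "?n ^ r = ?n * ?n ^ (r - 1)" using r by (cases r) auto
  have 2: "?k ^ u * (?n / (2 * real r * ?k)) ^ r * (1 / real (r * n) ^ (r - 1)) = mean_const * (?k ^ u * ?n / ?k ^ r)"
    using np by (simp add: mean_const_def power_divide power_mult_distrib nr)
  have "?k ^ s \<le> ?n"
  proof -
    have "?k \<le> real r * ?k" using r kp by simp
    then have "?k ^ s \<le> (real r * ?k) ^ s" by (intro power_mono) auto
    then show ?thesis using B(2) by linarith
  qed
  then have "?k ^ u * ?k ^ s \<le> ?k ^ u * ?n" by (intro mult_left_mono) auto
  then have "?k * ?k ^ r \<le> ?k ^ u * ?n" by (simp add: power_add[symmetric] us)
  then have "?k \<le> ?k ^ u * ?n / ?k ^ r" using kp by (simp add: le_divide_eq)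
  then have "mean_const * ?k \<le> mean_const * (?k ^ u * ?n / ?k ^ r)"
    by (rule mult_left_mono) (use mean_const_pos in simp)
  then show ?thesis using 1 2 by linarith
qed

lemma side_ev: "eventually (\<lambda>n. n \<ge> 1 \<and> side n \<ge> 1) sequentially"
  using eventually_conj[OF eventually_ge_at_top[of 1] filterlim_at_top[THEN iffD1, OF side_at_top, rule_format, of 1]]
  by simp

lemma many_boxed: "aas (\<lambda>n M. mean_const * real (side n) / 2 < real (card (M \<inter> boxed n))) r"
proof -
  have lim: "filterlim (\<lambda>n. real (card (boxed n)) * edge_prob r n 1) at_top sequentially"
  proof (rule filterlim_at_top_mono)
    show "filterlim (\<lambda>n. mean_const * real (side n)) at_top sequentially"
      by (rule filterlim_tendsto_pos_mult_at_top[OF tendsto_const mean_const_pos])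
        (rule filterlim_compose[OF filterlim_real_sequentially side_at_top])
    show "eventually (\<lambda>n. mean_const * real (side n) \<le> real (card (boxed n)) * edge_prob r n 1) sequentially"
      using side_ev by eventually_elim (use boxed_mean in auto)
  qed
  have "aas (\<lambda>n M. real (card (boxed n)) * edge_prob r n 1 / 2 < real (card (M \<inter> boxed n))) r"
    by (rule many_edges[OF r boxed_props(1) boxed_props(3) lim])
  then show ?thesis
  proof (rule aas_mono[OF r])
    show "eventually (\<lambda>n. \<forall>M\<in>matchings r n. real (card (boxed n)) * edge_prob r n 1 / 2 < real (card (M \<inter> boxed n)) \<longrightarrow>
      mean_const * real (side n) / 2 < real (card (M \<inter> boxed n))) sequentially"
      using side_ev
    proof eventually_elim
      case (elim n)
      then have "mean_const * real (side n) \<le> real (card (boxed n)) * edge_prob r n 1" using boxed_mean by blast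
      then show ?case by auto
    qed
  qed
qed

section \<open>Boxed edges do not concentrate in few rows and columns\<close>

definition crossing :: "nat \<Rightarrow> nat set \<Rightarrow> nat set \<Rightarrow> nat set set" where
  "crossing n A B = (\<Union>e\<in>{e \<in> E (side n). a (side n) e \<in> A \<or> b (side n) e \<in> B}. blowup (len n) e)"

text \<open>A row or column carries at most a proportion 1/k of the labels, so at most d * k rows
  and as many columns take up at most a proportion 2 d of the boxed edges.\<close>

lemma card_crossing:
  assumes "side n \<ge> 1" "finite A" "finite B" "real (card A) \<le> d * real (side n)" "real (card B) \<le> d * real (side n)"
  shows "finite (crossing n A B)"
    "real (card (crossing n A B)) \<le> 2 * d * real (side n) ^ u * real (len n) ^ r"
proof -
  let ?k = "side n"
  let ?S = "{e \<in> E ?k. a ?k e \<in> A \<or> b ?k e \<in> B}"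
  have one: "real (card (\<Union>i\<in>A. {e \<in> E ?k. g e = i})) \<le> d * real ?k ^ u"
    if A: "finite A" "real (card A) \<le> d * real ?k" and g: "\<And>i. card {e \<in> E ?k. g e = i} * ?k \<le> ?k ^ u" for A and g :: "nat set \<Rightarrow> nat"
  proof -
    have each: "real (card {e \<in> E ?k. g e = i}) \<le> real ?k ^ u / real ?k" for i
    proof -
      have "real (card {e \<in> E ?k. g e = i} * ?k) \<le> real (?k ^ u)" using g by (simp only: of_nat_le_iff)
      then show ?thesis using assms(1) by (simp add: le_divide_eq)
    qed
    have "real (card (\<Union>i\<in>A. {e \<in> E ?k. g e = i})) \<le> (\<Sum>i\<in>A. real (card {e \<in> E ?k. g e = i}))"
      using card_UN_le[OF A(1), of "\<lambda>i. {e \<in> E ?k. g e = i}"] by (simp flip: of_nat_sum)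
    also have "\<dots> \<le> (\<Sum>i\<in>A. real ?k ^ u / real ?k)" by (intro sum_mono each)
    also have "\<dots> = real (card A) * (real ?k ^ u / real ?k)" by simp
    also have "\<dots> \<le> (d * real ?k) * (real ?k ^ u / real ?k)" by (intro mult_right_mono A(2)) simp
    also have "\<dots> = d * real ?k ^ u" using assms(1) by simp
    finally show ?thesis .
  qed
  have sub: "?S \<subseteq> (\<Union>i\<in>A. {e \<in> E ?k. a ?k e = i}) \<union> (\<Union>i\<in>B. {e \<in> E ?k. b ?k e = i})" by blast
  have fin: "finite ((\<Union>i\<in>A. {e \<in> E ?k. a ?k e = i}) \<union> (\<Union>i\<in>B. {e \<in> E ?k. b ?k e = i}))"
    by (rule finite_subset[OF _ cardE(1)[of ?k]]) blast
  have "card ?S \<le> card (\<Union>i\<in>A. {e \<in> E ?k. a ?k e = i}) + card (\<Union>i\<in>B. {e \<in> E ?k. b ?k e = i})"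
    using card_mono[OF fin sub] card_Un_le order_trans by blast
  then have "real (card ?S) \<le> real (card (\<Union>i\<in>A. {e \<in> E ?k. a ?k e = i})) + real (card (\<Union>i\<in>B. {e \<in> E ?k. b ?k e = i}))"
    by linarith
  also have "\<dots> \<le> d * real ?k ^ u + d * real ?k ^ u"
    by (intro add_mono one assms rows cols)
  finally have S: "real (card ?S) \<le> 2 * d * real ?k ^ u" by simp
  have c: "card (crossing n A B) = card ?S * len n ^ r" "finite (crossing n A B)"
    unfolding crossing_def by (rule card_boxes, blast)+
  then show "finite (crossing n A B)" by simp
  show "real (card (crossing n A B)) \<le> 2 * d * real ?k ^ u * real (len n) ^ r"
    unfolding c of_nat_mult of_nat_power by (intro mult_right_mono S) simp
qed

lemma boxed_crossing:
  assumes "f \<in> boxed n" "a (side n) (down n f) \<in> A \<or> b (side n) (down n f) \<in> B"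
  shows "f \<in> crossing n A B"
  using boxed_down[OF assms(1)] assms(2) unfolding crossing_def by blast

text \<open>Chosen so that \<open>rho\<close> to the power mean_const * k / 2 equals 8^(-k), which
  beats the 4^k pairs of row and column sets by a factor 2^k.\<close>

definition rho :: real where "rho = (1 / 8) powr (2 / mean_const)"
text \<open>The solution of 4 * dens * e^r * (2r)^s / mean_const = rho, the last equation in
  \<open>base_le_rho\<close>.\<close>

definition dens :: real where "dens = rho * mean_const / (4 * exp 1 ^ r * (2 * real r) ^ s)"
definition quota :: "nat \<Rightarrow> nat" where "quota n = nat \<lceil>mean_const * real (side n) / 2\<rceil>"
definition small_sets :: "nat \<Rightarrow> nat set set" where
  "small_sets n = {A. A \<subseteq> {..<side n} \<and> real (card A) \<le> dens * real (side n)}"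
definition concentrated :: "nat \<Rightarrow> nat set set set" where
  "concentrated n = (\<Union>(A, B)\<in>small_sets n \<times> small_sets n. {S. S \<subseteq> crossing n A B \<and> card S = quota n})"

lemma rho: "0 < rho" "rho < 1"
proof -
  show "0 < rho" by (simp add: rho_def)
  have "(1 / 8) powr (2 / mean_const) < (1 / 8 :: real) powr 0"
    by (rule powr_less_mono') (use mean_const_pos in auto)
  then show "rho < 1" by (simp add: rho_def)
qed

lemma dens_pos: "dens > 0" using rho mean_const_pos r by (simp add: dens_def)

lemma quota_bounds:
  assumes "side n \<ge> 1"
  shows "mean_const * real (side n) / 2 \<le> real (quota n)" "quota n \<ge> 1"
proof -
  have "mean_const * real (side n) / 2 > 0" using mean_const_pos assms by simp
  then show "mean_const * real (side n) / 2 \<le> real (quota n)" "quota n \<ge> 1"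
    unfolding quota_def by linarith+
qed

text \<open>There are at most 2^k choices for each of the two sets, and a crossing family of size at
  most g has at most (e g / m)^m subsets of size m.\<close>

lemma card_concentrated:
  assumes "side n \<ge> 1"
  shows "finite (concentrated n)"
    "real (card (concentrated n)) \<le> 4 ^ side n * ((2 * dens * real (side n) ^ u * real (len n) ^ r) * exp 1 / real (quota n)) ^ quota n"
proof -
  let ?g = "2 * dens * real (side n) ^ u * real (len n) ^ r" and ?m = "quota n"
  have sm: "small_sets n \<subseteq> Pow {..<side n}" by (auto simp: small_sets_def)
  have fin_sm: "finite (small_sets n)" by (rule finite_subset[OF sm]) simp
  have "card (small_sets n) \<le> card (Pow {..<side n})" by (rule card_mono[OF _ sm]) simp
  then have c_sm: "card (small_sets n) \<le> 2 ^ side n" by (simp add: card_Pow)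
  have cr: "finite (crossing n A B)" "real (card (crossing n A B)) \<le> ?g"
    if "A \<in> small_sets n" "B \<in> small_sets n" for A B
    using card_crossing[of n A B dens] assms that finite_subset[of _ "{..<side n}"] by (auto simp: small_sets_def)
  have g0: "?g \<ge> 0" using dens_pos by simp
  have each: "finite {S. S \<subseteq> crossing n A B \<and> card S = ?m}"
    "real (card {S. S \<subseteq> crossing n A B \<and> card S = ?m}) \<le> (?g * exp 1 / real ?m) ^ ?m"
    if "A \<in> small_sets n" "B \<in> small_sets n" for A B
  proof -
    note c = cr[OF that]
    show "finite {S. S \<subseteq> crossing n A B \<and> card S = ?m}" using c(1) by simp
    have "((card (crossing n A B)) choose ?m) * fact ?m \<le> card (crossing n A B) ^ ?m" by (rule binomial_fact_pow)
    then have "real (((card (crossing n A B)) choose ?m) * fact ?m) \<le> real (card (crossing n A B) ^ ?m)"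
      by (simp only: of_nat_le_iff)
    also have "\<dots> \<le> ?g ^ ?m" unfolding of_nat_power by (intro power_mono c(2)) simp
    finally have 1: "real ((card (crossing n A B)) choose ?m) * fact ?m \<le> ?g ^ ?m" by simp
    have "real ((card (crossing n A B)) choose ?m) * (real ?m / exp 1) ^ ?m \<le> real ((card (crossing n A B)) choose ?m) * fact ?m"
      by (intro mult_left_mono pow_div_exp_le_fact) simp
    then have "real ((card (crossing n A B)) choose ?m) * (real ?m / exp 1) ^ ?m \<le> ?g ^ ?m" using 1 by linarith
    moreover have "(real ?m / exp 1) ^ ?m > 0" using quota_bounds(2)[OF assms] by simp
    ultimately have "real ((card (crossing n A B)) choose ?m) \<le> ?g ^ ?m / (real ?m / exp 1) ^ ?m"
      by (simp only: le_divide_eq if_True)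
    also have "\<dots> = (?g * exp 1 / real ?m) ^ ?m" by (simp only: power_divide[symmetric] divide_divide_eq_right)
    finally show "real (card {S. S \<subseteq> crossing n A B \<and> card S = ?m}) \<le> (?g * exp 1 / real ?m) ^ ?m"
      using n_subsets[OF c(1), of ?m] by simp
  qed
  show "finite (concentrated n)" unfolding concentrated_def using fin_sm each(1) by auto
  let ?I = "small_sets n \<times> small_sets n"
  let ?f = "\<lambda>p. {S. S \<subseteq> crossing n (fst p) (snd p) \<and> card S = ?m}"
  have "concentrated n = (\<Union>p\<in>?I. ?f p)" unfolding concentrated_def by (simp add: case_prod_beta)
  then have "card (concentrated n) \<le> (\<Sum>p\<in>?I. card (?f p))"
    using card_UN_le[of ?I ?f] fin_sm by simp
  then have "real (card (concentrated n)) \<le> (\<Sum>p\<in>?I. real (card (?f p)))"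
    unfolding of_nat_sum[symmetric] by (simp only: of_nat_le_iff)
  also have "\<dots> \<le> (\<Sum>p\<in>?I. (?g * exp 1 / real ?m) ^ ?m)"
    by (intro sum_mono each(2)) auto
  also have "\<dots> = real (card (small_sets n) * card (small_sets n)) * (?g * exp 1 / real ?m) ^ ?m"
    by (simp add: card_cartesian_product)
  also have "\<dots> \<le> real (2 ^ side n * 2 ^ side n) * (?g * exp 1 / real ?m) ^ ?m"
    using g0 by (intro mult_right_mono of_nat_mono mult_le_mono c_sm zero_le_power) simp
  also have "real (2 ^ side n * 2 ^ side n) = 4 ^ side n" by (simp flip: power_mult_distrib)
  finally show "real (card (concentrated n)) \<le> 4 ^ side n * (?g * exp 1 / real ?m) ^ ?m" .
qed

text \<open>The left side is the m-th root, m = \<open>quota n\<close>, of the first-moment bound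
  for one pair of row and column sets. Up to constants the powers of n and k reduce to n / k^s,
  which is at most (2r)^s.\<close>

lemma base_le_rho:
  assumes n: "n \<ge> 1" and k: "side n \<ge> 1"
  shows "(2 * dens * real (side n) ^ u * real (len n) ^ r) * exp 1 / real (quota n) * (exp 1 / real n) ^ (r - 1) \<le> rho"
proof -
  let ?k = "real (side n)" and ?n = "real n"
  note B = side_bounds[OF n k]
  have pos: "?k > 0" "?n > 0" "real r \<ge> 1" using n k r by auto
  have "real (len n) \<le> ?n / ?k"
  proof -
    have "?n / (real r * ?k) \<le> ?n / ?k" using pos by (intro frac_le) auto
    then show ?thesis using B(5) by linarith
  qed
  then have "2 * dens * ?k ^ u * real (len n) ^ r \<le> 2 * dens * ?k ^ u * (?n / ?k) ^ r"
    using dens_pos by (intro mult_left_mono power_mono) auto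
  then have "(2 * dens * ?k ^ u * real (len n) ^ r) * exp 1 / real (quota n) \<le> (2 * dens * ?k ^ u * (?n / ?k) ^ r) * exp 1 / (mean_const * ?k / 2)"
    using quota_bounds(1)[OF k] mean_const_pos dens_pos pos by (intro frac_le mult_right_mono) auto
  then have "(2 * dens * ?k ^ u * real (len n) ^ r) * exp 1 / real (quota n) * (exp 1 / ?n) ^ (r - 1)
    \<le> (2 * dens * ?k ^ u * (?n / ?k) ^ r) * exp 1 / (mean_const * ?k / 2) * (exp 1 / ?n) ^ (r - 1)"
    by (rule mult_right_mono) simp
  also have "\<dots> = (4 * dens * exp 1 ^ r / mean_const) * (?n / ?k ^ s)"
  proof -
    have 1: "?n ^ r = ?n * ?n ^ (r - 1)" "exp (1::real) ^ r = exp 1 * exp 1 ^ (r - 1)" using r by (cases r; simp)+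
    have 2: "?k ^ r * ?k = ?k ^ u * ?k ^ s" using us by (simp flip: power_add power_Suc2)
    have "(2 * dens * ?k ^ u * (?n / ?k) ^ r) * exp 1 / (mean_const * ?k / 2) * (exp 1 / ?n) ^ (r - 1)
      = (4 * dens * exp 1 ^ r / mean_const) * ((?k ^ u * ?n) / (?k ^ r * ?k))"
      using pos mean_const_pos by (simp add: power_divide 1) (simp add: mult_ac)
    also have "(?k ^ u * ?n) / (?k ^ r * ?k) = ?n / ?k ^ s" unfolding 2 using pos by simp
    finally show ?thesis .
  qed
  also have "\<dots> \<le> (4 * dens * exp 1 ^ r / mean_const) * (2 * real r) ^ s"
  proof (rule mult_left_mono)
    have "?n \<le> (2 * real r) ^ s * ?k ^ s" using B(1) by (simp add: power_mult_distrib)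
    then show "?n / ?k ^ s \<le> (2 * real r) ^ s" using pos by (simp add: divide_le_eq)
    show "0 \<le> 4 * dens * exp 1 ^ r / mean_const" using dens_pos mean_const_pos by simp
  qed
  also have "\<dots> = rho" using mean_const_pos r by (simp add: dens_def)
  finally show ?thesis .
qed

lemma not_concentrated: "aas (\<lambda>n M. \<not> (\<exists>S\<in>concentrated n. S \<subseteq> M)) r"
proof (rule aasI)
  show "(\<lambda>n. (1 / 2) ^ side n) \<longlonglongrightarrow> (0::real)"
    by (rule filterlim_compose[OF LIMSEQ_power_zero side_at_top]) simp
  show "eventually (\<lambda>n. measure_pmf.prob (RM r n) {M. \<not> \<not> (\<exists>S\<in>concentrated n. S \<subseteq> M)} \<le> (1 / 2) ^ side n) sequentially"
    using side_ev
  proof eventually_elim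
    case (elim n)
    then have n: "n \<ge> 1" and k: "side n \<ge> 1" by auto
    let ?g = "(2 * dens * real (side n) ^ u * real (len n) ^ r) * exp 1 / real (quota n)"
    have "measure_pmf.prob (RM r n) {M. \<exists>S\<in>concentrated n. S \<subseteq> M} \<le> real (card (concentrated n)) * (exp 1 / real n) ^ ((r - 1) * quota n)"
      by (rule first_moment[OF r n card_concentrated(1)[OF k]]) (auto simp: concentrated_def)
    also have "\<dots> \<le> (4 ^ side n * ?g ^ quota n) * (exp 1 / real n) ^ ((r - 1) * quota n)"
      by (intro mult_right_mono card_concentrated(2)[OF k]) simp
    also have "\<dots> = 4 ^ side n * (?g * (exp 1 / real n) ^ (r - 1)) ^ quota n"
      by (simp only: power_mult power_mult_distrib mult.assoc)
    also have "\<dots> \<le> 4 ^ side n * rho ^ quota n"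
      using dens_pos by (intro mult_left_mono power_mono base_le_rho n k) simp_all
    also have "rho ^ quota n \<le> (1 / 8) ^ side n"
    proof -
      have "rho ^ quota n = rho powr real (quota n)" using rho by (simp add: powr_realpow)
      also have "\<dots> \<le> rho powr (mean_const * real (side n) / 2)"
        by (rule powr_mono') (use quota_bounds(1)[OF k] rho in auto)
      also have "\<dots> = (1 / 8) powr (2 / mean_const * (mean_const * real (side n) / 2))" by (simp only: rho_def powr_powr)
      also have "2 / mean_const * (mean_const * real (side n) / 2) = real (side n)" using mean_const_pos by simp
      also have "(1 / 8 :: real) powr real (side n) = (1 / 8) ^ side n" by (rule powr_realpow) simp
      finally show ?thesis .
    qed
    then have "4 ^ side n * rho ^ quota n \<le> 4 ^ side n * (1 / 8) ^ side n" by (rule mult_left_mono) simp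
    also have "(4 :: real) ^ side n * (1 / 8) ^ side n = (1 / 2) ^ side n" by (simp flip: power_mult_distrib)
    finally show ?case by simp
  qed
qed

text \<open>If a maximal rook placement had fewer than dens * k edges, its rows and columns would be
  small sets covering all boxed edges of the matching, and \<open>quota n\<close> of these edges
  would form a concentrated set.\<close>

lemma lower_bound: "\<exists>c>0. aas (\<lambda>n M. c * real n powr (1 / real s) \<le> real (z_of r Ps M)) r"
proof (intro exI conjI)
  show "dens / (2 * real r) > 0" using dens_pos r by simp
  have "aas (\<lambda>n M. mean_const * real (side n) / 2 < real (card (M \<inter> boxed n)) \<and> \<not> (\<exists>S\<in>concentrated n. S \<subseteq> M)) r"
    by (rule aas_conj[OF many_boxed not_concentrated])
  then show "aas (\<lambda>n M. dens / (2 * real r) * real n powr (1 / real s) \<le> real (z_of r Ps M)) r"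
  proof (rule aas_mono[OF r])
    show "eventually (\<lambda>n. \<forall>M\<in>matchings r n. mean_const * real (side n) / 2 < real (card (M \<inter> boxed n)) \<and> \<not> (\<exists>S\<in>concentrated n. S \<subseteq> M) \<longrightarrow>
       dens / (2 * real r) * real n powr (1 / real s) \<le> real (z_of r Ps M)) sequentially"
      using side_ev
    proof (eventually_elim, intro ballI impI)
      fix n M assume nk: "1 \<le> n \<and> 1 \<le> side n" and M: "M \<in> matchings r n"
        and big: "mean_const * real (side n) / 2 < real (card (M \<inter> boxed n)) \<and> \<not> (\<exists>S\<in>concentrated n. S \<subseteq> M)"
      let ?k = "side n"
      have fin: "finite (M \<inter> boxed n)" using boxed_props(1) by simp
      obtain T where T: "T \<subseteq> M \<inter> boxed n"
        "\<forall>x\<in>T. \<forall>y\<in>T. x \<noteq> y \<longrightarrow> a ?k (down n x) \<noteq> a ?k (down n y) \<and> b ?k (down n x) \<noteq> b ?k (down n y)"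
        "\<forall>x\<in>M \<inter> boxed n. a ?k (down n x) \<in> (\<lambda>x. a ?k (down n x)) ` T \<or> b ?k (down n x) \<in> (\<lambda>x. b ?k (down n x)) ` T"
        by (rule covering_rook[OF fin, of "\<lambda>x. a ?k (down n x)" "\<lambda>x. b ?k (down n x)"])
      have finT: "finite T" using T(1) fin finite_subset by blast
      have Tb: "down n x \<in> E ?k \<and> x \<in> blowup (len n) (down n x)" if "x \<in> T" for x
        by (rule boxed_down) (use T(1) that in blast)
      have "is_clique r Ps T"
      proof (rule cliqueI_blowup[OF r finT, where d = "down n" and L = "len n"])
        show "redge r (down n f) \<and> f \<in> blowup (len n) (down n f)" if "f \<in> T" for f
          using Tb[OF that] E[of "down n f" ?k] by simp
        show "down n f \<inter> down n g = {} \<and> (\<exists>X\<in>Ps. forms (down n f) (down n g) X)"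
          if "f \<in> T" "g \<in> T" "f \<noteq> g" for f g
        proof -
          have "a ?k (down n f) \<noteq> a ?k (down n g) \<and> b ?k (down n f) \<noteq> b ?k (down n g)" using T(2) that by blast
          then show ?thesis using compat[of "down n f" ?k "down n g"] Tb[OF that(1)] Tb[OF that(2)] by simp
        qed
      qed
      then have z: "card T \<le> z_of r Ps M" using z_of_ge[OF finite_matching[OF M]] T(1) by simp
      have "dens * real ?k \<le> real (card T)"
      proof (rule ccontr)
        assume n: "\<not> ?thesis"
        let ?A = "(\<lambda>x. a ?k (down n x)) ` T" and ?B = "(\<lambda>x. b ?k (down n x)) ` T"
        have "card ?A \<le> card T" "card ?B \<le> card T" using card_image_le[OF finT] by auto
        then have "real (card ?A) \<le> dens * real ?k" "real (card ?B) \<le> dens * real ?k" using n by linarith+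
        moreover have "?A \<subseteq> {..<?k}" "?B \<subseteq> {..<?k}" using Tb E by blast+
        ultimately have AB: "?A \<in> small_sets n" "?B \<in> small_sets n" by (simp_all add: small_sets_def)
        have sub: "M \<inter> boxed n \<subseteq> crossing n ?A ?B" using boxed_crossing T(3) by blast
        have "quota n \<le> card (M \<inter> boxed n)" using big unfolding quota_def by linarith
        then obtain S where S: "S \<subseteq> M \<inter> boxed n" "card S = quota n" by (rule obtain_subset_with_card_n)
        have "S \<in> concentrated n" unfolding concentrated_def using AB sub S by blast
        then show False using big S(1) by blast
      qed
      moreover have "real n powr (1 / real s) \<le> 2 * real r * real ?k" using side_bounds(3) nk by blast
      then have "dens / (2 * real r) * real n powr (1 / real s) \<le> dens / (2 * real r) * (2 * real r * real ?k)"
        by (rule mult_left_mono) (use dens_pos in simp)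
      moreover have "dens / (2 * real r) * (2 * real r * real ?k) = dens * real ?k" using r by simp
      ultimately show "dens / (2 * real r) * real n powr (1 / real s) \<le> real (z_of r Ps M)" using z by linarith
    qed
  qed
qed

end

section \<open>Lower bounds and the theorem\<close>

locale block_patterns =
  fixes r :: nat and P Q :: "bool list" and ts :: "nat list"
  assumes P: "is_pattern r P" "has_composition P ts" and Q: "is_pattern r Q" "has_composition Q ts"
begin

text \<open>In the region of a block the edge labelled (i, j) is placed according to i where the signs
  of P and Q agree and according to j where they differ; a negative sign of P reverses the order.\<close>

definition slot :: "nat \<Rightarrow> nat \<Rightarrow> nat \<Rightarrow> nat \<Rightarrow> nat" where
  "slot k i j l = (let x = (if before P l l = before Q l l then i else j)
     in if before P l l then x else k - 1 - x)"

text \<open>Each block owns a region of \<open>k\<close> consecutive places.\<close>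

definition place :: "nat \<Rightarrow> nat \<Rightarrow> nat \<Rightarrow> nat \<Rightarrow> nat" where
  "place k i j l = blk ts l * k + slot k i j l"

text \<open>Vertices of one edge that belong to the same block share a place. Spreading places by
  the factor \<open>r\<close> and adding \<open>l\<close> keeps them distinct and in order.\<close>

definition cell :: "nat \<Rightarrow> nat \<Rightarrow> nat \<Rightarrow> nat set" where
  "cell k i j = (\<lambda>l. place k i j l * r + l) ` {..<r}"

lemma before_P: "i < r \<Longrightarrow> m < r \<Longrightarrow> before P i m \<longleftrightarrow> blk ts i < blk ts m \<or> blk ts i = blk ts m \<and> before P i i"
  and before_Q: "i < r \<Longrightarrow> m < r \<Longrightarrow> before Q i m \<longleftrightarrow> blk ts i < blk ts m \<or> blk ts i = blk ts m \<and> before Q i i"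
proof -
  obtain bs where bs: "\<And>i m. i < r \<Longrightarrow> m < r \<Longrightarrow> before P i m \<longleftrightarrow> blk ts i < blk ts m \<or> blk ts i = blk ts m \<and> bs ! blk ts i"
    using has_composition_before[OF P] by metis
  show "i < r \<Longrightarrow> m < r \<Longrightarrow> before P i m \<longleftrightarrow> blk ts i < blk ts m \<or> blk ts i = blk ts m \<and> before P i i"
    using bs[of i m] bs[of i i] by simp
  obtain cs where cs: "\<And>i m. i < r \<Longrightarrow> m < r \<Longrightarrow> before Q i m \<longleftrightarrow> blk ts i < blk ts m \<or> blk ts i = blk ts m \<and> cs ! blk ts i"
    using has_composition_before[OF Q] by metis
  show "i < r \<Longrightarrow> m < r \<Longrightarrow> before Q i m \<longleftrightarrow> blk ts i < blk ts m \<or> blk ts i = blk ts m \<and> before Q i i"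
    using cs[of i m] cs[of i i] by simp
qed

lemma sign_const:
  assumes "i < r" "m < r" "blk ts i = blk ts m"
  shows "before P i i = before P m m" "before Q i i = before Q m m"
proof -
  obtain bs where bs: "\<And>i m. i < r \<Longrightarrow> m < r \<Longrightarrow> before P i m \<longleftrightarrow> blk ts i < blk ts m \<or> blk ts i = blk ts m \<and> bs ! blk ts i"
    using has_composition_before[OF P] by metis
  show "before P i i = before P m m" using bs[of i i] bs[of m m] assms by simp
  obtain cs where cs: "\<And>i m. i < r \<Longrightarrow> m < r \<Longrightarrow> before Q i m \<longleftrightarrow> blk ts i < blk ts m \<or> blk ts i = blk ts m \<and> cs ! blk ts i"
    using has_composition_before[OF Q] by metis
  show "before Q i i = before Q m m" using cs[of i i] cs[of m m] assms by simp
qed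

lemma r_pos: "r \<ge> 1" using P(1) by (cases r) (auto simp: is_pattern_def)

lemma blk_less: "l < r \<Longrightarrow> blk ts l < r"
proof -
  assume l: "l < r"
  obtain bs where s: "sum_list ts = r" using has_composition_before[OF P] by metis
  have "\<forall>t\<in>set ts. t \<ge> 1" using P(2) by (auto simp: has_composition_def)
  then have "length ts \<le> sum_list ts" by (induction ts) auto
  then show ?thesis using blk_less_length[of l ts] l s by simp
qed

lemma slot_less: "i < k \<Longrightarrow> j < k \<Longrightarrow> slot k i j l < k"
  by (auto simp: slot_def Let_def)

lemma slot_cong: "l < r \<Longrightarrow> m < r \<Longrightarrow> blk ts l = blk ts m \<Longrightarrow> slot k i j l = slot k i j m"
  using sign_const[of l m] by (simp add: slot_def)

lemma place_less_iff:
  assumes k: "i < k" "j < k" "i' < k" "j' < k"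
  shows "place k i j l < place k i' j' m \<longleftrightarrow>
    blk ts l < blk ts m \<or> blk ts l = blk ts m \<and> slot k i j l < slot k i' j' m"
proof -
  have lt: "x * k + a < y * k + b" if "x < y" "a < k" for x y a b :: nat
  proof -
    have "x * k + a < (x + 1) * k" using that by simp
    also have "\<dots> \<le> y * k" using that by (intro mult_right_mono) auto
    finally show ?thesis by simp
  qed
  show ?thesis
    unfolding place_def
    using lt[of "blk ts l" "blk ts m" "slot k i j l" "slot k i' j' m"]
      lt[of "blk ts m" "blk ts l" "slot k i' j' m" "slot k i j l"] slot_less[OF k(1,2)] slot_less[OF k(3,4)]
    by (cases "blk ts l" "blk ts m" rule: linorder_cases) auto
qed

lemma mult_add_less_iff:
  fixes p q l m :: nat
  assumes "p \<noteq> q" "l < r" "m < r"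
  shows "p * r + l < q * r + m \<longleftrightarrow> p < q"
proof -
  have lt: "x * r + a < y * r + b" if "x < y" "a < r" for x y a b :: nat
  proof -
    have "x * r + a < (x + 1) * r" using that by simp
    also have "\<dots> \<le> y * r" using that by (intro mult_right_mono) auto
    finally show ?thesis by simp
  qed
  show ?thesis using lt[of p q l m] lt[of q p m l] assms by linarith
qed

lemma cell_mono:
  assumes "i < k" "j < k" shows "strict_mono_on {..<r} (\<lambda>l. place k i j l * r + l)"
proof (rule strict_mono_onI)
  fix l m assume lm: "l \<in> {..<r}" "m \<in> {..<r}" "l < m"
  have "blk ts l \<le> blk ts m" using blk_mono lm by simp
  then consider "blk ts l = blk ts m" | "blk ts l < blk ts m" by linarith
  then have "place k i j l \<le> place k i j m"
  proof cases
    case 1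
    then show ?thesis using slot_cong[of l m k i j] lm by (simp add: place_def)
  next
    case 2
    then show ?thesis using place_less_iff[OF assms assms, of l m] by simp
  qed
  then have "place k i j l * r \<le> place k i j m * r" by (rule mult_right_mono) simp
  then show "place k i j l * r + l < place k i j m * r + m" using lm(3) by linarith
qed

lemma vx_cell: "i < k \<Longrightarrow> j < k \<Longrightarrow> l < r \<Longrightarrow> vx (cell k i j) l = place k i j l * r + l"
  unfolding cell_def by (rule vx_unique[OF cell_mono])

lemma redge_cell: "i < k \<Longrightarrow> j < k \<Longrightarrow> redge r (cell k i j)"
  unfolding cell_def redge_def
  using card_image[OF strict_mono_on_imp_inj_on[OF cell_mono[of i k j]]] by simp

lemma cell_subset:
  assumes "i < k" "j < k" shows "cell k i j \<subseteq> {0..<r * r * k}"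
proof
  fix v assume "v \<in> cell k i j"
  then obtain l where l: "l < r" "v = place k i j l * r + l" by (auto simp: cell_def)
  have "blk ts l + 1 \<le> r" using blk_less[OF l(1)] by simp
  then have "(blk ts l + 1) * k \<le> r * k" by (rule mult_right_mono) simp
  then have "place k i j l + 1 \<le> r * k" using slot_less[OF assms, of l] by (simp add: place_def)
  then have "(place k i j l + 1) * r \<le> r * k * r" by (rule mult_right_mono) simp
  then show "v \<in> {0..<r * r * k}" using l by (simp add: mult_ac)
qed

text \<open>Both labels have to differ, because a slot shows only one of them, and which one depends
  on the position.\<close>

lemma slot_neq:
  assumes "i < k" "j < k" "i' < k" "j' < k" "i \<noteq> i'" "j \<noteq> j'"
  shows "slot k i j l \<noteq> slot k i' j' l"
  using assms by (auto simp: slot_def Let_def)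

lemma place_neq:
  assumes k: "i < k" "j < k" "i' < k" "j' < k" "i \<noteq> i'" "j \<noteq> j'" and l: "l < r" "m < r"
  shows "place k i j l \<noteq> place k i' j' m"
proof
  assume eq: "place k i j l = place k i' j' m"
  then have "\<not> place k i j l < place k i' j' m" "\<not> place k i' j' m < place k i j l" by simp_all
  then have n: "blk ts l = blk ts m" "slot k i j l = slot k i' j' m"
    unfolding place_less_iff[OF k(1-4)] place_less_iff[OF k(3,4,1,2)] by linarith+
  then show False using slot_neq[OF k, of l] slot_cong[OF l n(1), of k i' j'] by simp
qed

lemma cell_disjoint:
  assumes k: "i < k" "j < k" "i' < k" "j' < k" "i \<noteq> i'" "j \<noteq> j'"
  shows "cell k i j \<inter> cell k i' j' = {}"
proof -
  have "place k i j l * r + l \<noteq> place k i' j' m * r + m" if "l < r" "m < r" for l m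
    using mult_add_less_iff[OF place_neq[OF k that] that]
      mult_add_less_iff[OF place_neq[OF k that, symmetric] that(2,1)] place_neq[OF k that] by linarith
  then show ?thesis by (auto simp: cell_def)
qed

text \<open>Where the signs agree, i < i' produces the common order. Where they differ,
  \<open>j\<close> decides: j < j' produces the order of \<open>P\<close>, and j > j' the reverse,
  which is that of \<open>Q\<close>.\<close>

lemma cell_forms_ordered:
  assumes k: "i < k" "j < k" "i' < k" "j' < k" "j \<noteq> j'" and lt: "i < i'"
  shows "forms (cell k i j) (cell k i' j') (if j < j' then P else Q)"
proof (rule formsI[of r])
  have ne: "i \<noteq> i'" using lt by simp
  show "redge r (cell k i j)" "redge r (cell k i' j')" using redge_cell k by auto
  show "cell k i j \<inter> cell k i' j' = {}" using cell_disjoint[OF k(1-4) ne k(5)] .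
  show "is_pattern r (if j < j' then P else Q)" using P Q by simp
  fix l m assume lm: "l < r" "m < r"
  have "vx (cell k i j) l < vx (cell k i' j') m \<longleftrightarrow> place k i j l < place k i' j' m"
    unfolding vx_cell[OF k(1,2) lm(1)] vx_cell[OF k(3,4) lm(2)]
    by (rule mult_add_less_iff[OF place_neq[OF k(1-4) ne k(5) lm] lm])
  also have "\<dots> \<longleftrightarrow> blk ts l < blk ts m \<or> blk ts l = blk ts m \<and> slot k i j l < slot k i' j' m"
    by (rule place_less_iff[OF k(1-4)])
  also have "\<dots> \<longleftrightarrow> blk ts l < blk ts m \<or> blk ts l = blk ts m \<and> before (if j < j' then P else Q) l l"
  proof -
    have "slot k i j l < slot k i' j' m \<longleftrightarrow> before (if j < j' then P else Q) l l" if "blk ts l = blk ts m"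
      using slot_cong[OF lm that, of k i' j'] k lt by (auto simp: slot_def Let_def)
    then show ?thesis by blast
  qed
  also have "\<dots> \<longleftrightarrow> before (if j < j' then P else Q) l m" using before_P[OF lm] before_Q[OF lm] by simp
  finally show "vx (cell k i j) l < vx (cell k i' j') m \<longleftrightarrow> before (if j < j' then P else Q) l m" .
qed

lemma cell_forms:
  assumes k: "i < k" "j < k" "i' < k" "j' < k" "i \<noteq> i'" "j \<noteq> j'"
  shows "\<exists>X\<in>{P, Q}. forms (cell k i j) (cell k i' j') X"
proof (cases "i < i'")
  case True
  then show ?thesis using cell_forms_ordered[OF k(1-4,6) True] by (cases "j < j'") auto
next
  case False
  then have lt: "i' < i" using k(5) by simp
  have "forms (cell k i' j') (cell k i j) (if j' < j then P else Q)"
    by (rule cell_forms_ordered[OF k(3,4,1,2) k(6)[symmetric] lt])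
  then have "forms (cell k i j) (cell k i' j') (if j' < j then P else Q)"
    using pattern_of_sym[OF redge_cell[OF k(1,2)] redge_cell[OF k(3,4)] cell_disjoint[OF k] r_pos]
    by (simp add: forms_def)
  then show ?thesis by (cases "j' < j") auto
qed

text \<open>Recovers the label \<open>i\<close>: both patterns begin with A, so position 0 has
  positive signs and lies in block 0, and its place is \<open>i\<close> itself.\<close>

definition row :: "nat set \<Rightarrow> nat" where
  "row e = vx e 0 div r"

lemma row_cell: "i < k \<Longrightarrow> j < k \<Longrightarrow> row (cell k i j) = i"
proof -
  assume k: "i < k" "j < k"
  have r0: "0 < r" using r_pos by simp
  have "blk ts 0 = 0"
  proof (cases ts)
    case (Cons t us)
    then have "t \<ge> 1" using P(2) by (auto simp: has_composition_def)
    then show ?thesis using Cons by simp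
  qed simp
  then have "place k i j 0 = i"
    using is_pattern_before_0[OF P(1)] is_pattern_before_0[OF Q(1)] by (simp add: place_def slot_def)
  then show ?thesis using vx_cell[OF k r0] r0 by (simp add: row_def)
qed

end

text \<open>With both patterns equal to \<open>P\<close>, the k diagonal cells pairwise form
  \<open>P\<close>; rows and columns coincide.\<close>

lemma collectable_lower_bound:
  assumes P: "is_pattern r P" "has_composition P ts" and PQ: "P \<in> Ps"
  shows "\<exists>c>0. aas (\<lambda>n M. c * real n powr (1 / real r) \<le> real (z_of r Ps M)) r"
proof -
  interpret block_patterns r P P ts using P by unfold_locales
  define E where "E k = (\<lambda>i. cell k i i) ` {..<k}" for k
  have inj: "inj_on (\<lambda>i. cell k i i) {..<k}" for k
    by (rule inj_on_inverseI[of _ row]) (simp add: row_cell)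
  interpret rook_family r 1 r Ps E "\<lambda>_. row" "\<lambda>_. row"
  proof
    show "r \<ge> 1" by (rule r_pos)
    show "1 + r = r + 1" by simp
    show "redge r e \<and> e \<subseteq> {0..<r * r * k} \<and> row e < k \<and> row e < k" if "e \<in> E k" for e k
    proof -
      obtain i where i: "i < k" "e = cell k i i" using \<open>e \<in> E k\<close> by (auto simp: E_def)
      then show ?thesis using redge_cell[OF i(1,1)] cell_subset[OF i(1,1)] by (simp add: row_cell)
    qed
    show "finite (E k)" for k by (simp add: E_def)
    show "card (E k) = k ^ 1" for k unfolding E_def by (simp add: card_image[OF inj])
    show "card {e \<in> E k. row e = i} * k \<le> k ^ 1" for k i
    proof -
      have "{e \<in> E k. row e = i} \<subseteq> {cell k i i}" by (auto simp: E_def row_cell)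
      then have "card {e \<in> E k. row e = i} \<le> card {cell k i i}" by (rule card_mono[rotated]) simp
      then have "card {e \<in> E k. row e = i} * k \<le> 1 * k" by (intro mult_right_mono) auto
      then show ?thesis by simp
    qed
    show "e \<inter> f = {} \<and> (\<exists>X\<in>Ps. forms e f X)"
      if ef: "e \<in> E k" "f \<in> E k" "row e \<noteq> row f" "row e \<noteq> row f" for k e f
    proof -
      obtain i i' where i: "i < k" "i' < k" "e = cell k i i" "f = cell k i' i'" using ef by (auto simp: E_def)
      then have ne: "i \<noteq> i'" using ef(3) by auto
      show ?thesis using cell_disjoint[OF i(1,1,2,2) ne ne] cell_forms[OF i(1,1,2,2) ne ne] PQ i(3,4) by auto
    qed
  qed
  show ?thesis by (rule lower_bound)
qed

lemma harmonious_lower_bound: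
  assumes P: "is_pattern r P" "has_composition P ts" and Q: "is_pattern r Q" "has_composition Q ts"
    and ne: "P \<noteq> Q" and r2: "r \<ge> 2"
  shows "\<exists>c>0. aas (\<lambda>n M. c * real n powr (1 / real (r - 1)) \<le> real (z_of r {P, Q} M)) r"
proof -
  interpret block_patterns r P Q ts using P Q by unfold_locales
  \<comment> \<open>At a vertex where the signs differ the slot shows \<open>j\<close>, possibly
    reversed by a negative sign of \<open>P\<close>; \<open>flip\<close> undoes the reversal, so
    \<open>col\<close> recovers \<open>j\<close>.\<close>
  obtain l where l: "l < r" "before P l l \<noteq> before Q l l" using sign_differs[OF P Q ne] by blast
  define flip where "flip k x = (if before P l l then x else k - 1 - x)" for k x :: nat
  have flip: "flip k x < k" "flip k (flip k x) = x" if "x < k" for k x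
    using that by (auto simp: flip_def)
  define col where "col k e = flip k ((vx e l div r) mod k)" for k e
  have col: "col k (cell k i j) = j" if k: "i < k" "j < k" for k i j
  proof -
    have "vx (cell k i j) l div r = place k i j l" using vx_cell[OF k l(1)] l(1) by simp
    moreover have "slot k i j l = flip k j" using l(2) by (simp add: slot_def flip_def)
    ultimately have "(vx (cell k i j) l div r) mod k = flip k j" using flip(1)[OF k(2)] by (simp add: place_def)
    then show ?thesis using flip(2)[OF k(2)] by (simp add: col_def)
  qed
  define E where "E k = (\<lambda>(i, j). cell k i j) ` ({..<k} \<times> {..<k})" for k
  have inj: "inj_on (\<lambda>(i, j). cell k i j) ({..<k} \<times> {..<k})" for k
    by (rule inj_on_inverseI[of _ "\<lambda>e. (row e, col k e)"]) (auto simp: row_cell col)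
  interpret rook_family r 2 "r - 1" "{P, Q}" E "\<lambda>_. row" col
  proof
    show "r \<ge> 1" by (rule r_pos)
    show "2 + (r - 1) = r + 1" "r - 1 \<ge> 1" using r2 by simp_all
    show "redge r e \<and> e \<subseteq> {0..<r * r * k} \<and> row e < k \<and> col k e < k" if "e \<in> E k" for e k
    proof -
      obtain i j where ij: "i < k" "j < k" "e = cell k i j" using \<open>e \<in> E k\<close> by (auto simp: E_def)
      then show ?thesis using redge_cell[OF ij(1,2)] cell_subset[OF ij(1,2)] by (simp add: row_cell col)
    qed
    show "finite (E k)" for k by (simp add: E_def)
    show "card (E k) = k ^ 2" for k unfolding E_def
      by (simp add: card_image[OF inj] card_cartesian_product power2_eq_square)
    have bound: "card A * k \<le> k ^ 2" if "A \<subseteq> g ` {..<k}" for A :: "nat set set" and g k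
    proof -
      have "card A \<le> card (g ` {..<k})" by (rule card_mono[OF _ that]) simp
      also have "\<dots> \<le> k" using card_image_le[of "{..<k}" g] by simp
      finally have "card A * k \<le> k * k" by (rule mult_right_mono) simp
      then show ?thesis by (simp add: power2_eq_square)
    qed
    show "card {e \<in> E k. row e = i} * k \<le> k ^ 2" for k i
      by (rule bound[of _ "cell k i"]) (auto simp: E_def row_cell)
    show "card {e \<in> E k. col k e = j} * k \<le> k ^ 2" for k j
      by (rule bound[of _ "\<lambda>i. cell k i j"]) (auto simp: E_def col)
    show "e \<inter> f = {} \<and> (\<exists>X\<in>{P, Q}. forms e f X)"
      if ef: "e \<in> E k" "f \<in> E k" "row e \<noteq> row f" "col k e \<noteq> col k f" for k e f
    proof -
      obtain i j i' j' where i: "i < k" "j < k" "i' < k" "j' < k" "e = cell k i j" "f = cell k i' j'"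
        using ef(1,2) by (auto simp: E_def)
      then have ne: "i \<noteq> i'" "j \<noteq> j'" using ef(3,4) row_cell col by auto
      show ?thesis using cell_disjoint[OF i(1-4) ne] cell_forms[OF i(1-4) ne] unfolding i(5,6) by simp
    qed
  qed
  show ?thesis by (rule lower_bound)
qed

section \<open>Assembling the three cases\<close>

lemma aas_sandwich:
  assumes r: "r \<ge> 1" and lo: "\<exists>c>0. aas (\<lambda>n M. c * x n \<le> z n M) r"
    and up: "\<exists>C>0. aas (\<lambda>n M. z n M \<le> C * x n) r" and x: "\<And>n. x n \<ge> (0::real)"
  shows "\<exists>c C. 0 < c \<and> c < C \<and> aas (\<lambda>n M. c * x n \<le> z n M \<and> z n M \<le> C * x n) r"
proof -
  obtain c where c: "c > 0" "aas (\<lambda>n M. c * x n \<le> z n M) r" using lo by blast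
  obtain C where C: "C > 0" "aas (\<lambda>n M. z n M \<le> C * x n) r" using up by blast
  \<comment> \<open>\<open>C + c\<close> replaces \<open>C\<close> so that the two constants are
    strictly ordered.\<close>
  have "aas (\<lambda>n M. c * x n \<le> z n M \<and> z n M \<le> (C + c) * x n) r"
  proof (rule aas_mono[OF r aas_conj[OF c(2) C(2)]], intro always_eventually allI ballI impI)
    fix n M assume "c * x n \<le> z n M \<and> z n M \<le> C * x n"
    moreover have "c * x n \<ge> 0" using c(1) x[of n] by simp
    ultimately show "c * x n \<le> z n M \<and> z n M \<le> (C + c) * x n" by (simp add: distrib_right)
  qed
  then show ?thesis using c C by (intro exI[of _ c] exI[of _ "C + c"]) auto
qed

lemma mismatch_upper_bound:
  assumes P: "is_pattern r P" and Q: "is_pattern r Q" and m: "mismatch P Q" and r: "r \<ge> 1"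
  shows "\<exists>C>0. aas (\<lambda>n M. real (z_of r {P, Q} M) \<le> C * real n powr (1 / real r)) r"
proof -
  obtain i j where ij: "i < j" "j < r" "separated P i j \<noteq> separated Q i j"
    using mismatch_separated[OF P Q m] by blast
  have "card (cliques r {P, Q} N k) * fact k ^ r \<le> N ^ (r * k)" for N k
  proof (cases "separated P i j")
    case True
    then show ?thesis using card_separated_cliques[OF ij(1,2) True] ij(3) by simp
  next
    case False
    then show ?thesis using card_separated_cliques[OF ij(1,2) _ False, of Q] ij(3) by (simp add: insert_commute)
  qed
  then show ?thesis by (rule upper_bound[OF r r])
qed

text \<open>In a mismatch at least one pattern is collectable, and cliques of that pattern alone
  suffice.\<close>

lemma mismatch_lower_bound:
  assumes "is_pattern r P" "is_pattern r Q" "mismatch P Q"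
  shows "\<exists>c>0. aas (\<lambda>n M. c * real n powr (1 / real r) \<le> real (z_of r {P, Q} M)) r"
proof -
  obtain X ts where "X \<in> {P, Q}" "has_composition X ts"
    using assms(3) by (auto simp: mismatch_def collectable_def)
  then show ?thesis using collectable_lower_bound[of r X ts "{P, Q}"] assms(1,2) by auto
qed

lemma harmonious_common_composition:
  assumes "harmonious P Q"
  obtains ts where "has_composition P ts" "has_composition Q ts"
proof -
  obtain ts us where "has_composition P ts" "has_composition Q us"
    using assms by (auto simp: harmonious_def collectable_def)
  moreover have "ts = us" using composition_eq[OF calculation(1)] composition_eq[OF calculation(2)] assms
    by (simp add: harmonious_def)
  ultimately show ?thesis using that by simp
qed

lemma harmonious_upper_bound:
  assumes P: "is_pattern r P" "has_composition P ts" and Q: "is_pattern r Q" "has_composition Q ts"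
    and ne: "P \<noteq> Q" and r2: "r \<ge> 2"
  shows "\<exists>C>0. aas (\<lambda>n M. real (z_of r {P, Q} M) \<le> C * real n powr (1 / real (r - 1))) r"
proof -
  obtain j where j: "j < r" "before P j j \<noteq> before Q j j" using sign_differs[OF P Q ne] by blast
  show ?thesis
    by (rule upper_bound) (use r2 card_sign_cliques[OF j is_pattern_before_0[OF P(1)] is_pattern_before_0[OF Q(1)]] in auto)
qed

text \<open>The upper bound is deterministic; for the lower one it suffices that a single extremal
  clique appears.\<close>

lemma noncollectable_aas:
  assumes "is_pattern r P" "is_pattern r Q" "\<not> collectable P" "\<not> collectable Q" and r: "r \<ge> 1"
  shows "aas (\<lambda>n M. z_of r {P, Q} M = z_global r {P, Q}) r"
proof -
  note bdd = noncollectable_z_global(1)[OF assms(1,3,2,4)]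
  obtain K where K: "is_clique r {P, Q} K" "card K = z_global r {P, Q}" using z_global_attained[OF bdd] .
  show ?thesis
  proof (rule aas_mono[OF r contains_fixed_clique[OF r K(1)]], intro always_eventually allI ballI impI)
    fix n M assume "M \<in> matchings r n" "card K \<le> z_of r {P, Q} M"
    then show "z_of r {P, Q} M = z_global r {P, Q}"
      using z_of_le_z_global[OF bdd finite_matching] K(2) by (simp add: le_antisym)
  qed
qed

theorem theorem2p2:
  fixes r :: nat and P Q :: "bool list"
  assumes "r \<ge> 2" and "is_pattern r P" and "is_pattern r Q" and "P \<noteq> Q"
  shows
    "(harmonious P Q \<longrightarrow>
       (\<exists>c C :: real. 0 < c \<and> c < C \<and>
          aas (\<lambda>n M. c * real n powr (1 / (real r - 1)) \<le> real (z_of r {P, Q} M) \<and>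
                      real (z_of r {P, Q} M) \<le> C * real n powr (1 / (real r - 1))) r)) \<and>
     (mismatch P Q \<longrightarrow>
       (\<exists>c C :: real. 0 < c \<and> c < C \<and>
          aas (\<lambda>n M. c * real n powr (1 / real r) \<le> real (z_of r {P, Q} M) \<and>
                      real (z_of r {P, Q} M) \<le> C * real n powr (1 / real r)) r)) \<and>
     (\<not> collectable P \<and> \<not> collectable Q \<longrightarrow>
       bdd_above (clique_sizes r {P, Q}) \<and>
       2 \<le> z_global r {P, Q} \<and> z_global r {P, Q} \<le> 5 \<and>
       aas (\<lambda>n M. z_of r {P, Q} M = z_global r {P, Q}) r)"
proof (intro conjI impI)
  have r: "r \<ge> 1" and r1: "real r - 1 = real (r - 1)" using assms(1) by (simp_all add: of_nat_diff)
  assume "harmonious P Q"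
  then obtain ts where ts: "has_composition P ts" "has_composition Q ts"
    by (rule harmonious_common_composition)
  show "\<exists>c C :: real. 0 < c \<and> c < C \<and>
          aas (\<lambda>n M. c * real n powr (1 / (real r - 1)) \<le> real (z_of r {P, Q} M) \<and>
                      real (z_of r {P, Q} M) \<le> C * real n powr (1 / (real r - 1))) r"
    unfolding r1
    by (rule aas_sandwich[OF r harmonious_lower_bound[OF assms(2) ts(1) assms(3) ts(2) assms(4,1)]
          harmonious_upper_bound[OF assms(2) ts(1) assms(3) ts(2) assms(4,1)]]) simp
next
  have r: "r \<ge> 1" using assms(1) by simp
  assume m: "mismatch P Q"
  show "\<exists>c C :: real. 0 < c \<and> c < C \<and>
          aas (\<lambda>n M. c * real n powr (1 / real r) \<le> real (z_of r {P, Q} M) \<and>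
                      real (z_of r {P, Q} M) \<le> C * real n powr (1 / real r)) r"
    by (rule aas_sandwich[OF r mismatch_lower_bound[OF assms(2,3) m] mismatch_upper_bound[OF assms(2,3) m r]]) simp
next
  have r: "r \<ge> 1" using assms(1) by simp
  assume nc: "\<not> collectable P \<and> \<not> collectable Q"
  show "bdd_above (clique_sizes r {P, Q})" "2 \<le> z_global r {P, Q}" "z_global r {P, Q} \<le> 5"
    using noncollectable_z_global[OF assms(2) _ assms(3)] nc by simp_all
  show "aas (\<lambda>n M. z_of r {P, Q} M = z_global r {P, Q}) r"
    using noncollectable_aas[OF assms(2,3) _ _ r] nc by blast
qed

end
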